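(* Let $V$ be a complex vector space of dimension $4$, let $\Lambda : \mathrm{GL}(V) \to \mathrm{GL}(\wedge^2 V)$, $g \mapsto \wedge^2 g$, let $j$ be a primitive cube root of unity in $\mathbb{C}$, let $E_6 \subset \mathrm{O}(\wedge^2 V)$ be a Weyl group of type $E_6$ realized as a finite subgroup generated by reflections, and let $$W = \Lambda^{-1}\bigl(\langle \mathrm{D}(E_6),\, j\,\mathrm{Id}_{\wedge^2 V}\rangle\bigr) \subset \mathrm{GL}(V).$$ Then the group $W$ is isomorphic to the Shephard-Todd reflection group $G_{32}$.
   Context: Fix a generator $\varepsilon$ of the one-dimensional space $\wedge^4 V$, which identifies $\wedge^4 V$ with $\mathbb{C}$. The form $\beta_\wedge : \wedge^2 V \times \wedge^2 V \to \mathbb{C}$, $(x,y) \mapsto x\wedge y$, is a non-degenerate symmetric bilinear form on the $6$-dimensional space $\wedge^2 V$, and $\mathrm{O}(\wedge^2 V) = \mathrm{O}(\wedge^2 V,\beta_\wedge)$ denotes its orthogonal group. $E_6$ denotes the Weyl group of type $E_6$, viewed through its (complexified) $6$-dimensional reflection representation as a finite subgroup of $\mathrm{O}(\wedge^2 V)$ generated by reflections. $\mathrm{D}(G)$ denotes the derived subgroup of a group $G$. $G_{32}$ denotes the group numbered $32$ in the Shephard-Todd classification of irreducible finite complex reflection groups: it is, up to conjugacy, the irreducible primitive complex reflection group of rank $4$ with degrees $12, 18, 24, 30$. *)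

theory Defs
  imports "HOL-Analysis.Analysis" "HOL-Algebra.Algebra"
begin

text \<open>
  A complex vector space is given by a scalar multiplication
  \<open>s :: complex \<Rightarrow> 'v \<Rightarrow> 'v\<close> with \<^term>\<open>vector_space s\<close>; the whole type \<open>'v\<close> is the space.
\<close>

section \<open>Linear groups\<close>

definition GL :: "(complex \<Rightarrow> 'v::ab_group_add \<Rightarrow> 'v) \<Rightarrow> ('v \<Rightarrow> 'v) monoid" where
  "GL s = \<lparr>carrier = {g. Vector_Spaces.linear s s g \<and> bij g}, monoid.mult = (\<circ>), one = id\<rparr>"

definition orthogonal_group ::
    "(complex \<Rightarrow> 'v::ab_group_add \<Rightarrow> 'v) \<Rightarrow> ('v \<Rightarrow> 'v \<Rightarrow> complex) \<Rightarrow> ('v \<Rightarrow> 'v) set" where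
  "orthogonal_group s \<beta> = {g \<in> carrier (GL s). \<forall>x y. \<beta> (g x) (g y) = \<beta> x y}"

definition is_reflection :: "(complex \<Rightarrow> 'v::ab_group_add \<Rightarrow> 'v) \<Rightarrow> ('v \<Rightarrow> 'v) \<Rightarrow> bool" where
  "is_reflection s g \<longleftrightarrow>
     g \<in> carrier (GL s) \<and> vector_space.dim s {v. g v = v} + 1 = vector_space.dim s UNIV"

section \<open>Exterior powers\<close>

text \<open>A $k$-linear map is represented by a function of which only the values on lists of
  length $k$ matter.\<close>

definition alternating_map ::
    "nat \<Rightarrow> (complex \<Rightarrow> 'v::ab_group_add \<Rightarrow> 'v) \<Rightarrow> (complex \<Rightarrow> 'e::ab_group_add \<Rightarrow> 'e)
     \<Rightarrow> ('v list \<Rightarrow> 'e) \<Rightarrow> bool" where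
  "alternating_map k s t f \<longleftrightarrow>
     (\<forall>vs i. length vs = k \<and> i < k \<longrightarrow> Vector_Spaces.linear s t (\<lambda>x. f (vs[i := x]))) \<and>
     (\<forall>vs i j. length vs = k \<and> i < j \<and> j < k \<and> vs ! i = vs ! j \<longrightarrow> f vs = 0)"

text \<open>
  The universal property of the $k$-th exterior power, with \<open>w [v\<^sub>1, \<dots>, v\<^sub>k]\<close> playing the
  role of $v_1 \wedge \dots \wedge v_k$.  HOL cannot quantify over all codomain types inside a
  formula, so the property is stated for scalar-valued maps; as linear functionals separate the
  points of any vector space, this gives the universal property for every codomain.
\<close>

definition is_exterior_power ::
    "nat \<Rightarrow> (complex \<Rightarrow> 'v::ab_group_add \<Rightarrow> 'v) \<Rightarrow> (complex \<Rightarrow> 'e::ab_group_add \<Rightarrow> 'e)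
     \<Rightarrow> ('v list \<Rightarrow> 'e) \<Rightarrow> bool" where
  "is_exterior_power k s t w \<longleftrightarrow>
     vector_space s \<and> vector_space t \<and> alternating_map k s t w \<and>
     (\<forall>f. alternating_map k s ((*) :: complex \<Rightarrow> complex \<Rightarrow> complex) f \<longrightarrow>
        (\<exists>!\<phi>. Vector_Spaces.linear t (*) \<phi> \<and> (\<forall>vs. length vs = k \<longrightarrow> \<phi> (w vs) = f vs)))"

definition exterior_power_map ::
    "nat \<Rightarrow> (complex \<Rightarrow> 'e::ab_group_add \<Rightarrow> 'e) \<Rightarrow> ('v list \<Rightarrow> 'e) \<Rightarrow> ('v \<Rightarrow> 'v) \<Rightarrow> 'e \<Rightarrow> 'e" where
  "exterior_power_map k t w g =
     (THE h. Vector_Spaces.linear t t h \<and>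
        (\<forall>vs. length vs = k \<longrightarrow> h (w vs) = w (map g vs)))"

text \<open>The product $\wedge^p V \times \wedge^q V \to \wedge^{p+q} V$.\<close>

definition exterior_product ::
    "nat \<Rightarrow> nat \<Rightarrow> (complex \<Rightarrow> 'e::ab_group_add \<Rightarrow> 'e) \<Rightarrow> (complex \<Rightarrow> 'f::ab_group_add \<Rightarrow> 'f)
     \<Rightarrow> (complex \<Rightarrow> 'h::ab_group_add \<Rightarrow> 'h)
     \<Rightarrow> ('v list \<Rightarrow> 'e) \<Rightarrow> ('v list \<Rightarrow> 'f) \<Rightarrow> ('v list \<Rightarrow> 'h) \<Rightarrow> 'e \<Rightarrow> 'f \<Rightarrow> 'h" where
  "exterior_product p q t t' t'' w w' w'' =
     (THE m. (\<forall>x. Vector_Spaces.linear t' t'' (m x)) \<and>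
             (\<forall>y. Vector_Spaces.linear t t'' (\<lambda>x. m x y)) \<and>
             (\<forall>us vs. length us = p \<and> length vs = q \<longrightarrow> m (w us) (w' vs) = w'' (us @ vs)))"

text \<open>The form $\beta_\wedge$ on $\wedge^2 V$, where the generator \<open>\<epsilon>\<close> of the line $\wedge^4 V$
  (with scalar multiplication \<open>t4\<close>) identifies it with the complex numbers.\<close>

definition beta_wedge ::
    "(complex \<Rightarrow> 'e::ab_group_add \<Rightarrow> 'e) \<Rightarrow> (complex \<Rightarrow> 'f::ab_group_add \<Rightarrow> 'f)
     \<Rightarrow> ('v list \<Rightarrow> 'e) \<Rightarrow> ('v list \<Rightarrow> 'f) \<Rightarrow> 'f \<Rightarrow> 'e \<Rightarrow> 'e \<Rightarrow> complex" where
  "beta_wedge t2 t4 w2 w4 \<epsilon> x y =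
     (THE c. exterior_product 2 2 t2 t2 t4 w2 w2 w4 x y = t4 c \<epsilon>)"

section \<open>The Weyl group of type $E_6$\<close>

text \<open>Bourbaki numbering: the chain 1 - 3 - 4 - 5 - 6, with 2 attached to 4.\<close>

definition E6_edges :: "(nat \<times> nat) set" where
  "E6_edges = {(1,3), (3,4), (4,5), (5,6), (2,4)}"

definition cartan_E6 :: "nat \<Rightarrow> nat \<Rightarrow> complex" where
  "cartan_E6 i j =
     (if i = j then 2 else if (i, j) \<in> E6_edges \<or> (j, i) \<in> E6_edges then - 1 else 0)"

text \<open>
  \<open>H\<close> is the image of the Weyl group of type $E_6$ under its complexified reflection
  representation: \<open>\<alpha>\<close> is a basis of simple roots and \<open>\<sigma> i\<close> is the simple reflection
  $\alpha_j \mapsto \alpha_j - C_{ij} \alpha_i$.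
\<close>

definition is_weyl_group_E6 ::
    "(complex \<Rightarrow> 'e::ab_group_add \<Rightarrow> 'e) \<Rightarrow> ('e \<Rightarrow> 'e) set \<Rightarrow> bool" where
  "is_weyl_group_E6 t H \<longleftrightarrow>
     (\<exists>(\<alpha> :: nat \<Rightarrow> 'e) (\<sigma> :: nat \<Rightarrow> 'e \<Rightarrow> 'e).
        inj_on \<alpha> {1..6} \<and> \<not> module.dependent t (\<alpha> ` {1..6}) \<and>
        module.span t (\<alpha> ` {1..6}) = UNIV \<and>
        (\<forall>i\<in>{1..6}. \<sigma> i \<in> carrier (GL t) \<and>
           (\<forall>j\<in>{1..6}. \<sigma> i (\<alpha> j) = \<alpha> j - t (cartan_E6 i j) (\<alpha> i))) \<and>
        H = generate (GL t) (\<sigma> ` {1..6}))"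

section \<open>Complex reflection groups\<close>

definition is_reflection_group ::
    "(complex \<Rightarrow> 'v::ab_group_add \<Rightarrow> 'v) \<Rightarrow> ('v \<Rightarrow> 'v) set \<Rightarrow> bool" where
  "is_reflection_group s G \<longleftrightarrow>
     subgroup G (GL s) \<and> finite G \<and> generate (GL s) {g \<in> G. is_reflection s g} = G"

definition irreducible_group ::
    "(complex \<Rightarrow> 'v::ab_group_add \<Rightarrow> 'v) \<Rightarrow> ('v \<Rightarrow> 'v) set \<Rightarrow> bool" where
  "irreducible_group s G \<longleftrightarrow>
     (UNIV :: 'v set) \<noteq> {0} \<and>
     (\<forall>U. module.subspace s U \<and> (\<forall>g\<in>G. g ` U \<subseteq> U) \<longrightarrow> U = {0} \<or> U = UNIV)"

definition is_direct_sum ::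
    "(complex \<Rightarrow> 'v::ab_group_add \<Rightarrow> 'v) \<Rightarrow> 'v set set \<Rightarrow> bool" where
  "is_direct_sum s \<U> \<longleftrightarrow>
     finite \<U> \<and> (\<forall>U\<in>\<U>. module.subspace s U) \<and>
     (\<forall>v. \<exists>!u. (\<forall>U\<in>\<U>. u U \<in> U) \<and> (\<forall>U. U \<notin> \<U> \<longrightarrow> u U = 0) \<and> v = (\<Sum>U\<in>\<U>. u U))"

text \<open>Primitive: there is no decomposition of the space into at least two nonzero summands
  that are permuted by the group (no transitivity required; it is automatic for irreducible
  groups).\<close>

definition primitive_group ::
    "(complex \<Rightarrow> 'v::ab_group_add \<Rightarrow> 'v) \<Rightarrow> ('v \<Rightarrow> 'v) set \<Rightarrow> bool" where
  "primitive_group s G \<longleftrightarrow>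
     \<not> (\<exists>\<U>. is_direct_sum s \<U> \<and> card \<U> \<ge> 2 \<and> {0} \<notin> \<U> \<and> (\<forall>g\<in>G. \<forall>U\<in>\<U>. g ` U \<in> \<U>))"

text \<open>The algebra of functions generated by a set of functions.  Over the complex numbers
  polynomials may be identified with polynomial functions.\<close>

inductive_set subalgebra_gen :: "('a \<Rightarrow> complex) set \<Rightarrow> ('a \<Rightarrow> complex) set"
  for S :: "('a \<Rightarrow> complex) set" where
  base: "f \<in> S \<Longrightarrow> f \<in> subalgebra_gen S"
| const: "(\<lambda>_. c) \<in> subalgebra_gen S"
| add: "f \<in> subalgebra_gen S \<Longrightarrow> g \<in> subalgebra_gen S \<Longrightarrow> (\<lambda>x. f x + g x) \<in> subalgebra_gen S"
| mult: "f \<in> subalgebra_gen S \<Longrightarrow> g \<in> subalgebra_gen S \<Longrightarrow> (\<lambda>x. f x * g x) \<in> subalgebra_gen S"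

definition polynomial_functions ::
    "(complex \<Rightarrow> 'v::ab_group_add \<Rightarrow> 'v) \<Rightarrow> ('v \<Rightarrow> complex) set" where
  "polynomial_functions s = subalgebra_gen {\<phi>. Vector_Spaces.linear s (*) \<phi>}"

definition invariant_ring ::
    "(complex \<Rightarrow> 'v::ab_group_add \<Rightarrow> 'v) \<Rightarrow> ('v \<Rightarrow> 'v) set \<Rightarrow> ('v \<Rightarrow> complex) set" where
  "invariant_ring s G = {f \<in> polynomial_functions s. \<forall>g\<in>G. \<forall>v. f (g v) = f v}"

text \<open>Polynomials in the variables \<open>y 0, \<dots>, y (n - 1)\<close>.\<close>

definition polynomials_in :: "nat \<Rightarrow> ((nat \<Rightarrow> complex) \<Rightarrow> complex) set" where
  "polynomials_in n = subalgebra_gen {\<lambda>y. y i | i. i < n}"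

definition algebraically_independent :: "nat \<Rightarrow> (nat \<Rightarrow> 'v \<Rightarrow> complex) \<Rightarrow> bool" where
  "algebraically_independent n f \<longleftrightarrow>
     (\<forall>P\<in>polynomials_in n. (\<forall>v. P (\<lambda>i. f i v) = 0) \<longrightarrow> (\<forall>y. P y = 0))"

text \<open>The list \<open>ds\<close> (in any order) consists of the degrees of \<open>G\<close>: its invariant ring is a
  polynomial algebra on homogeneous generators of these degrees.\<close>

definition has_degrees ::
    "(complex \<Rightarrow> 'v::ab_group_add \<Rightarrow> 'v) \<Rightarrow> ('v \<Rightarrow> 'v) set \<Rightarrow> nat list \<Rightarrow> bool" where
  "has_degrees s G ds \<longleftrightarrow>
     length ds = vector_space.dim s UNIV \<and>
     (\<exists>f :: nat \<Rightarrow> 'v \<Rightarrow> complex.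
        (\<forall>i<length ds. \<forall>c v. f i (s c v) = c ^ (ds ! i) * f i v) \<and>
        algebraically_independent (length ds) f \<and>
        invariant_ring s G = subalgebra_gen (f ` {..<length ds}))"

text \<open>\<open>G\<close> is a realization, in the linear group of a space of dimension 4, of the group
  $G_{32}$ of the Shephard-Todd classification; such a \<open>G\<close> is unique up to conjugacy.\<close>

definition is_shephard_todd_G32 ::
    "(complex \<Rightarrow> 'v::ab_group_add \<Rightarrow> 'v) \<Rightarrow> ('v \<Rightarrow> 'v) set \<Rightarrow> bool" where
  "is_shephard_todd_G32 s G \<longleftrightarrow>
     vector_space s \<and> vector_space.dim s UNIV = 4 \<and>
     is_reflection_group s G \<and> irreducible_group s G \<and> primitive_group s G \<and>
     has_degrees s G [12, 18, 24, 30]"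

end

theory Submission
  imports Defs "HOL-Computational_Algebra.Polynomial"
begin

text \<open>
  The group is recognised in three steps.

  \<^bold>\<open>Spin lifts.\<close>  In coordinates the exterior square is the space of skew-symmetric
  $4 \times 4$ matrices, on which \<open>g\<close> acts by \<open>S \<mapsto> g ** S ** transpose g\<close>, and the form
  $\beta_\wedge$ is a multiple of the polarised Pfaffian (\<open>beta_wedge_eq_pfb\<close>).  Pfaffian and
  complementary matrix satisfy the Clifford relation, so the product of the reflections in \<open>A\<close> and
  \<open>B\<close> is induced by the matrix \<open>A ** dual B\<close> (\<open>act_mult_dual\<close>).  As orthogonal maps are products of
  reflections, every similitude of the exterior square is induced by a linear map of the
  space, possibly after one reflection (\<open>similitude_lift\<close>).  This moves the simple roots of $E_6$
  to multiples of six explicit matrices (\<open>simple_system_normal_form\<close>); in the improper case the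
  simple system is first replaced by its image under a simple reflection.

  \<^bold>\<open>The preimage.\<close>  The derived group of $E_6$ consists of the even words in the simple
  reflections, and a product of two of these lifts to a matrix \<open>spin (i, k)\<close>.  Up to scalars, these
  lifts and four reflections \<open>rmat b\<close> of order three can be written as words in each other
  (\<open>spin_in_G32\<close>, \<open>rmat_eq_spin_product\<close>).  The four reflections generate a group that contains the
  sixth roots of unity, in particular the kernel $\pm 1$ of the action on the exterior square, so
  this group is the preimage (\<open>preimage_eq_G32\<close>).

  \<^bold>\<open>Recognition.\<close>  Up to sixth roots of unity the group permutes the 40 linear forms of the
  Witting configuration.  Hence it is finite; it is irreducible because the diagram of its four
  generators is connected, and primitive because a reflection of order three cannot move a summand
  of a direct sum decomposition that it permutes (\<open>reflection_fixes_summand\<close>).  The power sums of the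
  40 forms of degrees 12, 18, 24 and 30 are invariant.  Their Jacobian determinant has degree
  $11 + 17 + 23 + 29 = 2 \cdot 40$ and is divisible by the squares of the 40 forms, so it is a
  nonzero multiple of the product of these squares.  If \<open>h\<close> is a homogeneous invariant, then the
  numerators in Cramer's rule for expressing the differential of \<open>h\<close> through those of the power
  sums are divisible by the same squares, hence by the Jacobian determinant.  The quotients
  are invariants of smaller degree, and Euler's identity expresses \<open>h\<close> through them and the power
  sums (\<open>homogeneous_invariant_in_R\<close>).
\<close>

section \<open>Polynomial functions on coordinate space\<close>

abbreviation Poly :: "(complex ^ 'n \<Rightarrow> complex) set" where
  "Poly \<equiv> polynomial_functions (*s)"

lemma linear_form_expand:
  fixes \<phi> :: "complex ^ 'n \<Rightarrow> complex"
  assumes "Vector_Spaces.linear (*s) (*) \<phi>"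
  shows "\<phi> v = (\<Sum>i\<in>UNIV. \<phi> (axis i 1) * v $ i)"
proof -
  interpret l: Vector_Spaces.linear "(*s)" "(*)" \<phi> by fact
  have "\<phi> v = \<phi> (\<Sum>i\<in>UNIV. v $ i *s axis i 1)" by (simp add: basis_expansion)
  then show ?thesis by (simp add: l.sum l.scale mult.commute)
qed

lemma linear_form_sum: "Vector_Spaces.linear (*s) (*) (\<lambda>v::complex ^ 'n. \<Sum>i\<in>UNIV. a i * v $ i)"
  by unfold_locales (auto simp: algebra_simps sum.distrib sum_distrib_left)

lemma linear_form_coord: "Vector_Spaces.linear (*s) (*) (\<lambda>v::complex ^ 'n. v $ i)"
  by unfold_locales (auto simp: algebra_simps)

lemma Poly_linear: "Vector_Spaces.linear (*s) (*) \<phi> \<Longrightarrow> \<phi> \<in> Poly"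
  unfolding polynomial_functions_def by (rule subalgebra_gen.base) simp

lemma Poly_const: "(\<lambda>_. c) \<in> Poly"
  unfolding polynomial_functions_def by (rule subalgebra_gen.const)

lemma Poly_add: "f \<in> Poly \<Longrightarrow> g \<in> Poly \<Longrightarrow> (\<lambda>v. f v + g v) \<in> Poly"
  unfolding polynomial_functions_def by (rule subalgebra_gen.add)

lemma Poly_mult: "f \<in> Poly \<Longrightarrow> g \<in> Poly \<Longrightarrow> (\<lambda>v. f v * g v) \<in> Poly"
  unfolding polynomial_functions_def by (rule subalgebra_gen.mult)

lemma Poly_coord: "(\<lambda>v. v $ i) \<in> Poly"
  by (rule Poly_linear[OF linear_form_coord])

lemma Poly_scale: "f \<in> Poly \<Longrightarrow> (\<lambda>v. c * f v) \<in> Poly"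
  by (rule Poly_mult[OF Poly_const])

lemma Poly_diff: "f \<in> Poly \<Longrightarrow> g \<in> Poly \<Longrightarrow> (\<lambda>v. f v - g v) \<in> Poly"
  using Poly_add[OF _ Poly_scale[of g "-1"], of f] by simp

lemma Poly_sum: "(\<And>i. i \<in> I \<Longrightarrow> f i \<in> Poly) \<Longrightarrow> (\<lambda>v. \<Sum>i\<in>I. f i v) \<in> Poly"
  by (induction I rule: infinite_finite_induct) (auto intro: Poly_const Poly_add)

lemma Poly_prod: "(\<And>i. i \<in> I \<Longrightarrow> f i \<in> Poly) \<Longrightarrow> (\<lambda>v. \<Prod>i\<in>I. f i v) \<in> Poly"
  by (induction I rule: infinite_finite_induct) (auto intro: Poly_const Poly_mult)

lemma Poly_power: "f \<in> Poly \<Longrightarrow> (\<lambda>v. f v ^ k) \<in> Poly"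
  by (induction k) (auto intro: Poly_const Poly_mult)

lemma Poly_det: "(\<And>i k. (\<lambda>v. M v $ i $ k) \<in> Poly) \<Longrightarrow> (\<lambda>v. det (M v)) \<in> Poly"
  unfolding det_def by (intro Poly_sum Poly_mult Poly_const Poly_prod)

text \<open>Induction over the constants and the coordinates only, which generate the same algebra.\<close>

lemma Poly_induct [consumes 1, case_names coord const add mult]:
  fixes P :: "(complex ^ 'n \<Rightarrow> complex) \<Rightarrow> bool"
  assumes "f \<in> Poly" and coord: "\<And>i. P (\<lambda>v. v $ i)" and const: "\<And>c. P (\<lambda>_. c)"
    and add: "\<And>f g. f \<in> Poly \<Longrightarrow> g \<in> Poly \<Longrightarrow> P f \<Longrightarrow> P g \<Longrightarrow> P (\<lambda>v. f v + g v)"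
    and mult: "\<And>f g. f \<in> Poly \<Longrightarrow> g \<in> Poly \<Longrightarrow> P f \<Longrightarrow> P g \<Longrightarrow> P (\<lambda>v. f v * g v)"
  shows "P f"
proof -
  have "f \<in> subalgebra_gen {\<phi>. Vector_Spaces.linear (*s) (*) \<phi>}"
    using assms(1) by (simp add: polynomial_functions_def)
  then show ?thesis
  proof (induction rule: subalgebra_gen.induct)
    case (base f)
    have sum: "(\<lambda>v. \<Sum>i\<in>I. f (axis i 1) * v $ i) \<in> Poly
      \<and> P (\<lambda>v. \<Sum>i\<in>I. f (axis i 1) * v $ i)" if "finite I" for I
      using that
    proof (induction I rule: finite_induct)
      case empty
      show ?case using assms(3)[of 0] Poly_const[of 0] by simp
    next
      case (insert i I)
      have 1: "(\<lambda>v. f (axis i 1) * v $ i) \<in> Poly" by (rule Poly_scale[OF Poly_coord])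
      have 2: "P (\<lambda>v. f (axis i 1) * v $ i)"
        by (rule assms(5)[OF Poly_const Poly_coord assms(3) assms(2)])
      show ?case
        using Poly_add[OF 1, of "\<lambda>v. \<Sum>i\<in>I. f (axis i 1) * v $ i"]
          assms(4)[OF 1 _ 2, of "\<lambda>v. \<Sum>i\<in>I. f (axis i 1) * v $ i"] insert
        by simp
    qed
    have "f = (\<lambda>v. \<Sum>i\<in>UNIV. f (axis i 1) * v $ i)"
      by (rule ext, rule linear_form_expand) (use base in simp)
    then show ?case using sum[of UNIV] by simp
  next
    case (const c) then show ?case by (rule assms(3))
  next
    case (add f g)
    then show ?case by (intro assms(4)) (simp_all add: polynomial_functions_def)
  next
    case (mult f g)
    then show ?case by (intro assms(5)) (simp_all add: polynomial_functions_def)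
  qed
qed

lemma Poly_compose:
  assumes "f \<in> Poly"
  shows "(\<lambda>v. f (A *v v)) \<in> Poly"
  using assms
proof (induction rule: Poly_induct)
  case (coord i)
  show ?case
    unfolding matrix_vector_mult_def by (auto intro!: Poly_sum Poly_scale Poly_coord)
qed (auto intro: Poly_const Poly_add Poly_mult)

lemma mat_mult_vec: "mat c *v v = c *s v" for v :: "complex ^ 'n"
  by (simp add: mat_def matrix_vector_mult_def vec_eq_iff if_distrib[of "\<lambda>x. x * _"] sum.delta
      cong: if_cong)

lemma Poly_scale_arg:
  assumes "f \<in> Poly"
  shows "(\<lambda>v. f (c *s v)) \<in> Poly"
  using Poly_compose[OF assms, of "mat c"] by (simp add: mat_mult_vec)

lemma Poly_line:
  assumes "f \<in> Poly"
  shows "\<exists>p. \<forall>t. f (v + t *s u) = poly p t"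
  using assms
proof (induction rule: Poly_induct)
  case (coord i)
  show ?case by (rule exI[of _ "[:v $ i, u $ i:]"]) simp
next
  case (const c)
  show ?case by (rule exI[of _ "[:c:]"]) simp
next
  case (add f g)
  then obtain p q where "\<forall>t. f (v + t *s u) = poly p t" "\<forall>t. g (v + t *s u) = poly q t"
    by blast
  then show ?case by (intro exI[of _ "p + q"]) simp
next
  case (mult f g)
  then obtain p q where "\<forall>t. f (v + t *s u) = poly p t" "\<forall>t. g (v + t *s u) = poly q t"
    by blast
  then show ?case by (intro exI[of _ "p * q"]) simp
qed

lemma poly_eq_if_eq_nonzero:
  fixes p q :: "complex poly"
  assumes "\<And>t. t \<noteq> 0 \<Longrightarrow> poly p t = poly q t"
  shows "p = q"
proof (rule ccontr)
  assume "p \<noteq> q"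
  then have "finite {t. poly (p - q) t = 0}" by (intro poly_roots_finite) simp
  moreover have "- {0} \<subseteq> {t. poly (p - q) t = 0}" using assms by auto
  ultimately have "finite (- {0::complex})" by (rule rev_finite_subset)
  then show False by (simp add: infinite_UNIV_char_0)
qed

text \<open>Restriction to a line reduces the cancellation of polynomial functions to polynomials in
  one variable.  Stating it on the kernel of a functional \<open>l\<close> also gives it on hyperplanes.\<close>

lemma Poly_cancel_on:
  assumes f: "f \<in> Poly" and g: "g \<in> Poly" and l: "Vector_Spaces.linear (*s) (*) l"
    and fg: "\<And>v. l v = 0 \<Longrightarrow> f v * g v = 0" and p: "l p = 0" "f p \<noteq> 0" and v: "l v = 0"
  shows "g v = 0"
proof -
  interpret l: Vector_Spaces.linear "(*s)" "(*)" l by fact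
  obtain P where P: "\<And>t. f (p + t *s (v - p)) = poly P t" using Poly_line[OF f] by blast
  obtain Q where Q: "\<And>t. g (p + t *s (v - p)) = poly Q t" using Poly_line[OF g] by blast
  have "poly (P * Q) t = poly 0 t" for t
    using fg[of "p + t *s (v - p)"] P Q p v by (simp add: l.add l.scale l.diff)
  then have "P * Q = 0" by (subst poly_eq_poly_eq_iff[symmetric]) auto
  moreover have "P \<noteq> 0" using P[of 0] p by auto
  ultimately have "Q = 0" by simp
  then show ?thesis using Q[of 1] by simp
qed

lemma Poly_cancel:
  fixes f g :: "complex ^ 'n \<Rightarrow> complex"
  assumes "f \<in> Poly" "g \<in> Poly" "\<And>v. f v * g v = 0" "f p \<noteq> 0"
  shows "g v = 0"
proof (rule Poly_cancel_on[OF assms(1,2) _ assms(3) refl assms(4) refl])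
  show "Vector_Spaces.linear (*s) (*) (\<lambda>_::complex ^ 'n. 0)"
    using linear_form_sum[of "\<lambda>_. 0"] by simp
qed

lemma Poly_eq_where_nonzero:
  assumes f: "f \<in> Poly" "f p \<noteq> 0" and gh: "g \<in> Poly" "h \<in> Poly"
    and eq: "\<And>v. f v \<noteq> 0 \<Longrightarrow> g v = h v"
  shows "g v = h v"
proof -
  have "f v * (g v - h v) = 0" for v using eq[of v] by auto
  from Poly_cancel[OF f(1) Poly_diff[OF gh] this f(2), of v] show ?thesis by simp
qed

section \<open>Homogeneous components\<close>

definition homog :: "nat \<Rightarrow> (complex ^ 'n \<Rightarrow> complex) \<Rightarrow> bool" where
  "homog d f \<longleftrightarrow> f \<in> Poly \<and> (\<forall>c v. f (c *s v) = c ^ d * f v)"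

lemma Poly_homog_sum:
  assumes "f \<in> Poly"
  shows "\<exists>N q. (\<forall>k. homog k (q k)) \<and> (\<forall>k>N. q k = (\<lambda>_. 0)) \<and> (\<forall>v. f v = (\<Sum>k\<le>N. q k v))"
  using assms
proof (induction rule: Poly_induct)
  case (coord i)
  show ?case
    by (rule exI[of _ 1], rule exI[of _ "\<lambda>k. if k = 1 then (\<lambda>v. v $ i) else (\<lambda>_. 0)"])
      (auto simp: homog_def intro: Poly_coord Poly_const)
next
  case (const c)
  show ?case
    by (rule exI[of _ 0], rule exI[of _ "\<lambda>k. if k = 0 then (\<lambda>v. c) else (\<lambda>_. 0)"])
      (auto simp: homog_def intro: Poly_const)
next
  case (add f g)
  then obtain N q M r where q: "\<And>k. homog k (q k)" "\<And>k. k > N \<Longrightarrow> q k = (\<lambda>_. 0)"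
      "\<And>v. f v = (\<Sum>k\<le>N. q k v)"
    and r: "\<And>k. homog k (r k)" "\<And>k. k > M \<Longrightarrow> r k = (\<lambda>_. 0)" "\<And>v. g v = (\<Sum>k\<le>M. r k v)"
    by metis
  have 1: "(\<Sum>k\<le>N. q k v) = (\<Sum>k\<le>max N M. q k v)" for v
    by (rule sum.mono_neutral_left) (auto simp: q(2))
  have 2: "(\<Sum>k\<le>M. r k v) = (\<Sum>k\<le>max N M. r k v)" for v
    by (rule sum.mono_neutral_left) (auto simp: r(2))
  show ?case
    by (rule exI[of _ "max N M"], rule exI[of _ "\<lambda>k v. q k v + r k v"])
      (use q r 1 2 in \<open>auto simp: homog_def algebra_simps sum.distrib intro!: Poly_add\<close>)
next
  case (mult f g)
  then obtain N q M r where q: "\<And>k. homog k (q k)" "\<And>k. k > N \<Longrightarrow> q k = (\<lambda>_. 0)"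
      "\<And>v. f v = (\<Sum>k\<le>N. q k v)"
    and r: "\<And>k. homog k (r k)" "\<And>k. k > M \<Longrightarrow> r k = (\<lambda>_. 0)" "\<And>v. g v = (\<Sum>k\<le>M. r k v)"
    by metis
  define s where "s k v = (\<Sum>i\<le>k. q i v * r (k - i) v)" for k v
  have "homog k (s k)" for k
  proof -
    have "s k \<in> Poly"
      using q(1) r(1) by (auto simp: s_def[abs_def] homog_def intro!: Poly_sum Poly_mult)
    moreover have "s k (c *s v) = c ^ k * s k v" for c v
    proof -
      have "q i (c *s v) * r (k - i) (c *s v) = c ^ k * (q i v * r (k - i) v)" if "i \<le> k" for i
      proof -
        have "c ^ k = c ^ i * c ^ (k - i)" using that by (simp flip: power_add)
        then show ?thesis using q(1)[of i] r(1)[of "k - i"] by (simp add: homog_def algebra_simps)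
      qed
      then show ?thesis by (simp add: s_def sum_distrib_left)
    qed
    ultimately show ?thesis by (simp add: homog_def)
  qed
  moreover have "s k = (\<lambda>_. 0)" if "k > N + M" for k
  proof
    fix v
    have "q i v * r (k - i) v = 0" if "i \<le> k" for i
      using q(2)[of i] r(2)[of "k - i"] \<open>k > N + M\<close> that by (cases "i > N") auto
    then show "s k v = 0" unfolding s_def by (intro sum.neutral) simp
  qed
  moreover have "f v * g v = (\<Sum>k\<le>N + M. s k v)" for v
    using polynomial_product[of N "\<lambda>i. q i v" M "\<lambda>i. r i v" 1]
    unfolding q(3) r(3) s_def by (simp add: q(2) r(2))
  ultimately show ?case by (intro exI[of _ "N + M"] exI[of _ s]) simp
qed

lemma homog_components_unique:
  fixes a b :: "nat \<Rightarrow> complex"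
  assumes "\<And>t. (\<Sum>k\<le>N. t ^ k * a k) = (\<Sum>k\<le>N. t ^ k * b k)" "k \<le> N"
  shows "a k = b k"
  using polyfun_eq_coeffs[where n=N and c=a and d=b] assms by (simp add: mult.commute)

text \<open>A quotient of homogeneous polynomials is known only through its behaviour under nonzero scalars.
  On a line through the origin that behaviour becomes an identity of polynomials in one variable.\<close>

lemma homog_if_shifted:
  assumes p: "p \<in> Poly" and eq: "\<And>c v. c \<noteq> 0 \<Longrightarrow> c ^ e * p (c *s v) = c ^ m * p v"
  shows "(e \<le> m \<and> homog (m - e) p) \<or> (\<forall>v. p v = 0)"
proof -
  have "c ^ e * p (c *s v) = c ^ m * p v" for c v
  proof -
    obtain P where P: "\<And>t. p (0 + t *s v) = poly P t" using Poly_line[OF p] by blast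
    have "Polynomial.monom 1 e * P = Polynomial.monom (p v) m"
    proof (rule poly_eq_if_eq_nonzero)
      fix t :: complex assume "t \<noteq> 0"
      then show "poly (Polynomial.monom 1 e * P) t = poly (Polynomial.monom (p v) m) t"
        using eq[of t v] P[of t] by (simp add: poly_monom mult.commute)
    qed
    then have "poly (Polynomial.monom 1 e * P) c = poly (Polynomial.monom (p v) m) c" by simp
    then show ?thesis using P[of c] by (simp add: poly_monom mult.commute)
  qed note all = this
  show ?thesis
  proof (cases "e \<le> m")
    case True
    have "p (c *s v) = c ^ (m - e) * p v" for c v
    proof -
      obtain P where P: "\<And>t. p (0 + t *s v) = poly P t" using Poly_line[OF p] by blast
      have "P = Polynomial.monom (p v) (m - e)"
      proof (rule poly_eq_if_eq_nonzero)
        fix t :: complex assume "t \<noteq> 0"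
        moreover have "t ^ m = t ^ e * t ^ (m - e)" using True by (simp flip: power_add)
        ultimately show "poly P t = poly (Polynomial.monom (p v) (m - e)) t"
          using all[of t v] P[of t] by (simp add: poly_monom mult.commute)
      qed
      then show ?thesis using P[of c] by (simp add: poly_monom mult.commute)
    qed
    then show ?thesis using True p by (simp add: homog_def)
  next
    case False
    have "p v = 0" for v
    proof -
      obtain P where P: "\<And>t. p (0 + t *s v) = poly P t" using Poly_line[OF p] by blast
      have "Polynomial.monom 1 (e - m) * P = [:p v:]"
      proof (rule poly_eq_if_eq_nonzero)
        fix t :: complex assume "t \<noteq> 0"
        moreover have "t ^ e = t ^ m * t ^ (e - m)" using False by (simp flip: power_add)
        ultimately show "poly (Polynomial.monom 1 (e - m) * P) t = poly [:p v:] t"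
          using all[of t v] P[of t] by (simp add: poly_monom)
      qed
      then have "poly (Polynomial.monom 1 (e - m) * P) 0 = p v" by simp
      then show ?thesis using False by (simp add: poly_monom power_0_left)
    qed
    then show ?thesis by blast
  qed
qed

section \<open>Gradients\<close>

definition grad :: "(complex ^ 'n \<Rightarrow> complex) \<Rightarrow> complex ^ 'n \<Rightarrow> complex ^ 'n" where
  "grad f v = (\<chi> i. frechet_derivative f (at v) (axis i 1))"

lemma Poly_has_gradient:
  fixes f :: "complex ^ 'n \<Rightarrow> complex"
  assumes "f \<in> Poly"
  shows "\<exists>D. (\<forall>i. D i \<in> Poly) \<and>
    (\<forall>v. (f has_derivative (\<lambda>u. \<Sum>i\<in>UNIV. D i v * u $ i)) (at v))"
  using assms
proof (induction rule: Poly_induct)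
  case (coord i)
  have "((\<lambda>v::complex ^ 'n. v $ i) has_derivative (\<lambda>u. \<Sum>k\<in>UNIV. (if k = i then 1 else 0) * u $ k)) (at v)" for v
    by (simp add: if_distrib[of "\<lambda>x. x * _"] sum.delta' cong: if_cong)
      (intro bounded_linear_imp_has_derivative bounded_linear_vec_nth)
  then show ?case
    by (intro exI[of _ "\<lambda>k _. if k = i then 1 else 0"]) (auto intro: Poly_const)
next
  case (const c)
  show ?case by (rule exI[of _ "\<lambda>_ _. 0"]) (simp add: Poly_const)
next
  case (add f g)
  obtain D where D: "\<And>i. D i \<in> Poly"
      "\<And>v. (f has_derivative (\<lambda>u. \<Sum>i\<in>UNIV. D i v * u $ i)) (at v)"
    using add(3) by blast
  obtain E where E: "\<And>i. E i \<in> Poly"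
      "\<And>v. (g has_derivative (\<lambda>u. \<Sum>i\<in>UNIV. E i v * u $ i)) (at v)"
    using add(4) by blast
  have "((\<lambda>v. f v + g v) has_derivative (\<lambda>u. \<Sum>i\<in>UNIV. (D i v + E i v) * u $ i)) (at v)" for v
    using has_derivative_add[OF D(2)[of v] E(2)[of v]] by (simp add: algebra_simps sum.distrib)
  then show ?case
    using Poly_add[OF D(1) E(1)] by (intro exI[of _ "\<lambda>i v. D i v + E i v"]) simp
next
  case (mult f g)
  obtain D where D: "\<And>i. D i \<in> Poly"
      "\<And>v. (f has_derivative (\<lambda>u. \<Sum>i\<in>UNIV. D i v * u $ i)) (at v)"
    using mult(3) by blast
  obtain E where E: "\<And>i. E i \<in> Poly"
      "\<And>v. (g has_derivative (\<lambda>u. \<Sum>i\<in>UNIV. E i v * u $ i)) (at v)"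
    using mult(4) by blast
  have "((\<lambda>v. f v * g v) has_derivative
      (\<lambda>u. \<Sum>i\<in>UNIV. (f v * E i v + D i v * g v) * u $ i)) (at v)" for v
    using has_derivative_mult[OF D(2)[of v] E(2)[of v]]
    by (simp add: algebra_simps sum.distrib sum_distrib_left)
  then show ?case
    using Poly_add[OF Poly_mult[OF mult(1) E(1)] Poly_mult[OF D(1) mult(2)]]
    by (intro exI[of _ "\<lambda>i v. f v * E i v + D i v * g v"]) simp
qed

lemma grad_eqI:
  assumes "(f has_derivative (\<lambda>u. \<Sum>i\<in>UNIV. D i * u $ i)) (at v)"
  shows "grad f v $ i = D i"
proof -
  have "frechet_derivative f (at v) = (\<lambda>u. \<Sum>i\<in>UNIV. D i * u $ i)"
    using frechet_derivative_at[OF assms] by (rule sym)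
  moreover have "D k * axis i 1 $ k = (if k = i then D k else 0)" for k
    by (simp add: axis_def)
  ultimately show ?thesis by (simp add: grad_def)
qed

lemma Poly_has_derivative:
  assumes "f \<in> Poly"
  shows "(f has_derivative (\<lambda>u. \<Sum>i\<in>UNIV. grad f v $ i * u $ i)) (at v)"
proof -
  obtain D where D: "\<And>v. (f has_derivative (\<lambda>u. \<Sum>i\<in>UNIV. D i v * u $ i)) (at v)"
    using Poly_has_gradient[OF assms] by blast
  have "grad f v $ i = D i v" for i by (rule grad_eqI[OF D])
  then show ?thesis using D by simp
qed

lemma Poly_grad:
  assumes "f \<in> Poly"
  shows "(\<lambda>v. grad f v $ i) \<in> Poly"
proof -
  obtain D where D: "\<And>i. D i \<in> Poly" "\<And>v. (f has_derivative (\<lambda>u. \<Sum>i\<in>UNIV. D i v * u $ i)) (at v)"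
    using Poly_has_gradient[OF assms] by blast
  have "(\<lambda>v. grad f v $ i) = D i" using grad_eqI[OF D(2)] by auto
  then show ?thesis using D(1) by simp
qed

lemma Poly_continuous_on:
  assumes "f \<in> Poly"
  shows "continuous_on S f"
  using has_derivative_continuous[OF Poly_has_derivative[OF assms]]
  by (simp add: continuous_at_imp_continuous_on)

lemma grad_compose_matrix:
  assumes f: "f \<in> Poly"
  shows "grad (\<lambda>v. f (A *v v)) v = grad f (A *v v) v* A"
proof -
  have "((\<lambda>v. A *v v) has_derivative (\<lambda>u. A *v u)) (at v)"
    by (intro bounded_linear_imp_has_derivative) (simp add: linear_linear matrix_vector_mul_linear)
  from has_derivative_compose[OF this Poly_has_derivative[OF f]]
  have "((\<lambda>v. f (A *v v)) has_derivative (\<lambda>u. \<Sum>i\<in>UNIV. grad f (A *v v) $ i * (A *v u) $ i)) (at v)" .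
  also have "(\<lambda>u. \<Sum>i\<in>UNIV. grad f (A *v v) $ i * (A *v u) $ i)
    = (\<lambda>u. \<Sum>k\<in>UNIV. (grad f (A *v v) v* A) $ k * u $ k)"
    by (rule ext, simp add: matrix_vector_mult_def vector_matrix_mult_def sum_distrib_left
        sum_distrib_right, subst sum.swap) (simp add: mult_ac)
  finally show ?thesis by (simp add: vec_eq_iff grad_eqI)
qed

lemma grad_invariant:
  assumes "f \<in> Poly" "\<And>v. f (A *v v) = f v"
  shows "grad f v = grad f (A *v v) v* A"
  using grad_compose_matrix[OF assms(1), of A v] assms(2) by simp

lemma grad_homogeneous:
  assumes "f \<in> Poly" "\<And>v. f (c *s v) = c ^ d * f v"
  shows "c *s grad f (c *s v) = c ^ d *s grad f v"
proof -
  have B: "u v* mat c = c *s u" for u :: "complex ^ 'n"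
    by (simp add: mat_def vector_matrix_mult_def vec_eq_iff if_distrib[of "\<lambda>x. _ * x"] mult.commute
        cong: if_cong)
  have "((\<lambda>v. c ^ d * f v) has_derivative (\<lambda>u. \<Sum>i\<in>UNIV. (c ^ d *s grad f v) $ i * u $ i)) (at v)"
    using has_derivative_mult_right[OF Poly_has_derivative[OF assms(1)], of "c ^ d" v]
    by (simp add: sum_distrib_left mult.assoc)
  then have "grad (\<lambda>v. c ^ d * f v) v = c ^ d *s grad f v"
    by (simp add: vec_eq_iff grad_eqI)
  then show ?thesis
    using grad_compose_matrix[OF assms(1), of "mat c" v] assms(2) by (simp add: mat_mult_vec B)
qed

lemma euler_identity:
  assumes "homog d f"
  shows "(\<Sum>i\<in>UNIV. grad f v $ i * v $ i) = of_nat d * f v"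
proof -
  have f: "f \<in> Poly" "\<And>c v. f (c *s v) = c ^ d * f v" using assms by (auto simp: homog_def)
  have r: "t *\<^sub>R v = complex_of_real t *s v" for t and v :: "complex ^ 'n"
    by (simp add: vec_eq_iff scaleR_conv_of_real[where 'a = complex])
  have "((\<lambda>t::real. t *\<^sub>R v) has_derivative (\<lambda>s. s *\<^sub>R v)) (at 1)"
    by (auto intro!: derivative_eq_intros)
  from has_derivative_compose[OF this Poly_has_derivative[OF f(1)]]
  have 1: "((\<lambda>t::real. f (t *\<^sub>R v)) has_derivative (\<lambda>s. \<Sum>i\<in>UNIV. grad f v $ i * (s *\<^sub>R v) $ i)) (at 1)"
    by (simp only: scaleR_one)
  have 2: "((\<lambda>t::real. f (t *\<^sub>R v)) has_derivative (\<lambda>s. of_nat d * of_real s * f v)) (at 1)"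
    unfolding r f(2) by (auto intro!: derivative_eq_intros)
  from fun_cong[OF has_derivative_unique[OF 1 2], of 1] show ?thesis by simp
qed

section \<open>Divisibility by linear forms\<close>

text \<open>With the projection \<open>p\<close> onto the hyperplane, \<open>f v - f (p v)\<close> is divisible by \<open>l\<close>: this property is
  inherited by sums, and by products because
  $f g - (f \circ p)(g \circ p) = (f - f \circ p) g + (f \circ p)(g - g \circ p)$.\<close>

lemma Poly_divide_linear:
  fixes f :: "complex ^ 'n \<Rightarrow> complex"
  assumes f: "f \<in> Poly" and l: "Vector_Spaces.linear (*s) (*) l" and a: "l a = 1"
    and zero: "\<And>v. l v = 0 \<Longrightarrow> f v = 0"
  shows "\<exists>g\<in>Poly. \<forall>v. f v = l v * g v"
proof -
  interpret l: Vector_Spaces.linear "(*s)" "(*)" l by fact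
  \<comment> \<open>the projection onto the hyperplane along \<open>a\<close>\<close>
  define p where "p v = v - l v *s a" for v
  have "\<exists>g\<in>Poly. (\<lambda>v. f (p v)) \<in> Poly \<and> (\<forall>v. f v - f (p v) = l v * g v)" using f
  proof (induction rule: Poly_induct)
    case (coord i)
    have "(\<lambda>v. p v $ i) = (\<lambda>v. v $ i - a $ i * l v)" by (simp add: p_def mult.commute)
    then have "(\<lambda>v. p v $ i) \<in> Poly"
      using Poly_diff[OF Poly_coord Poly_scale[OF Poly_linear[OF l]]] by simp
    moreover have "v $ i - p v $ i = l v * a $ i" for v by (simp add: p_def)
    ultimately show ?case using Poly_const by (intro bexI[of _ "\<lambda>_. a $ i"]) auto
  next
    case (const c)
    show ?case using Poly_const by (intro bexI[of _ "\<lambda>_. 0"]) auto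
  next
    case (add f g)
    obtain f' where f': "f' \<in> Poly" "(\<lambda>v. f (p v)) \<in> Poly" "\<And>v. f v - f (p v) = l v * f' v"
      using add(3) by blast
    obtain g' where g': "g' \<in> Poly" "(\<lambda>v. g (p v)) \<in> Poly" "\<And>v. g v - g (p v) = l v * g' v"
      using add(4) by blast
    have "f v + g v - (f (p v) + g (p v)) = l v * (f' v + g' v)" for v
      using f'(3)[of v] g'(3)[of v] by (simp add: algebra_simps)
    then show ?case
      using Poly_add[OF f'(1) g'(1)] Poly_add[OF f'(2) g'(2)]
      by (intro bexI[of _ "\<lambda>v. f' v + g' v"]) simp_all
  next
    case (mult f g)
    obtain f' where f': "f' \<in> Poly" "(\<lambda>v. f (p v)) \<in> Poly" "\<And>v. f v - f (p v) = l v * f' v"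
      using mult(3) by blast
    obtain g' where g': "g' \<in> Poly" "(\<lambda>v. g (p v)) \<in> Poly" "\<And>v. g v - g (p v) = l v * g' v"
      using mult(4) by blast
    have "f v * g v - f (p v) * g (p v) = l v * (f' v * g v + f (p v) * g' v)" for v
    proof -
      have "f v * g v - f (p v) * g (p v) = (f v - f (p v)) * g v + f (p v) * (g v - g (p v))"
        by (simp add: algebra_simps)
      then show ?thesis unfolding f'(3) g'(3) by (simp add: algebra_simps)
    qed
    then show ?case
      using Poly_add[OF Poly_mult[OF f'(1) mult(2)] Poly_mult[OF f'(2) g'(1)]]
        Poly_mult[OF f'(2) g'(2)]
      by (intro bexI[of _ "\<lambda>v. f' v * g v + f (p v) * g' v"]) simp_all
  qed
  moreover have "f (p v) = 0" for v by (intro zero) (simp add: p_def l.diff l.scale a)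
  ultimately show ?thesis by auto
qed

text \<open>The transformation rule of Jacobian determinants under a reflection of order at least
  three forces a double zero along the reflecting hyperplane.\<close>

lemma semi_invariant_divisible:
  fixes A :: "complex ^ 'n \<Rightarrow> complex"
  assumes A: "A \<in> Poly" and l: "Vector_Spaces.linear (*s) (*) l" and a: "l a = 1"
    and fixed: "\<And>v. l v = 0 \<Longrightarrow> r *v v = v" and lr: "\<And>v. l (r *v v) = \<zeta> * l v"
    and z: "\<zeta> \<noteq> 1" "\<zeta>\<^sup>2 \<noteq> 1" and semi: "\<And>v. A (r *v v) * \<zeta> = A v"
  shows "\<exists>B\<in>Poly. \<forall>v. A v = (l v)\<^sup>2 * B v"
proof -
  have "A v = 0" if "l v = 0" for v using semi[of v] fixed[OF that] z by simp
  from Poly_divide_linear[OF A l a this] obtain B where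
    B: "B \<in> Poly" "\<And>v. A v = l v * B v" by blast
  have "l v * (\<zeta>\<^sup>2 * B (r *v v) - B v) = 0" for v
    using semi[of v] by (simp add: B(2) lr power2_eq_square algebra_simps)
  then have "\<zeta>\<^sup>2 * B (r *v v) - B v = 0" for v
    by (rule Poly_cancel[OF Poly_linear[OF l] Poly_diff[OF Poly_scale[OF Poly_compose[OF B(1)]] B(1)],
          where p = a]) (simp add: a)
  then have "B v = 0" if "l v = 0" for v
    using fixed[OF that] z(2) by (metis eq_iff_diff_eq_0 mult_cancel_right1)
  from Poly_divide_linear[OF B(1) l a this] obtain C where
    "C \<in> Poly" "\<And>v. B v = l v * C v" by blast
  then show ?thesis using B(2) by (intro bexI[of _ C]) (auto simp: power2_eq_square)
qed

lemma Poly_cancel_prod_on: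
  fixes m :: "'k \<Rightarrow> complex ^ 'n \<Rightarrow> complex"
  assumes "finite F" and l: "Vector_Spaces.linear (*s) (*) l"
    and m: "\<And>k. k \<in> F \<Longrightarrow> m k \<in> Poly" "\<And>k. k \<in> F \<Longrightarrow> \<exists>p. l p = 0 \<and> m k p \<noteq> 0"
    and g: "g \<in> Poly" and mg: "\<And>v. l v = 0 \<Longrightarrow> (\<Prod>k\<in>F. m k v) * g v = 0" and v: "l v = 0"
  shows "g v = 0"
  using assms(1) m mg v
proof (induction F arbitrary: v rule: finite_induct)
  case empty
  then show ?case using empty(3)[OF empty(4)] by simp
next
  case (insert k F)
  obtain p where p: "l p = 0" "m k p \<noteq> 0" using insert(5)[of k] by auto
  have P: "(\<lambda>v. (\<Prod>k\<in>F. m k v) * g v) \<in> Poly"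
    using insert(4) g by (intro Poly_mult Poly_prod) auto
  have "(\<Prod>k\<in>F. m k u) * g u = 0" if "l u = 0" for u
  proof (rule Poly_cancel_on[OF insert(4)[of k] P l _ p that])
    show "k \<in> insert k F" by simp
    show "m k v * ((\<Prod>k\<in>F. m k v) * g v) = 0" if "l v = 0" for v
      using insert(6)[OF that] insert(1,2) by (simp add: mult.assoc)
  qed
  then show ?case using insert by auto
qed

text \<open>Linear forms are prime: what vanishes on a hyperplane after multiplication by forms that do not
  vanish identically there already vanishes on it.  So the squares can be split off one by one.\<close>

lemma divisible_by_distinct_squares:
  fixes l :: "'k \<Rightarrow> complex ^ 'n \<Rightarrow> complex"
  assumes "finite K" and l: "\<And>k. k \<in> K \<Longrightarrow> Vector_Spaces.linear (*s) (*) (l k)"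
    and a: "\<And>k. k \<in> K \<Longrightarrow> l k (a k) = 1"
    and indep: "\<And>k k'. k \<in> K \<Longrightarrow> k' \<in> K \<Longrightarrow> k \<noteq> k' \<Longrightarrow> \<exists>p. l k p = 0 \<and> l k' p \<noteq> 0"
    and A: "A \<in> Poly" and div: "\<And>k. k \<in> K \<Longrightarrow> \<exists>B\<in>Poly. \<forall>v. A v = (l k v)\<^sup>2 * B v"
  shows "\<exists>B\<in>Poly. \<forall>v. A v = (\<Prod>k\<in>K. (l k v)\<^sup>2) * B v"
  using assms(1) l a indep div
proof (induction K rule: finite_induct)
  case empty
  then show ?case using A by (intro bexI[of _ A]) auto
next
  case (insert k F)
  have lk: "Vector_Spaces.linear (*s) (*) (l k)" using insert.prems(1) by simp
  have "\<exists>B\<in>Poly. \<forall>v. A v = (\<Prod>k\<in>F. (l k v)\<^sup>2) * B v"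
    by (intro insert.IH) (use insert.prems in auto)
  then obtain B where B: "B \<in> Poly" "\<And>v. A v = (\<Prod>k\<in>F. (l k v)\<^sup>2) * B v" by blast
  obtain C where C: "C \<in> Poly" "\<And>v. A v = (l k v)\<^sup>2 * C v" using insert.prems(4)[of k] by auto
  have cancel: "h v = 0" if "h \<in> Poly" "\<And>v. l k v = 0 \<Longrightarrow> (\<Prod>k\<in>F. (l k v)\<^sup>2) * h v = 0" "l k v = 0"
    for h v
  proof (rule Poly_cancel_prod_on[OF insert(1) lk _ _ that])
    fix j assume "j \<in> F"
    then show "(\<lambda>v. (l j v)\<^sup>2) \<in> Poly"
      using insert.prems(1) by (intro Poly_power Poly_linear) auto
    have "j \<noteq> k" using insert(2) \<open>j \<in> F\<close> by auto
    then show "\<exists>p. l k p = 0 \<and> (l j p)\<^sup>2 \<noteq> 0"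
      using insert.prems(3)[of k j] \<open>j \<in> F\<close> by auto
  qed
  have "B v = 0" if "l k v = 0" for v
    by (rule cancel[OF B(1) _ that]) (use B(2) C(2) in \<open>metis mult_zero_left zero_power2\<close>)
  from Poly_divide_linear[OF B(1) lk insert.prems(2)[of k] this] obtain B1 where
    B1: "B1 \<in> Poly" "\<And>v. B v = l k v * B1 v" by auto
  have sq: "(\<lambda>v. (\<Prod>k\<in>F. (l k v)\<^sup>2)) \<in> Poly"
    by (intro Poly_prod Poly_power Poly_linear insert.prems) auto
  have "l k v * ((\<Prod>k\<in>F. (l k v)\<^sup>2) * B1 v - l k v * C v) = 0" for v
    using B(2)[of v] C(2)[of v] B1(2)[of v] by (auto simp: power2_eq_square algebra_simps)
  then have "(\<Prod>k\<in>F. (l k v)\<^sup>2) * B1 v - l k v * C v = 0" for v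
    by (rule Poly_cancel[OF Poly_linear[OF lk] Poly_diff[OF Poly_mult[OF sq B1(1)]
          Poly_mult[OF Poly_linear[OF lk] C(1)]], where p = "a k"])
      (use insert.prems(2)[of k] in simp)
  then have "B1 v = 0" if "l k v = 0" for v
    by (intro cancel[OF B1(1) _ that]) (metis eq_iff_diff_eq_0 mult_zero_left)
  from Poly_divide_linear[OF B1(1) lk insert.prems(2)[of k] this] obtain B2 where
    B2: "B2 \<in> Poly" "\<And>v. B1 v = l k v * B2 v" by auto
  show ?case
    using B2 insert(1,2) by (intro bexI[of _ B2]) (auto simp: B(2) B1(2) power2_eq_square algebra_simps)
qed

section \<open>The Jacobian criterion\<close>

text \<open>The map \<open>\<iota>\<close> only numbers the coordinates.  The assumption \<open>degrees\<close> says that the Jacobian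
  determinant, of degree $\sum (\delta_i - 1)$, has the degree of the product of the squares of the
  forms \<open>l k\<close>, which divides it.\<close>

locale jacobian_system =
  fixes \<Gamma> :: "(complex ^ 'n ^ 'n) set" and F :: "nat \<Rightarrow> complex ^ 'n \<Rightarrow> complex"
    and \<delta> :: "nat \<Rightarrow> nat" and \<iota> :: "'n \<Rightarrow> nat"
    and K :: "'k set" and l :: "'k \<Rightarrow> complex ^ 'n \<Rightarrow> complex"
    and a :: "'k \<Rightarrow> complex ^ 'n" and r :: "'k \<Rightarrow> complex ^ 'n ^ 'n" and \<zeta> :: complex
    and v0 :: "complex ^ 'n"
  assumes \<iota>: "bij_betw \<iota> UNIV {..<CARD('n)}"
    and F_homog: "i < CARD('n) \<Longrightarrow> homog (\<delta> i) (F i)" and \<delta>_pos: "i < CARD('n) \<Longrightarrow> \<delta> i > 0"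
    and F_inv: "i < CARD('n) \<Longrightarrow> g \<in> \<Gamma> \<Longrightarrow> F i (g *v v) = F i v"
    and det_nz: "g \<in> \<Gamma> \<Longrightarrow> det g \<noteq> 0"
    and K: "finite K" and l: "k \<in> K \<Longrightarrow> Vector_Spaces.linear (*s) (*) (l k)"
    and la: "k \<in> K \<Longrightarrow> l k (a k) = 1"
    and l_indep: "k \<in> K \<Longrightarrow> k' \<in> K \<Longrightarrow> k \<noteq> k' \<Longrightarrow> \<exists>p. l k p = 0 \<and> l k' p \<noteq> 0"
    and r: "k \<in> K \<Longrightarrow> r k \<in> \<Gamma>" "k \<in> K \<Longrightarrow> l k v = 0 \<Longrightarrow> r k *v v = v"
      "k \<in> K \<Longrightarrow> l k (r k *v v) = \<zeta> * l k v" "k \<in> K \<Longrightarrow> det (r k) = \<zeta>"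
    and \<zeta>: "\<zeta> \<noteq> 1" "\<zeta>\<^sup>2 \<noteq> 1"
    and J_nz: "det (\<chi> i. grad (F (\<iota> i)) v0) \<noteq> 0"
    and degrees: "(\<Sum>i\<in>UNIV. \<delta> (\<iota> i)) = 2 * card K + CARD('n)"
begin

definition J :: "complex ^ 'n \<Rightarrow> complex" where
  "J v = det (\<chi> i. grad (F (\<iota> i)) v)"

text \<open>The numerators in Cramer's rule for expressing \<open>grad h\<close> through the gradients of the
  given invariants.\<close>

definition Jrep :: "(complex ^ 'n \<Rightarrow> complex) \<Rightarrow> 'n \<Rightarrow> complex ^ 'n \<Rightarrow> complex" where
  "Jrep h i v = det (\<chi> k. if k = i then grad h v else grad (F (\<iota> k)) v)"

lemma iota_less: "\<iota> i < CARD('n)"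
  using \<iota> by (auto simp: bij_betw_def)

lemma F_Poly: "F (\<iota> i) \<in> Poly"
  using F_homog[OF iota_less] by (simp add: homog_def)

lemma Poly_J: "J \<in> Poly"
  unfolding J_def[abs_def] by (intro Poly_det) (simp add: Poly_grad F_Poly)

lemma Poly_Jrep:
  assumes "h \<in> Poly"
  shows "Jrep h i \<in> Poly"
  unfolding Jrep_def[abs_def]
proof (rule Poly_det)
  show "(\<lambda>v. (\<chi> k. if k = i then grad h v else grad (F (\<iota> k)) v) $ k $ j) \<in> Poly" for k j
    using Poly_grad[OF assms] Poly_grad[OF F_Poly] by (cases "k = i") simp_all
qed

lemma rows_mult: "(\<chi> i. R i v* g) = (\<chi> i. R i) ** g" for R :: "'n \<Rightarrow> complex ^ 'n"
  by (simp add: vec_eq_iff vector_matrix_mult_def matrix_matrix_mult_def mult.commute)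

lemma J_transform: "g \<in> \<Gamma> \<Longrightarrow> J (g *v v) * det g = J v"
proof -
  assume "g \<in> \<Gamma>"
  then have "(\<chi> i. grad (F (\<iota> i)) v) = (\<chi> i. grad (F (\<iota> i)) (g *v v) v* g)"
    using grad_invariant[OF F_Poly F_inv[OF iota_less]] by (simp add: vec_eq_iff)
  then show ?thesis unfolding J_def by (simp add: rows_mult det_mul)
qed

lemma Jrep_transform:
  assumes "g \<in> \<Gamma>" and h: "h \<in> Poly" "\<And>v. h (g *v v) = h v"
  shows "Jrep h i (g *v v) * det g = Jrep h i v"
proof -
  have "(\<chi> k. if k = i then grad h v else grad (F (\<iota> k)) v)
    = (\<chi> k. (if k = i then grad h (g *v v) else grad (F (\<iota> k)) (g *v v)) v* g)"
    using grad_invariant[OF F_Poly F_inv[OF iota_less assms(1)]] grad_invariant[OF h]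
    by (simp add: vec_eq_iff)
  then show ?thesis unfolding Jrep_def by (simp add: rows_mult det_mul)
qed

abbreviation Q :: "complex ^ 'n \<Rightarrow> complex" where "Q v \<equiv> \<Prod>k\<in>K. (l k v)\<^sup>2"

lemma Q_divides:
  assumes A: "A \<in> Poly" and semi: "\<And>k v. k \<in> K \<Longrightarrow> A (r k *v v) * \<zeta> = A v"
  shows "\<exists>B\<in>Poly. \<forall>v. A v = Q v * B v"
proof (rule divisible_by_distinct_squares[OF K l la l_indep A])
  fix k assume k: "k \<in> K"
  show "\<exists>B\<in>Poly. \<forall>v. A v = (l k v)\<^sup>2 * B v"
    by (rule semi_invariant_divisible[OF A l[OF k] la[OF k] r(2)[OF k] r(3)[OF k] \<zeta> semi[OF k]])
qed

lemma J_scale: "c ^ CARD('n) * J (c *s v) = c ^ (2 * card K + CARD('n)) * J v"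
proof -
  have "(\<chi> i. c *s grad (F (\<iota> i)) (c *s v)) = (\<chi> i. c ^ \<delta> (\<iota> i) *s grad (F (\<iota> i)) v)"
    using grad_homogeneous[OF F_Poly] F_homog[OF iota_less] by (simp add: vec_eq_iff homog_def)
  from arg_cong[OF this, of det] show ?thesis
    unfolding J_def by (simp add: det_rows_mul degrees flip: power_sum)
qed

lemma Jrep_scale:
  assumes "homog d h"
  shows "c ^ (CARD('n) + \<delta> (\<iota> i)) * Jrep h i (c *s v)
    = c ^ (2 * card K + CARD('n) + d) * Jrep h i v"
proof -
  have h: "h \<in> Poly" "\<And>c v. h (c *s v) = c ^ d * h v" using assms by (auto simp: homog_def)
  have "(\<chi> k. c *s (if k = i then grad h (c *s v) else grad (F (\<iota> k)) (c *s v)))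
    = (\<chi> k. c ^ (if k = i then d else \<delta> (\<iota> k)) *s (if k = i then grad h v else grad (F (\<iota> k)) v))"
    using grad_homogeneous[OF F_Poly] F_homog[OF iota_less] grad_homogeneous[OF h]
    by (simp add: vec_eq_iff homog_def)
  from arg_cong[OF this, of det]
  have 1: "c ^ CARD('n) * Jrep h i (c *s v) = (\<Prod>k\<in>UNIV. c ^ (if k = i then d else \<delta> (\<iota> k))) * Jrep h i v"
    unfolding Jrep_def by (simp add: det_rows_mul)
  have 2: "(\<Prod>k\<in>UNIV. c ^ (if k = i then d else \<delta> (\<iota> k))) * c ^ \<delta> (\<iota> i)
    = c ^ (2 * card K + CARD('n) + d)"
  proof -
    have "(\<Sum>k\<in>UNIV. if k = i then d else \<delta> (\<iota> k)) + \<delta> (\<iota> i) = d + (\<Sum>k\<in>UNIV. \<delta> (\<iota> k))"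
      by (simp add: sum.remove[of UNIV i])
    then show ?thesis unfolding power_sum[symmetric] power_add[symmetric] by (simp add: degrees add_ac)
  qed
  have 3: "c ^ (CARD('n) + \<delta> (\<iota> i)) * Jrep h i (c *s v)
    = (c ^ CARD('n) * Jrep h i (c *s v)) * c ^ \<delta> (\<iota> i)" by (simp add: power_add mult_ac)
  show ?thesis unfolding 3 1 2[symmetric] by (simp only: mult_ac)
qed

lemma Q_Poly: "Q \<in> Poly"
  by (intro Poly_prod Poly_power Poly_linear l)

lemma Q_scale: "Q (c *s v) = c ^ (2 * card K) * Q v"
proof -
  have "l k (c *s v) = c * l k v" if "k \<in> K" for k
  proof -
    interpret lk: Vector_Spaces.linear "(*s)" "(*)" "l k" using l[OF that] .
    show ?thesis by (rule lk.scale)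
  qed
  then have "Q (c *s v) = (\<Prod>k\<in>K. c\<^sup>2 * (l k v)\<^sup>2)" by (simp add: power_mult_distrib)
  then show ?thesis by (simp add: prod.distrib power_mult)
qed

text \<open>The quotient of the Jacobian determinant by the product of the squares is homogeneous of degree 0.\<close>

lemma J_eq_Q: "\<exists>c. c \<noteq> 0 \<and> (\<forall>v. J v = c * Q v)"
proof -
  have "J (r k *v v) * \<zeta> = J v" if "k \<in> K" for k v
    using J_transform[OF r(1)[OF that]] r(4)[OF that] by simp
  from Q_divides[OF Poly_J this] obtain C where C: "C \<in> Poly" "\<And>v. J v = Q v * C v" by blast
  have Q0: "Q v0 \<noteq> 0" "C v0 \<noteq> 0" using J_nz C(2)[of v0] by (auto simp: J_def)
  have "C (c *s v) = C v" if "c \<noteq> 0" for c v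
  proof (rule Poly_eq_where_nonzero[OF Q_Poly Q0(1) _ C(1)])
    show "(\<lambda>v. C (c *s v)) \<in> Poly" by (rule Poly_scale_arg[OF C(1)])
    show "C (c *s v) = C v" if "Q v \<noteq> 0" for v
      using J_scale[of c v] \<open>c \<noteq> 0\<close> that unfolding C(2) Q_scale by (simp add: power_add)
  qed
  then have "c ^ 0 * C (c *s v) = c ^ 0 * C v" if "c \<noteq> 0" for c v using that by simp
  from homog_if_shifted[OF C(1) this] have "homog 0 C" using Q0(2) by auto
  then have "C (0 *s v) = C v" for v unfolding homog_def by (metis mult_1 power_0)
  then have "C v = C v0" for v by (metis vector_smult_lzero)
  then show ?thesis using C(2) Q0(2) by (intro exI[of _ "C v0"]) (auto simp: mult.commute)
qed

lemma J_v0: "J v0 \<noteq> 0"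
  using J_nz by (simp add: J_def)

text \<open>The numerators transform under reflections like the Jacobian determinant itself.\<close>

lemma quotient_Poly:
  assumes h: "h \<in> Poly" "\<And>g v. g \<in> \<Gamma> \<Longrightarrow> h (g *v v) = h v"
  shows "\<exists>p\<in>Poly. \<forall>v. J v * p v = Jrep h i v"
proof -
  have "Jrep h i (r k *v v) * \<zeta> = Jrep h i v" if "k \<in> K" for k v
    using Jrep_transform[OF r(1)[OF that] h(1) h(2)[OF r(1)[OF that]]] r(4)[OF that] by simp
  from Q_divides[OF Poly_Jrep[OF h(1)] this] obtain B where
    B: "B \<in> Poly" "\<And>v. Jrep h i v = Q v * B v" by blast
  obtain c where c: "c \<noteq> 0" "\<And>v. J v = c * Q v" using J_eq_Q by blast
  show ?thesis
    by (rule bexI[of _ "\<lambda>v. (1 / c) * B v"]) (use B c Poly_scale[OF B(1), of "1 / c"] in auto)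
qed

lemma invariant_quotient:
  assumes h: "h \<in> Poly" "\<And>g v. g \<in> \<Gamma> \<Longrightarrow> h (g *v v) = h v"
    and p: "p \<in> Poly" "\<And>v. J v * p v = Jrep h i v" and g: "g \<in> \<Gamma>"
  shows "p (g *v v) = p v"
proof (rule Poly_eq_where_nonzero[OF Poly_J J_v0 Poly_compose[OF p(1)] p(1)])
  fix v assume "J v \<noteq> 0"
  have "J v * p (g *v v) = J (g *v v) * p (g *v v) * det g"
    using J_transform[OF g, of v] by (simp add: mult_ac)
  also have "\<dots> = J v * p v"
    using Jrep_transform[OF g h(1) h(2)[OF g], of i v] by (simp add: p(2))
  finally show "p (g *v v) = p v" using \<open>J v \<noteq> 0\<close> by simp
qed

text \<open>Euler's identity turns the expansion of \<open>grad h\<close> into an expansion of \<open>h\<close> itself, with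
  invariant coefficients of smaller degree.\<close>

lemma euler_expansion:
  assumes h: "homog d h" and p: "\<And>i. p i \<in> Poly" "\<And>i v. J v * p i v = Jrep h i v"
  shows "of_nat d * h v = (\<Sum>i\<in>UNIV. p i v * (of_nat (\<delta> (\<iota> i)) * F (\<iota> i) v))"
proof (rule Poly_eq_where_nonzero[OF Poly_J J_v0])
  have hP: "h \<in> Poly" using h by (simp add: homog_def)
  show "(\<lambda>v. of_nat d * h v) \<in> Poly" by (rule Poly_scale[OF hP])
  show "(\<lambda>v. \<Sum>i\<in>UNIV. p i v * (of_nat (\<delta> (\<iota> i)) * F (\<iota> i) v)) \<in> Poly"
    by (intro Poly_sum Poly_mult p Poly_const F_Poly)
  fix v assume J: "J v \<noteq> 0"
  define M where "M = (\<chi> i. grad (F (\<iota> i)) v)"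
  have dM: "det M = J v" by (simp add: M_def J_def)
  have "det (transpose M) \<noteq> 0" using J dM by (simp add: det_transpose)
  note cr = cramer[OF this, of "\<chi> k. p k v" "grad h v"]
  have "p k v = det (\<chi> i j. if j = k then grad h v $ i else transpose M $ i $ j) / det (transpose M)" for k
  proof -
    have "(\<chi> i j. if j = k then grad h v $ i else transpose M $ i $ j)
      = transpose (\<chi> i. if i = k then grad h v else grad (F (\<iota> i)) v)"
      by (simp add: vec_eq_iff transpose_def M_def)
    then have "det (\<chi> i j. if j = k then grad h v $ i else transpose M $ i $ j) = Jrep h k v"
      by (simp add: det_transpose Jrep_def)
    then show ?thesis using p(2)[of v k] J dM by (simp add: det_transpose field_simps)
  qed
  then have "transpose M *v (\<chi> k. p k v) = grad h v" using cr by simp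
  then have gr: "grad h v $ j = (\<Sum>i\<in>UNIV. grad (F (\<iota> i)) v $ j * p i v)" for j
    by (simp add: vec_eq_iff matrix_vector_mult_def transpose_def M_def)
  have "of_nat d * h v = (\<Sum>j\<in>UNIV. (\<Sum>i\<in>UNIV. grad (F (\<iota> i)) v $ j * p i v) * v $ j)"
    using euler_identity[OF h, of v] gr by simp
  also have "\<dots> = (\<Sum>i\<in>UNIV. p i v * (\<Sum>j\<in>UNIV. grad (F (\<iota> i)) v $ j * v $ j))"
    by (simp add: sum_distrib_left sum_distrib_right mult_ac, subst sum.swap) (simp add: mult_ac)
  also have "\<dots> = (\<Sum>i\<in>UNIV. p i v * (of_nat (\<delta> (\<iota> i)) * F (\<iota> i) v))"
    using euler_identity[OF F_homog[OF iota_less]] by simp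
  finally show "of_nat d * h v = \<dots>" .
qed

abbreviation R :: "(complex ^ 'n \<Rightarrow> complex) set" where
  "R \<equiv> subalgebra_gen (F ` {..<CARD('n)})"

lemma R_sum: "(\<And>i. i \<in> I \<Longrightarrow> f i \<in> R) \<Longrightarrow> (\<lambda>v. \<Sum>i\<in>I. f i v) \<in> R"
proof (induction I rule: infinite_finite_induct)
  case (insert i I)
  then show ?case using subalgebra_gen.add[of "f i" _ "\<lambda>v. \<Sum>i\<in>I. f i v"] by simp
qed (simp_all add: subalgebra_gen.const)

text \<open>Induction on the degree: the coefficients in \<open>euler_expansion\<close> have smaller degree than \<open>h\<close>, since
  the degrees of the given invariants are positive.\<close>

lemma homogeneous_invariant_in_R:
  assumes "homog d h" "\<And>g v. g \<in> \<Gamma> \<Longrightarrow> h (g *v v) = h v"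
  shows "h \<in> R"
  using assms
proof (induction d arbitrary: h rule: less_induct)
  case (less d)
  have hP: "h \<in> Poly" using less.prems by (simp add: homog_def)
  show ?case
  proof (cases "d = 0")
    case True
    have "h v = h 0" for v using less.prems(1) True unfolding homog_def
      by (metis mult_1 power_0 vector_smult_lzero)
    then have "h = (\<lambda>_. h 0)" by auto
    then show ?thesis by (metis subalgebra_gen.const)
  next
    case False
    have "\<forall>i. \<exists>p\<in>Poly. \<forall>v. J v * p v = Jrep h i v" using quotient_Poly[OF hP less.prems(2)] by blast
    then obtain p where p: "\<And>i. p i \<in> Poly" "\<And>i v. J v * p i v = Jrep h i v"
      unfolding Bex_def by (auto dest!: choice)
    have "p i \<in> R" for i
    proof -
      have "c ^ \<delta> (\<iota> i) * p i (c *s v) = c ^ d * p i v" if "c \<noteq> 0" for c v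
      proof (rule Poly_eq_where_nonzero[OF Poly_J J_v0, of _ _ v])
        show "(\<lambda>v. c ^ \<delta> (\<iota> i) * p i (c *s v)) \<in> Poly"
          by (rule Poly_scale[OF Poly_scale_arg[OF p(1)]])
        show "(\<lambda>v. c ^ d * p i v) \<in> Poly" by (rule Poly_scale[OF p(1)])
        fix v assume J: "J v \<noteq> 0"
        have "(c ^ CARD('n) * J (c *s v)) * (c ^ \<delta> (\<iota> i) * p i (c *s v))
          = c ^ (CARD('n) + \<delta> (\<iota> i)) * Jrep h i (c *s v)"
          using p(2)[of "c *s v" i] by (simp add: power_add mult_ac)
        also have "\<dots> = (c ^ (2 * card K + CARD('n)) * J v) * (c ^ d * p i v)"
          using p(2)[of v i] unfolding Jrep_scale[OF less.prems(1)] by (simp add: power_add mult_ac)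
        finally show "c ^ \<delta> (\<iota> i) * p i (c *s v) = c ^ d * p i v"
          unfolding J_scale using J \<open>c \<noteq> 0\<close> by simp
      qed
      from homog_if_shifted[OF p(1) this]
      consider "\<delta> (\<iota> i) \<le> d" "homog (d - \<delta> (\<iota> i)) (p i)" | "\<forall>v. p i v = 0" by blast
      then show ?thesis
      proof cases
        case 1
        then show ?thesis
          using less.IH[of "d - \<delta> (\<iota> i)" "p i"] invariant_quotient[OF hP less.prems(2) p(1) p(2)]
            \<delta>_pos[OF iota_less, of i] False by simp
      next
        case 2
        then have "p i = (\<lambda>_. 0)" by auto
        then show ?thesis by (simp add: subalgebra_gen.const)
      qed
    qed
    moreover have "F (\<iota> i) \<in> R" for i using iota_less by (intro subalgebra_gen.base) auto
    ultimately have "(\<lambda>v. \<Sum>i\<in>UNIV. p i v * (of_nat (\<delta> (\<iota> i)) * F (\<iota> i) v)) \<in> R"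
      by (intro R_sum subalgebra_gen.mult subalgebra_gen.const)
    then have "(\<lambda>v. (1 / of_nat d) * (\<Sum>i\<in>UNIV. p i v * (of_nat (\<delta> (\<iota> i)) * F (\<iota> i) v))) \<in> R"
      by (intro subalgebra_gen.mult subalgebra_gen.const)
    moreover have "h = (\<lambda>v. (1 / of_nat d) * (\<Sum>i\<in>UNIV. p i v * (of_nat (\<delta> (\<iota> i)) * F (\<iota> i) v)))"
      using euler_expansion[OF less.prems(1) p] False by (auto simp: field_simps)
    ultimately show ?thesis by metis
  qed
qed

theorem invariants_generated:
  assumes h: "h \<in> Poly" "\<And>g v. g \<in> \<Gamma> \<Longrightarrow> h (g *v v) = h v"
  shows "h \<in> R"
proof -
  obtain N q where q: "\<And>k. homog k (q k)" "\<And>v. h v = (\<Sum>k\<le>N. q k v)"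
    using Poly_homog_sum[OF h(1)] by blast
  have "q k \<in> R" if "k \<le> N" for k
  proof (rule homogeneous_invariant_in_R[OF q(1)])
    fix g v assume "g \<in> \<Gamma>"
    have "(\<Sum>k\<le>N. t ^ k * q k (g *v v)) = (\<Sum>k\<le>N. t ^ k * q k v)" for t
    proof -
      have "h (g *v (t *s v)) = h (t *s v)" by (rule h(2)[OF \<open>g \<in> \<Gamma>\<close>])
      moreover have "q k (t *s u) = t ^ k * q k u" for k u using q(1) by (simp add: homog_def)
      ultimately show ?thesis unfolding q(2) by (simp add: vec.scale)
    qed
    from homog_components_unique[OF this that] show "q k (g *v v) = q k v" .
  qed
  then have "(\<lambda>v. \<Sum>k\<le>N. q k v) \<in> R" by (intro R_sum) simp
  moreover have "h = (\<lambda>v. \<Sum>k\<le>N. q k v)" using q(2) by auto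
  ultimately show ?thesis by simp
qed

end

section \<open>Algebraic independence\<close>

lemma polynomials_in_cong:
  assumes "P \<in> polynomials_in n" "\<And>i. i < n \<Longrightarrow> y i = z i"
  shows "P y = P z"
  using assms(1) unfolding polynomials_in_def
  by (induction rule: subalgebra_gen.induct) (use assms(2) in auto)

lemma polynomials_in_line:
  assumes "P \<in> polynomials_in n"
  shows "\<exists>p. \<forall>t. P (\<lambda>i. a i + t * b i) = poly p t"
  using assms unfolding polynomials_in_def
proof (induction rule: subalgebra_gen.induct)
  case (base f)
  then obtain i where "f = (\<lambda>y. y i)" by blast
  then show ?case by (intro exI[of _ "[:a i, b i:]"]) simp
next
  case (const c)
  show ?case by (intro exI[of _ "[:c:]"]) simp
next
  case (add f g)
  then obtain p q where "\<forall>t. f (\<lambda>i. a i + t * b i) = poly p t" "\<forall>t. g (\<lambda>i. a i + t * b i) = poly q t"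
    by blast
  then show ?case by (intro exI[of _ "p + q"]) simp
next
  case (mult f g)
  then obtain p q where "\<forall>t. f (\<lambda>i. a i + t * b i) = poly p t" "\<forall>t. g (\<lambda>i. a i + t * b i) = poly q t"
    by blast
  then show ?case by (intro exI[of _ "p * q"]) simp
qed

lemma has_derivative_vec_lambda:
  fixes f :: "'n::finite \<Rightarrow> 'a::real_normed_vector \<Rightarrow> 'b::euclidean_space"
  assumes "\<And>i. (f i has_derivative (\<lambda>u. f' u $ i)) (at x)"
  shows "((\<lambda>v. \<chi> i. f i v) has_derivative f') (at x)"
proof (subst has_derivative_componentwise_within, intro ballI)
  fix b :: "'b ^ 'n" assume "b \<in> Basis"
  then obtain i u where b: "b = axis i u" unfolding Basis_vec_def by blast
  show "((\<lambda>v. (\<chi> i. f i v) \<bullet> b) has_derivative (\<lambda>v. f' v \<bullet> b)) (at x)"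
    unfolding b inner_axis by (simp add: has_derivative_inner_left[OF assms])
qed

context jacobian_system
begin

text \<open>Where the Jacobian determinant does not vanish the map given by the invariants is open,
  so a polynomial relation between them vanishes on an open set.\<close>

theorem algebraically_independent: "algebraically_independent CARD('n) F"
  unfolding algebraically_independent_def
proof (intro ballI impI allI)
  fix P :: "(nat \<Rightarrow> complex) \<Rightarrow> complex" and y
  assume P: "P \<in> polynomials_in CARD('n)" and rel: "\<forall>v. P (\<lambda>i. F i v) = 0"
  define \<Phi> :: "complex ^ 'n \<Rightarrow> complex ^ 'n" where "\<Phi> v = (\<chi> i. F (\<iota> i) v)" for v
  define M where "M = (\<chi> i. grad (F (\<iota> i)) v0)"
  have "invertible M" using J_nz by (simp add: M_def invertible_det_nz)
  then obtain N where N: "M ** N = mat 1" unfolding invertible_def by blast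
  have "(\<Phi> has_derivative (\<lambda>u. M *v u)) (at v0)"
    unfolding \<Phi>_def[abs_def]
  proof (rule has_derivative_vec_lambda)
    show "((\<lambda>v. F (\<iota> i) v) has_derivative (\<lambda>u. (M *v u) $ i)) (at v0)" for i
      using Poly_has_derivative[OF F_Poly, of i v0]
      by (simp add: M_def matrix_vector_mult_def)
  qed
  moreover have "continuous_on UNIV \<Phi>"
    unfolding \<Phi>_def[abs_def] by (intro continuous_on_vec_lambda Poly_continuous_on F_Poly)
  moreover have "bounded_linear (\<lambda>u. N *v u)" by (simp add: linear_linear matrix_vector_mul_linear)
  moreover have "(\<lambda>u. M *v u) \<circ> (\<lambda>u. N *v u) = id"
    by (auto simp: matrix_vector_mul_assoc N)
  ultimately have "\<Phi> v0 \<in> interior (\<Phi> ` UNIV)"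
    by (intro sussmann_open_mapping[of UNIV]) auto
  then obtain e where e: "e > 0" "ball (\<Phi> v0) e \<subseteq> range \<Phi>"
    unfolding mem_interior by blast
  define u where "u = (\<chi> i. y (\<iota> i)) - \<Phi> v0"
  obtain p where p: "\<And>t. P (\<lambda>i. F i v0 + t * (y i - F i v0)) = poly p t"
    using polynomials_in_line[OF P, of "\<lambda>i. F i v0" "\<lambda>i. y i - F i v0"] by blast
  have small: "poly p t = 0" if "norm (t *s u) < e" for t
  proof -
    have "\<Phi> v0 + t *s u \<in> range \<Phi>"
      by (rule subsetD[OF e(2)]) (use that in \<open>simp add: dist_norm norm_minus_commute\<close>)
    then obtain w where "\<Phi> v0 + t *s u = \<Phi> w" by blast
    have w: "F (\<iota> k) v0 + t * (y (\<iota> k) - F (\<iota> k) v0) = F (\<iota> k) w" for k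
    proof -
      have "F (\<iota> k) v0 + t * (y (\<iota> k) - F (\<iota> k) v0) = (\<Phi> v0 + t *s u) $ k"
        by (simp only: \<Phi>_def u_def vector_add_component vector_smult_component
            vector_minus_component vec_lambda_beta)
      also have "\<dots> = \<Phi> w $ k" by (simp only: \<open>\<Phi> v0 + t *s u = \<Phi> w\<close>)
      finally show ?thesis by (simp only: \<Phi>_def vec_lambda_beta)
    qed
    have "F i v0 + t * (y i - F i v0) = F i w" if "i < CARD('n)" for i
    proof -
      have "i \<in> range \<iota>" using \<iota> that by (simp add: bij_betw_def)
      then obtain k where k: "i = \<iota> k" by (rule rangeE)
      show ?thesis unfolding k by (rule w)
    qed
    from polynomials_in_cong[OF P this] have "poly p t = P (\<lambda>i. F i w)"
      unfolding p[symmetric] .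
    then show ?thesis using rel by simp
  qed
  have "p = 0"
  proof (rule ccontr)
    assume "p \<noteq> 0"
    then have fin: "finite {t. poly p t = 0}" by (rule poly_roots_finite)
    define s where "s = e / (norm u + 1)"
    have s: "s > 0" using e(1) by (simp add: s_def add_nonneg_pos)
    have "complex_of_real ` {0<..<s} \<subseteq> {t. poly p t = 0}"
    proof clarsimp
      fix t :: real assume t: "0 < t" "t < s"
      have "complex_of_real t *s u = t *\<^sub>R u"
        by (simp add: vec_eq_iff scaleR_conv_of_real[where 'a = complex])
      then have "norm (complex_of_real t *s u) = t * norm u" using t by simp
      also have "\<dots> \<le> t * (norm u + 1)" using t by simp
      also have "\<dots> < s * (norm u + 1)"
        using t(2) by (intro mult_strict_right_mono) (auto simp: add_nonneg_pos)
      also have "\<dots> = e" by (simp add: s_def add_nonneg_pos less_imp_neq[symmetric])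
      finally show "poly p (complex_of_real t) = 0" by (rule small)
    qed
    then have "finite (complex_of_real ` {0<..<s})" using fin by (rule finite_subset)
    then have "finite {0<..<s}" by (rule finite_imageD) (simp add: inj_on_def)
    then show False using s by (simp add: infinite_Ioo)
  qed
  then show "P y = 0" using p[of 1] by simp
qed

end

section \<open>Exact arithmetic with Eisenstein integers\<close>

text \<open>The pair \<open>(a, b)\<close> stands for \<open>a + b * w\<close> with a primitive cube root of unity \<open>w\<close>, that is with
  \<open>w\<^sup>2 = - 1 - w\<close>.  Everything below holds for both choices of \<open>w\<close>; complex conjugation is replaced
  by the formal conjugation \<open>econj\<close>.\<close>

type_synonym eis = "int \<times> int"

definition ev :: "complex \<Rightarrow> eis \<Rightarrow> complex" where
  "ev w x = of_int (fst x) + of_int (snd x) * w"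

fun eadd :: "eis \<Rightarrow> eis \<Rightarrow> eis" where "eadd (a, b) (c, d) = (a + c, b + d)"
fun emul :: "eis \<Rightarrow> eis \<Rightarrow> eis" where
  "emul (a, b) (c, d) = (let p = b * d in (a * c - p, a * d + b * c - p))"
fun econj :: "eis \<Rightarrow> eis" where "econj (a, b) = (a - b, - b)"

fun edot :: "eis list \<Rightarrow> eis list \<Rightarrow> eis" where
  "edot (x # xs) (y # ys) = eadd (emul x y) (edot xs ys)"
| "edot _ _ = (0, 0)"

definition vscale :: "eis \<Rightarrow> eis list \<Rightarrow> eis list" where
  "vscale u x = map (emul u) x"

fun vadd :: "eis list \<Rightarrow> eis list \<Rightarrow> eis list" where
  "vadd (x # xs) (y # ys) = eadd x y # vadd xs ys"
| "vadd _ _ = []"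

definition mmul :: "eis list list \<Rightarrow> eis list list \<Rightarrow> eis list list" where
  "mmul A B = (let C = map (\<lambda>k. map (\<lambda>r. r ! k) B) [0..<4]
     in map (\<lambda>i. map (edot (A ! i)) C) [0..<4])"

definition mscale :: "eis \<Rightarrow> eis list list \<Rightarrow> eis list list" where
  "mscale u A = map (vscale u) A"

fun mprod :: "eis list list \<Rightarrow> eis list list list \<Rightarrow> eis list list" where
  "mprod A [] = A"
| "mprod A (B # Bs) = mprod (mmul A B) Bs"

text \<open>The element \<open>w - w\<^sup>2\<close>, a square root of \<open>-3\<close>.  The denominators of the matrices below are powers of it.\<close>

definition e_theta :: eis where "e_theta = (1, 2)"

fun epow :: "eis \<Rightarrow> nat \<Rightarrow> eis" where
  "epow x 0 = (1, 0)" | "epow x (Suc n) = emul x (epow x n)"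

definition cube_units :: "eis list" where "cube_units = [(1, 0), (0, 1), (-1, -1)]"
definition six_units :: "eis list" where "six_units = cube_units @ map (emul (-1, 0)) cube_units"

text \<open>One form on each of the 40 lines spanned by the 240 vertices of the Witting polytope.  All of
  them have Hermitian norm 3, which the invariance of the power sums depends on.\<close>

definition witting :: "eis list list" where
  "witting =
    [[e_theta, (0,0), (0,0), (0,0)], [(0,0), e_theta, (0,0), (0,0)],
     [(0,0), (0,0), e_theta, (0,0)], [(0,0), (0,0), (0,0), e_theta]]
    @ concat (map (\<lambda>u. map (\<lambda>v. [(0,0), (1,0), u, v]) cube_units) cube_units)
    @ concat (map (\<lambda>u. map (\<lambda>v. [(1,0), (0,0), u, emul (-1,0) v]) cube_units) cube_units)
    @ concat (map (\<lambda>u. map (\<lambda>v. [(1,0), emul (-1,0) u, (0,0), v]) cube_units) cube_units)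
    @ concat (map (\<lambda>u. map (\<lambda>v. [(1,0), u, emul (-1,0) v, (0,0)]) cube_units) cube_units)"

text \<open>The multiple by \<open>e_theta\<close> of the reflection of order three attached to a form.\<close>

definition erefl :: "eis list \<Rightarrow> eis list list" where
  "erefl a = map (\<lambda>i. map (\<lambda>k. eadd (if i = k then e_theta else (0, 0))
      (emul (-1, -1) (emul (econj (a ! i)) (a ! k)))) [0..<4]) [0..<4]"

text \<open>The forms $(\theta,0,0,0)$, $(1,1,-1,0)$, $(0,\theta,0,0)$, $(0,1,1,1)$: consecutive ones are not
  orthogonal, all other pairs are, which is the diagram of the standard generators of $G_{32}$.\<close>

definition gens :: "nat list" where "gens = [0, 31, 1, 4]"

definition move_targets :: "eis list list" where
  "move_targets = concat (map (\<lambda>u. map (vscale (emul e_theta u)) witting) six_units)"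

text \<open>The multiple by \<open>e_theta\<close> of the form that the reflection attached to \<open>a\<close> makes of \<open>b\<close>.\<close>

definition move :: "eis list \<Rightarrow> eis list \<Rightarrow> eis list" where
  "move a b = vadd (vscale e_theta b) (vscale (emul (-1, -1) (edot b (map econj a))) a)"

definition moves_into :: "eis list list \<Rightarrow> bool" where
  "moves_into T \<longleftrightarrow> list_all (\<lambda>g. list_all (\<lambda>b. move (witting ! g) b \<in> set T) witting) gens"

lemma moves: "moves_into move_targets"
  by code_simp

definition minor :: "eis list \<Rightarrow> eis list \<Rightarrow> nat \<Rightarrow> nat \<Rightarrow> eis" where
  "minor b c i j = eadd (emul (b ! i) (c ! j)) (emul (-1, 0) (emul (b ! j) (c ! i)))"

lemma minors: "list_all (\<lambda>b. list_all (\<lambda>c. b = c \<or>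
   list_ex (\<lambda>(i, j). minor b c i j \<noteq> (0, 0)) [(0,1),(0,2),(0,3),(1,2),(1,3),(2,3)]) witting) witting"
  by code_simp

text \<open>A breadth-first enumeration of the 40 lines from line 0: \<open>(c, b, g)\<close> records that the reflection
  \<open>c\<close> is conjugate to the reflection \<open>b\<close>, which precedes it, by the generator \<open>g\<close>.\<close>

definition chain :: "(nat \<times> nat \<times> nat) list" where
  "chain = [(35, 0, 31), (31, 35, 0), (39, 35, 31), (38, 35, 1), (34, 31, 1), (33, 39, 1),
    (32, 38, 1), (15, 38, 4), (1, 34, 31), (37, 34, 1), (20, 34, 4), (36, 33, 1), (16, 33, 4),
    (2, 32, 31), (29, 32, 4), (23, 15, 4), (8, 1, 4), (25, 37, 4), (28, 20, 4), (24, 36, 4),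
    (27, 16, 4), (10, 2, 4), (19, 29, 4), (26, 23, 1), (4, 8, 1), (12, 8, 4), (18, 25, 4),
    (22, 28, 1), (14, 24, 4), (30, 27, 1), (9, 10, 1), (7, 10, 4), (21, 26, 31), (11, 30, 31),
    (5, 9, 1), (6, 7, 1), (17, 21, 0), (3, 5, 4), (13, 17, 0)]"

fun covered :: "nat list \<Rightarrow> (nat \<times> nat \<times> nat) list \<Rightarrow> nat list" where
  "covered acc [] = acc"
| "covered acc ((c, b, g) # ch) = (if b \<in> set acc \<and> g \<in> set gens \<and>
     mmul (erefl (witting ! g)) (erefl (witting ! c)) = mmul (erefl (witting ! b)) (erefl (witting ! g))
     then covered (c # acc) ch else acc)"

lemma all_covered: "list_all (\<lambda>k. k \<in> set (covered [0] chain)) [0..<40]"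
  by code_simp

section \<open>Explicit roots and words\<close>

definition eid :: "eis list list" where
  "eid = map (\<lambda>i. map (\<lambda>k. if i = k then (1, 0) else (0, 0)) [0..<4]) [0..<4]"

text \<open>The six entries above the diagonal, in the order 12, 13, 14, 23, 24, 34.\<close>

definition eskew :: "eis list \<Rightarrow> eis list list" where
  "eskew x = (let n = emul (-1, 0) in
    [[(0,0), x ! 0, x ! 1, x ! 2], [n (x ! 0), (0,0), x ! 3, x ! 4],
     [n (x ! 1), n (x ! 3), (0,0), x ! 5], [n (x ! 2), n (x ! 4), n (x ! 5), (0,0)]])"

definition estar :: "eis list \<Rightarrow> eis list" where
  "estar x = [x ! 5, emul (-1, 0) (x ! 4), x ! 3, x ! 2, emul (-1, 0) (x ! 1), x ! 0]"

text \<open>Multiples by \<open>e_theta\<close> of simple roots.  In terms of the coordinate vectors $E_{ik}$ the roots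
  1 and 3 lie in the plane of $E_{12}, E_{34}$, the roots 5 and 6 in that of $E_{13}, E_{24}$ and
  the root 2 in that of $E_{14}, E_{23}$.  These three orthogonal planes carry the subsystem
  $3 A_2$, and the root 4 is a sum of one minuscule weight for each of them.\<close>

definition eroots :: "eis list list" where
  "eroots = (let t = e_theta; z = (0, 0); w = (0, 1); w2 = (-1, -1); n = emul (-1, 0) in
    [[t, z, z, z, z, t],
     [z, z, t, t, z, z],
     [emul w t, z, z, z, z, emul w2 t],
     [(1, 0), (1, 0), w2, n w, (1, 0), (-1, 0)],
     [z, emul w t, z, z, n (emul w2 t), z],
     [z, t, z, z, n t, z]])"

definition eroot_prod :: "nat \<times> nat \<Rightarrow> eis list list" where
  "eroot_prod = (\<lambda>(i, k). mmul (eskew (eroots ! (i - 1))) (eskew (estar (eroots ! (k - 1)))))"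

definition erefl_word :: "nat list \<Rightarrow> eis list list" where
  "erefl_word ks = mprod eid (map (\<lambda>k. erefl (witting ! (gens ! (k - 1)))) ks)"

definition eroot_word :: "(nat \<times> nat) list \<Rightarrow> eis list list" where
  "eroot_word es = mprod eid (map eroot_prod es)"

text \<open>For each edge of the diagram a word in the four generating reflections that agrees, up to the
  stated unit, with the lift of the product of the two simple reflections.  The words come from a
  breadth-first search.\<close>

definition edge_words :: "((nat \<times> nat) \<times> eis \<times> nat list) list" where
  "edge_words =
    [((1, 3), (0, -1), [1, 3]),
     ((2, 4), (1, 1), [2, 2, 4, 4]),
     ((5, 6), (1, 0), [3, 4, 3, 2, 1, 1, 2, 3, 4]),
     ((3, 4), (1, 0), [2, 1, 1, 3, 3, 4, 4, 3, 2, 2, 1, 3]),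
     ((4, 5), (1, 0), [2, 2, 1, 3, 2, 2, 3, 4, 3, 2, 1, 1])]"

lemma edge_words_correct:
  "list_all (\<lambda>(e, u, ks). mscale (epow e_theta (length ks - 2)) (eroot_prod e) = mscale u (erefl_word ks))
    edge_words"
  by code_simp

text \<open>In the opposite direction, each generating reflection as a word in the lifts, up to the factor
  \<open>w\<close>.\<close>

definition gen_words :: "(nat \<times> nat) list list" where
  "gen_words =
    [[(3,4), (1,3), (5,6), (4,5), (1,3), (2,4), (1,3), (5,6), (2,4), (1,3), (5,6), (4,2)],
     [(1,3), (4,5), (2,4), (5,6), (5,4), (3,4), (2,4), (1,3), (5,6), (4,5), (2,4), (3,4)],
     [(2,4), (3,4), (1,3), (5,6), (4,5), (3,4), (2,4), (3,4), (1,3), (5,6), (4,5), (3,4)],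
     [(3,4), (5,6), (2,4), (5,6), (3,4), (1,3), (2,4), (5,6), (4,3), (4,5), (2,4), (3,1)]]"

lemma gen_words_correct:
  "list_all (\<lambda>(g, es). mscale (epow e_theta 23) (erefl (witting ! g)) = mscale (0, 1) (eroot_word es))
    (zip gens gen_words)"
  by code_simp

text \<open>The fifth power of a Coxeter element generates the centre of the group, of order 6.\<close>

lemma center_word_correct:
  "erefl_word (concat (replicate 5 [1, 2, 3, 4])) = mscale (emul (epow e_theta 20) (1, 1)) eid"
  by code_simp

text \<open>The exponents 11, 17, 23, 29 are the degrees of the invariants lowered by differentiation.\<close>

definition epows :: "eis \<Rightarrow> eis list" where
  "epows x = (let x2 = emul x x; x4 = emul x2 x2; x5 = emul x4 x; x6 = emul x4 x2;
     x11 = emul x5 x6; x17 = emul x11 x6; x23 = emul x17 x6; x29 = emul x23 x6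
     in [x11, x17, x23, x29])"

text \<open>A point with small coordinates on none of the 40 hyperplanes, where the Jacobian determinant is
  evaluated.\<close>

definition e_point :: "eis list" where "e_point = [(1, 0), (2, 0), (2, 0), (-1, 0)]"

fun madd :: "eis list list \<Rightarrow> eis list list \<Rightarrow> eis list list" where
  "madd (x # xs) (y # ys) = vadd x y # madd xs ys"
| "madd _ _ = []"

fun msum :: "eis list list list \<Rightarrow> eis list list" where
  "msum [] = replicate 4 (replicate 4 (0, 0))"
| "msum (A # As) = madd A (msum As)"

text \<open>The Jacobian matrix at the point, up to the factors 12, 18, 24, 30 of its rows.\<close>

definition ejac :: "eis list list" where
  "ejac = msum (map (\<lambda>b. map (\<lambda>p. vscale p b) (epows (edot b e_point))) witting)"

definition eminor :: "eis list list \<Rightarrow> nat list \<Rightarrow> nat list \<Rightarrow> eis" where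
  "eminor A is ks = (let a = (\<lambda>i k. A ! (is ! i) ! (ks ! k));
     d = (\<lambda>k l. eadd (emul (a 1 k) (a 2 l)) (emul (-1, 0) (emul (a 1 l) (a 2 k))))
     in eadd (emul (a 0 0) (d 1 2)) (eadd (emul (a 0 1) (d 2 0)) (emul (a 0 2) (d 0 1))))"

definition eadj :: "eis list list \<Rightarrow> eis list list" where
  "eadj A = map (\<lambda>i. map (\<lambda>k. emul (if even (i + k) then (1, 0) else (-1, 0))
     (eminor A (remove1 k [0..<4]) (remove1 i [0..<4]))) [0..<4]) [0..<4]"

fun scalar_nonzero :: "eis list list \<Rightarrow> bool" where
  "scalar_nonzero C \<longleftrightarrow> C ! 0 ! 0 \<noteq> (0, 0) \<and> C = mscale (C ! 0 ! 0) eid"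

fun inverse_up_to_scalar :: "eis list list \<Rightarrow> eis list list \<Rightarrow> bool" where
  "inverse_up_to_scalar A B \<longleftrightarrow> scalar_nonzero (mmul A B)"

fun adjugate_check :: "eis list list \<Rightarrow> bool" where
  "adjugate_check A \<longleftrightarrow> inverse_up_to_scalar A (eadj A)"

lemma ejac_regular: "adjugate_check ejac"
  by code_simp

section \<open>Skew-symmetric matrices as the exterior square\<close>

definition smat :: "complex \<Rightarrow> complex ^ 4 ^ 4 \<Rightarrow> complex ^ 4 ^ 4" where
  "smat c S = (\<chi> i k. c * S $ i $ k)"

definition skew :: "complex ^ 4 ^ 4 \<Rightarrow> bool" where
  "skew S \<longleftrightarrow> (\<forall>i k. S $ i $ k = - S $ k $ i)"

definition skew6 :: "complex \<Rightarrow> complex \<Rightarrow> complex \<Rightarrow> complex \<Rightarrow> complex \<Rightarrow> complex \<Rightarrow> complex ^ 4 ^ 4" where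
  "skew6 a b c d e f = (\<chi> i k.
     if i = 1 then (if k = 1 then 0 else if k = 2 then a else if k = 3 then b else c)
     else if i = 2 then (if k = 1 then - a else if k = 2 then 0 else if k = 3 then d else e)
     else if i = 3 then (if k = 1 then - b else if k = 2 then - d else if k = 3 then 0 else f)
     else (if k = 1 then - c else if k = 2 then - e else if k = 3 then - f else 0))"

text \<open>Half of \<open>pfb S S\<close> is the Pfaffian; in coordinates this form is the wedge product with values in
  the fourth exterior power.\<close>

definition pfb :: "complex ^ 4 ^ 4 \<Rightarrow> complex ^ 4 ^ 4 \<Rightarrow> complex" where
  "pfb S Y = S $ 1 $ 2 * Y $ 3 $ 4 + S $ 3 $ 4 * Y $ 1 $ 2 - S $ 1 $ 3 * Y $ 2 $ 4
     - S $ 2 $ 4 * Y $ 1 $ 3 + S $ 1 $ 4 * Y $ 2 $ 3 + S $ 2 $ 3 * Y $ 1 $ 4"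

text \<open>The complementary matrix.  As \<open>S\<close> maps covectors to vectors and \<open>dual S\<close> maps vectors to
  covectors, the two together are the action of a Clifford generator on spinors.\<close>

definition dual :: "complex ^ 4 ^ 4 \<Rightarrow> complex ^ 4 ^ 4" where
  "dual S = skew6 (S $ 3 $ 4) (- S $ 2 $ 4) (S $ 2 $ 3) (S $ 1 $ 4) (- S $ 1 $ 3) (S $ 1 $ 2)"

definition act :: "complex ^ 4 ^ 4 \<Rightarrow> complex ^ 4 ^ 4 \<Rightarrow> complex ^ 4 ^ 4" where
  "act g S = g ** S ** transpose g"

definition refl :: "complex ^ 4 ^ 4 \<Rightarrow> complex ^ 4 ^ 4 \<Rightarrow> complex ^ 4 ^ 4" where
  "refl A S = S - smat (2 * pfb S A / pfb A A) A"

lemma skew6_entries [simp]: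
  "skew6 a b c d e f $ 1 $ 1 = 0" "skew6 a b c d e f $ 1 $ 2 = a" "skew6 a b c d e f $ 1 $ 3 = b"
  "skew6 a b c d e f $ 1 $ 4 = c" "skew6 a b c d e f $ 2 $ 1 = - a" "skew6 a b c d e f $ 2 $ 2 = 0"
  "skew6 a b c d e f $ 2 $ 3 = d" "skew6 a b c d e f $ 2 $ 4 = e" "skew6 a b c d e f $ 3 $ 1 = - b"
  "skew6 a b c d e f $ 3 $ 2 = - d" "skew6 a b c d e f $ 3 $ 3 = 0" "skew6 a b c d e f $ 3 $ 4 = f"
  "skew6 a b c d e f $ 4 $ 1 = - c" "skew6 a b c d e f $ 4 $ 2 = - e" "skew6 a b c d e f $ 4 $ 3 = - f"
  "skew6 a b c d e f $ 4 $ 4 = 0"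
  by (simp_all add: skew6_def)

lemma skew_skew6: "skew (skew6 a b c d e f)"
  unfolding skew_def forall_4 by simp

lemma skew_eq_skew6:
  assumes "skew S"
  shows "S = skew6 (S $ 1 $ 2) (S $ 1 $ 3) (S $ 1 $ 4) (S $ 2 $ 3) (S $ 2 $ 4) (S $ 3 $ 4)"
proof -
  have "S $ i $ i = 0" for i
  proof -
    have "S $ i $ i = - S $ i $ i" using assms unfolding skew_def by blast
    then have "S $ i $ i + S $ i $ i = 0" by (rule eq_neg_iff_add_eq_0[THEN iffD1])
    then have "2 * S $ i $ i = 0" by (simp only: mult_2)
    then show ?thesis by simp
  qed
  moreover have "S $ 2 $ 1 = - S $ 1 $ 2" "S $ 3 $ 1 = - S $ 1 $ 3" "S $ 4 $ 1 = - S $ 1 $ 4"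
    "S $ 3 $ 2 = - S $ 2 $ 3" "S $ 4 $ 2 = - S $ 2 $ 4" "S $ 4 $ 3 = - S $ 3 $ 4"
    using assms unfolding skew_def by blast+
  ultimately show ?thesis unfolding vec_eq_iff forall_4 by simp
qed

lemma skew_cases:
  assumes "skew S"
  obtains a b c d e f where "S = skew6 a b c d e f"
  using skew_eq_skew6[OF assms] by blast

lemma smat_entry [simp]: "smat c S $ i $ k = c * S $ i $ k"
  by (simp add: smat_def)

lemma smat_smat [simp]: "smat c (smat d S) = smat (c * d) S"
  by (simp add: vec_eq_iff)

lemma smat_1 [simp]: "smat 1 S = S"
  by (simp add: vec_eq_iff)

lemma smat_add: "smat c (S + Y) = smat c S + smat c Y"
  by (simp add: vec_eq_iff algebra_simps)

lemma smat_diff: "smat c (S - Y) = smat c S - smat c Y"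
  by (simp add: vec_eq_iff algebra_simps)

lemma smat_mult: "smat c S ** Y = smat c (S ** Y)" "S ** smat c Y = smat c (S ** Y)"
  by (simp_all add: vec_eq_iff matrix_matrix_mult_def sum_distrib_left mult_ac)

lemma smat_cancel: "c \<noteq> 0 \<Longrightarrow> smat c M = smat d N \<Longrightarrow> M = smat (d / c) N"
  by (simp add: vec_eq_iff field_simps)

lemma smat_mat: "smat c (mat d) = mat (c * d)"
  by (simp add: vec_eq_iff mat_def)

lemma smat_eq_mat: "smat c M = mat c ** M"
  using smat_mult(1)[of c "mat 1" M] by (simp add: smat_mat)

lemma mat_mult: "(mat c :: complex ^ 4 ^ 4) ** mat d = mat (c * d)"
  using smat_eq_mat[of c "mat d"] by (simp add: smat_mat)

lemma transpose_smat: "transpose (smat c S) = smat c (transpose S)"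
  by (simp add: vec_eq_iff transpose_def)

lemma skew_smat: "skew S \<Longrightarrow> skew (smat c S)"
  unfolding skew_def smat_entry by (metis mult_minus_right)

lemma skew_add: "skew S \<Longrightarrow> skew Y \<Longrightarrow> skew (S + Y)"
  unfolding skew_def vector_add_component by (metis minus_add_distrib)

lemma skew_diff: "skew S \<Longrightarrow> skew Y \<Longrightarrow> skew (S - Y)"
  unfolding skew_def vector_minus_component by (metis minus_diff_eq minus_diff_minus)

lemma skew_transpose: "skew S \<longleftrightarrow> transpose S = smat (-1) S"
proof -
  have "transpose S = smat (-1) S \<longleftrightarrow> (\<forall>i k. S $ k $ i = - S $ i $ k)"
    by (simp add: vec_eq_iff transpose_def)
  then show ?thesis unfolding skew_def by blast
qed

lemma skew_act: "skew S \<Longrightarrow> skew (act g S)"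
  by (simp add: skew_transpose act_def matrix_transpose_mul smat_mult matrix_mul_assoc)

lemma skew_refl: "skew A \<Longrightarrow> skew S \<Longrightarrow> skew (refl A S)"
  by (simp add: refl_def skew_diff skew_smat)

lemma skew_dual: "skew (dual S)"
  by (simp add: dual_def skew_skew6)

lemma act_mult: "act (g ** h) S = act g (act h S)"
  by (simp add: act_def matrix_transpose_mul matrix_mul_assoc)

lemma act_smat: "act g (smat c S) = smat c (act g S)" "act (smat c g) S = smat (c\<^sup>2) (act g S)"
  by (simp_all add: act_def smat_mult transpose_smat power2_eq_square)

lemma act_add: "act g (S + Y) = act g S + act g Y"
proof -
  have "(A + B) ** C = A ** C + B ** C" for A B C :: "complex ^ 4 ^ 4"
    by (simp add: vec_eq_iff matrix_matrix_mult_def sum.distrib algebra_simps)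
  then show ?thesis by (simp add: act_def matrix_add_ldistrib)
qed

lemma act_1 [simp]: "act (mat 1) S = S"
  by (simp add: act_def)

lemma pfb_sym: "pfb S Y = pfb Y S"
  by (simp add: pfb_def)

lemma pfb_smat: "pfb (smat c S) Y = c * pfb S Y" "pfb S (smat c Y) = c * pfb S Y"
  by (simp_all add: pfb_def algebra_simps)

lemma pfb_add: "pfb (S + Y) Z = pfb S Z + pfb Y Z" "pfb S (Y + Z) = pfb S Y + pfb S Z"
  by (simp_all add: pfb_def algebra_simps)

lemma pfb_diff: "pfb (S - Y) Z = pfb S Z - pfb Y Z" "pfb S (Y - Z) = pfb S Y - pfb S Z"
  by (simp_all add: pfb_def algebra_simps)

lemma dual_dual: "skew S \<Longrightarrow> dual (dual S) = S"
  by (erule skew_cases) (simp add: dual_def)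

lemma pfb_dual: "pfb (dual S) (dual Y) = pfb S Y"
  by (simp add: pfb_def dual_def algebra_simps)

text \<open>The Clifford relation: \<open>A ** dual A\<close> is a scalar, and polarising it expresses the sandwich
  product through the reflection in \<open>A\<close>.\<close>

lemma mult_dual:
  assumes "skew A"
  shows "A ** dual A = mat (- pfb A A / 2)"
  using assms
  by (elim skew_cases, hypsubst) (simp add: vec_eq_iff forall_4 matrix_matrix_mult_def sum_4
    dual_def pfb_def mat_def field_simps)

lemma sandwich:
  assumes "skew A" "skew S" "pfb A A \<noteq> 0"
  shows "A ** dual S ** A = smat (pfb A A / 2) (refl A S)"
proof -
  have "smat (pfb A A / 2) (refl A S) = smat (pfb A A / 2) S - smat (pfb S A) A"
    using assms(3) by (simp add: refl_def smat_diff)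
  also have "\<dots> = A ** dual S ** A"
    using assms(1,2)
    by (elim skew_cases, hypsubst) (simp add: vec_eq_iff forall_4 matrix_matrix_mult_def sum_4
        dual_def pfb_def field_simps)
  finally show ?thesis by simp
qed

lemma dual_smat: "dual (smat c S) = smat c (dual S)"
  unfolding vec_eq_iff forall_4 by (simp add: dual_def)

lemma dual_refl: "skew A \<Longrightarrow> skew S \<Longrightarrow> dual (refl A S) = refl (dual A) (dual S)"
  unfolding vec_eq_iff forall_4 refl_def pfb_dual by (simp add: dual_def)

text \<open>Hence the product of the reflections in \<open>A\<close> and \<open>B\<close> is, up to a scalar, induced by the matrix
  \<open>A ** dual B\<close>: the lift of a product of two reflections to the spin group.\<close>

lemma act_mult_dual:
  assumes "skew A" "skew B" "skew S" "pfb A A \<noteq> 0" "pfb B B \<noteq> 0"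
  shows "act (A ** dual B) S = smat (pfb A A * pfb B B / 4) (refl A (refl B S))"
proof -
  have "dual B ** S ** dual B = smat (pfb B B / 2) (dual (refl B S))"
    using sandwich[of "dual B" "dual S"] assms
    by (simp add: skew_dual dual_dual pfb_dual dual_refl)
  moreover have "act (A ** dual B) S = A ** (dual B ** S ** dual B) ** A"
    using assms(1) skew_dual[of B] unfolding skew_transpose
    by (simp add: act_def matrix_transpose_mul smat_mult matrix_mul_assoc)
  moreover have "skew (refl B S)" using assms by (simp add: skew_refl)
  ultimately show ?thesis
    using sandwich[of A "refl B S"] assms by (simp add: smat_mult mult.commute)
qed

lemma invertible_if_mult_mat:
  fixes A B :: "complex ^ 4 ^ 4"
  assumes "A ** B = mat c" "c \<noteq> 0"
  shows "invertible A" "invertible B"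
proof -
  have "det (mat c :: complex ^ 4 ^ 4) \<noteq> 0"
    using assms(2) by (subst det_diagonal) (auto simp: mat_def)
  then have "det A * det B \<noteq> 0" using assms(1) by (metis det_mul)
  then show "invertible A" "invertible B" by (auto simp: invertible_det_nz)
qed

lemma invertible_mult_dual:
  assumes "skew A" "skew B" "pfb A A \<noteq> 0" "pfb B B \<noteq> 0"
  shows "invertible (A ** dual B)"
proof -
  have "invertible A" "invertible (dual B)"
    using invertible_if_mult_mat[OF mult_dual[OF assms(1)]]
      invertible_if_mult_mat[OF mult_dual[OF assms(2)]] assms(3,4) by auto
  then show ?thesis by (simp add: invertible_det_nz det_mul)
qed

section \<open>Similitudes of the exterior square\<close>

lemma refl_refl: "pfb A A \<noteq> 0 \<Longrightarrow> refl A (refl A S) = S"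
  by (simp add: refl_def vec_eq_iff pfb_diff pfb_smat field_simps)

lemma pfb_refl:
  assumes "pfb A A \<noteq> 0"
  shows "pfb (refl A S) (refl A Y) = pfb S Y"
  using assms by (simp add: refl_def pfb_diff pfb_smat pfb_sym[of A Y] field_simps)

lemma refl_orthogonal: "pfb S A = 0 \<Longrightarrow> refl A S = S"
  by (simp add: refl_def vec_eq_iff)

lemma refl_add: "refl A (S + Y) = refl A S + refl A Y"
  by (simp add: refl_def vec_eq_iff pfb_add algebra_simps add_divide_distrib)

lemma refl_smat: "refl A (smat c S) = smat c (refl A S)"
  by (simp add: refl_def vec_eq_iff pfb_smat algebra_simps)

lemma refl_self: "pfb A A \<noteq> 0 \<Longrightarrow> refl A A = smat (-1) A"
  by (simp add: refl_def vec_eq_iff)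

lemma refl_swap:
  assumes "pfb U U = pfb V V" "pfb (U - V) (U - V) \<noteq> 0"
  shows "refl (U - V) U = V"
proof -
  have "2 * pfb U (U - V) = pfb (U - V) (U - V)"
    using assms(1) by (simp add: pfb_diff pfb_sym[of V U])
  then have "2 * pfb U (U - V) / pfb (U - V) (U - V) = 1" using assms(2) by simp
  then show ?thesis by (simp only: refl_def smat_1) simp
qed

definition skew_isometry :: "(complex ^ 4 ^ 4 \<Rightarrow> complex ^ 4 ^ 4) \<Rightarrow> bool" where
  "skew_isometry T \<longleftrightarrow> (\<forall>S. skew S \<longrightarrow> skew (T S))
     \<and> (\<forall>S Y. skew S \<longrightarrow> skew Y \<longrightarrow> T (S + Y) = T S + T Y)
     \<and> (\<forall>c S. skew S \<longrightarrow> T (smat c S) = smat c (T S))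
     \<and> (\<forall>S Y. skew S \<longrightarrow> skew Y \<longrightarrow> pfb (T S) (T Y) = pfb S Y)"

lemma skew_isometry_refl:
  assumes "skew_isometry T" "skew A" "pfb A A \<noteq> 0"
  shows "skew_isometry (\<lambda>S. refl A (T S))"
  using assms by (auto simp: skew_isometry_def skew_refl pfb_refl refl_add refl_smat)

definition refl_product :: "(complex ^ 4 ^ 4) list \<Rightarrow> complex ^ 4 ^ 4 \<Rightarrow> complex ^ 4 ^ 4" where
  "refl_product As S = foldr refl As S"

definition skew_basis :: "(complex ^ 4 ^ 4) list" where
  "skew_basis = [skew6 1 0 0 0 0 1, skew6 1 0 0 0 0 (-1), skew6 0 1 0 0 1 0, skew6 0 1 0 0 (-1) 0,
     skew6 0 0 1 1 0 0, skew6 0 0 1 (-1) 0 0]"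

lemma skew_basis_skew: "S \<in> set skew_basis \<Longrightarrow> skew S"
  by (auto simp: skew_basis_def skew_skew6)

lemma skew_basis_anisotropic: "S \<in> set skew_basis \<Longrightarrow> pfb S S \<noteq> 0"
  by (auto simp: skew_basis_def pfb_def)

lemma skew_basis_orthogonal:
  "skew_basis = Zs @ Y # Ys \<Longrightarrow> Z \<in> set Zs \<Longrightarrow> pfb Y Z = 0"
  unfolding skew_basis_def
  by (auto simp: Cons_eq_append_conv pfb_def)

lemma skew_basis_expansion:
  assumes "skew S"
  shows "\<exists>a b c d e f. S = smat a (skew6 1 0 0 0 0 1) + smat b (skew6 1 0 0 0 0 (-1))
    + smat c (skew6 0 1 0 0 1 0) + smat d (skew6 0 1 0 0 (-1) 0)
    + smat e (skew6 0 0 1 1 0 0) + smat f (skew6 0 0 1 (-1) 0 0)"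
proof -
  obtain a b c d e f where S: "S = skew6 a b c d e f" using assms by (rule skew_cases)
  show ?thesis
    unfolding S
    by (rule exI[of _ "(a + f) / 2"], rule exI[of _ "(a - f) / 2"], rule exI[of _ "(b + e) / 2"],
        rule exI[of _ "(b - e) / 2"], rule exI[of _ "(c + d) / 2"], rule exI[of _ "(c - d) / 2"])
      (simp add: vec_eq_iff forall_4 field_simps)
qed

text \<open>The weak form of the Cartan--Dieudonne theorem, by moving the vectors of an orthogonal basis
  back one after the other: of \<open>U - V\<close> and \<open>U + V\<close> at least one is anisotropic.\<close>

lemma isometry_is_refl_product:
  assumes "skew_isometry T" "skew_basis = Zs @ Ys" "\<forall>Z\<in>set Zs. T Z = Z"
  shows "\<exists>As. (\<forall>A\<in>set As. skew A \<and> pfb A A \<noteq> 0) \<and> (\<forall>S. skew S \<longrightarrow> T S = refl_product As S)"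
  using assms
proof (induction Ys arbitrary: T Zs)
  case Nil
  have T: "T Z = Z" if "Z \<in> set skew_basis" for Z using Nil that by simp
  have "T S = S" if sk: "skew S" for S
  proof -
    obtain a b c d e f where S: "S = smat a (skew6 1 0 0 0 0 1) + smat b (skew6 1 0 0 0 0 (-1))
      + smat c (skew6 0 1 0 0 1 0) + smat d (skew6 0 1 0 0 (-1) 0)
      + smat e (skew6 0 0 1 1 0 0) + smat f (skew6 0 0 1 (-1) 0 0)"
      using skew_basis_expansion[OF sk] by blast
    have lin: "\<And>S Y. skew S \<Longrightarrow> skew Y \<Longrightarrow> T (S + Y) = T S + T Y"
      "\<And>c S. skew S \<Longrightarrow> T (smat c S) = smat c (T S)"
      using Nil(1) by (auto simp: skew_isometry_def)
    show ?thesis unfolding S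
      by (simp add: lin skew_add skew_smat skew_skew6 T skew_basis_def)
  qed
  then show ?case by (intro exI[of _ "[]"]) (simp add: refl_product_def)
next
  case (Cons Y Ys)
  have T: "skew_isometry T" by fact
  have "Y \<in> set skew_basis" unfolding Cons.prems(2) by simp
  then have Y: "skew Y" "pfb Y Y \<noteq> 0" by (rule skew_basis_skew, rule skew_basis_anisotropic)
  have TY: "skew (T Y)" "pfb (T Y) (T Y) = pfb Y Y"
    using T Y(1) by (auto simp: skew_isometry_def)
  have orth: "pfb Z Y = 0" "pfb Z (T Y) = 0" if "Z \<in> set Zs" for Z
  proof -
    show "pfb Z Y = 0" using skew_basis_orthogonal[OF Cons.prems(2) that] by (simp add: pfb_sym)
    have "Z \<in> set skew_basis" unfolding Cons.prems(2) using that by simp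
    then have "skew Z" by (rule skew_basis_skew)
    then have "pfb (T Z) (T Y) = pfb Z Y" using T Y(1) by (simp add: skew_isometry_def)
    then show "pfb Z (T Y) = 0" using \<open>pfb Z Y = 0\<close> Cons.prems(3) that by simp
  qed
  have next_step: "\<exists>As. (\<forall>A\<in>set As. skew A \<and> pfb A A \<noteq> 0) \<and> (\<forall>S. skew S \<longrightarrow> T' S = refl_product As S)"
    if "skew_isometry T'" "T' Y = Y" "\<forall>Z\<in>set Zs. T' Z = Z" for T'
    using Cons.IH[of T' "Zs @ [Y]"] that Cons.prems(2) by auto
  show ?case
  proof (cases "pfb (T Y - Y) (T Y - Y) = 0")
    case False
    define D where "D = T Y - Y"
    have D: "skew D" "pfb D D \<noteq> 0" using False TY Y by (auto simp: D_def skew_diff)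
    have "\<exists>As. (\<forall>A\<in>set As. skew A \<and> pfb A A \<noteq> 0)
      \<and> (\<forall>S. skew S \<longrightarrow> refl D (T S) = refl_product As S)"
    proof (rule next_step)
      show "skew_isometry (\<lambda>S. refl D (T S))" by (rule skew_isometry_refl[OF T D])
      show "refl D (T Y) = Y" unfolding D_def by (rule refl_swap) (use TY(2) False in auto)
      show "\<forall>Z\<in>set Zs. refl D (T Z) = Z"
        using orth Cons.prems(3) by (simp add: refl_orthogonal D_def pfb_diff)
    qed
    then obtain As where As: "\<forall>A\<in>set As. skew A \<and> pfb A A \<noteq> 0"
      "\<And>S. skew S \<Longrightarrow> refl D (T S) = refl_product As S" by blast
    have "T S = refl_product (D # As) S" if "skew S" for S
      using As(2)[OF that] refl_refl[OF D(2), of "T S"] by (simp add: refl_product_def)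
    then show ?thesis using As(1) D by (intro exI[of _ "D # As"]) auto
  next
    case True
    define D where "D = T Y - smat (-1) Y"
    have "pfb D D + pfb (T Y - Y) (T Y - Y) = 2 * pfb (T Y) (T Y) + 2 * pfb Y Y"
      by (simp add: D_def pfb_diff pfb_smat)
    then have D: "skew D" "pfb D D \<noteq> 0"
      using True TY Y by (auto simp: D_def skew_diff skew_smat)
    have "\<exists>As. (\<forall>A\<in>set As. skew A \<and> pfb A A \<noteq> 0)
      \<and> (\<forall>S. skew S \<longrightarrow> refl Y (refl D (T S)) = refl_product As S)"
    proof (rule next_step)
      show "skew_isometry (\<lambda>S. refl Y (refl D (T S)))"
        by (rule skew_isometry_refl[OF skew_isometry_refl[OF T D] Y])
      have "refl D (T Y) = smat (-1) Y"
        unfolding D_def by (rule refl_swap) (use TY(2) D in \<open>auto simp: pfb_smat D_def\<close>)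
      then show "refl Y (refl D (T Y)) = Y" by (simp add: refl_smat refl_self[OF Y(2)])
      show "\<forall>Z\<in>set Zs. refl Y (refl D (T Z)) = Z"
        using orth Cons.prems(3) by (simp add: refl_orthogonal D_def pfb_diff pfb_smat)
    qed
    then obtain As where As: "\<forall>A\<in>set As. skew A \<and> pfb A A \<noteq> 0"
      "\<And>S. skew S \<Longrightarrow> refl Y (refl D (T S)) = refl_product As S" by blast
    have "T S = refl_product (D # Y # As) S" if "skew S" for S
      using As(2)[OF that] refl_refl[OF D(2), of "T S"] refl_refl[OF Y(2), of "refl D (T S)"]
      by (simp add: refl_product_def)
    then show ?thesis using As(1) D Y by (intro exI[of _ "D # Y # As"]) auto
  qed
qed

text \<open>Every second reflection is combined with its predecessor; a reflection left over is combined with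
  the fixed one.\<close>

lemma refl_product_lift:
  assumes A: "skew A" "pfb A A \<noteq> 0"
  shows "\<forall>B\<in>set Bs. skew B \<and> pfb B B \<noteq> 0 \<Longrightarrow>
    \<exists>P \<mu>. invertible P \<and> \<mu> \<noteq> 0 \<and>
      ((\<forall>S. skew S \<longrightarrow> refl_product Bs S = smat \<mu> (act P S))
       \<or> (\<forall>S. skew S \<longrightarrow> refl_product Bs S = smat \<mu> (act P (refl A S))))"
proof (induction Bs rule: rev_induct)
  case Nil
  have "invertible (mat 1 :: complex ^ 4 ^ 4)" by (simp add: invertible_det_nz)
  then show ?case by (intro exI[of _ "mat 1"] exI[of _ 1]) (simp add: refl_product_def)
next
  case (snoc B Bs)
  have B: "skew B" "pfb B B \<noteq> 0" using snoc.prems by auto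
  have step: "refl_product (Bs @ [B]) S = refl_product Bs (refl B S)" for S
    by (simp add: refl_product_def)
  obtain P \<mu> where P: "invertible P" "\<mu> \<noteq> 0" and alt:
    "(\<forall>S. skew S \<longrightarrow> refl_product Bs S = smat \<mu> (act P S))
       \<or> (\<forall>S. skew S \<longrightarrow> refl_product Bs S = smat \<mu> (act P (refl A S)))"
    using snoc by auto
  define c where "c = pfb A A * pfb B B / 4"
  have c: "c \<noteq> 0" using A B by (simp add: c_def)
  show ?case
    using alt
  proof
    assume *: "\<forall>S. skew S \<longrightarrow> refl_product Bs S = smat \<mu> (act P S)"
    have "refl_product (Bs @ [B]) S = smat (\<mu> / c) (act (P ** (B ** dual A)) (refl A S))"
      if "skew S" for S
    proof -
      have "refl_product (Bs @ [B]) S = smat \<mu> (act P (refl B S))"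
        unfolding step using * that B by (simp add: skew_refl)
      also have "refl B S = smat (1 / c) (act (B ** dual A) (refl A S))"
        using act_mult_dual[OF B(1) A(1) _ B(2) A(2), of "refl A S"] that A c
        by (simp add: skew_refl refl_refl c_def mult.commute)
      finally show ?thesis by (simp add: act_mult act_smat)
    qed
    moreover have "invertible (P ** (B ** dual A))"
      using P(1) invertible_mult_dual[OF B(1) A(1) B(2) A(2)] by (simp add: invertible_det_nz det_mul)
    ultimately show ?thesis using P(2) c
      by (intro exI[of _ "P ** (B ** dual A)"] exI[of _ "\<mu> / c"]) simp
  next
    assume *: "\<forall>S. skew S \<longrightarrow> refl_product Bs S = smat \<mu> (act P (refl A S))"
    have "refl_product (Bs @ [B]) S = smat (\<mu> / c) (act (P ** (A ** dual B)) S)"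
      if "skew S" for S
    proof -
      have "refl_product (Bs @ [B]) S = smat \<mu> (act P (refl A (refl B S)))"
        unfolding step using * that B by (simp add: skew_refl)
      also have "refl A (refl B S) = smat (1 / c) (act (A ** dual B) S)"
        using act_mult_dual[OF A(1) B(1) that A(2) B(2)] c by (simp add: c_def)
      finally show ?thesis by (simp add: act_mult act_smat)
    qed
    moreover have "invertible (P ** (A ** dual B))"
      using P(1) invertible_mult_dual[OF A(1) B(1) A(2) B(2)] by (simp add: invertible_det_nz det_mul)
    ultimately show ?thesis using P(2) c
      by (intro exI[of _ "P ** (A ** dual B)"] exI[of _ "\<mu> / c"]) simp
  qed
qed

text \<open>A similitude becomes an isometry after division by a square root of its factor.\<close>

theorem similitude_lift:
  assumes A: "skew A" "pfb A A \<noteq> 0" and c: "c \<noteq> 0"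
    and T: "\<And>S. skew S \<Longrightarrow> skew (T S)" "\<And>S Y. skew S \<Longrightarrow> skew Y \<Longrightarrow> T (S + Y) = T S + T Y"
      "\<And>d S. skew S \<Longrightarrow> T (smat d S) = smat d (T S)"
      "\<And>S Y. skew S \<Longrightarrow> skew Y \<Longrightarrow> pfb (T S) (T Y) = c * pfb S Y"
  shows "\<exists>P \<mu>. invertible P \<and> \<mu> \<noteq> 0 \<and>
      ((\<forall>S. skew S \<longrightarrow> T S = smat \<mu> (act P S))
       \<or> (\<forall>S. skew S \<longrightarrow> T S = smat \<mu> (act P (refl A S))))"
proof -
  define d where "d = csqrt c"
  have d: "d \<noteq> 0" "d\<^sup>2 = c" using c by (auto simp: d_def)
  have "skew_isometry (\<lambda>S. smat (1 / d) (T S))"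
    unfolding skew_isometry_def
    using T d c by (simp add: skew_smat smat_add pfb_smat power2_eq_square field_simps)
  from isometry_is_refl_product[OF this, of "[]"] obtain Bs where
    Bs: "\<forall>B\<in>set Bs. skew B \<and> pfb B B \<noteq> 0" "\<And>S. skew S \<Longrightarrow> smat (1 / d) (T S) = refl_product Bs S"
    by auto
  have TX: "T S = smat d (refl_product Bs S)" if "skew S" for S
    using Bs(2)[OF that, symmetric] d by simp
  obtain P \<mu> where "invertible P" "\<mu> \<noteq> 0" and
    "(\<forall>S. skew S \<longrightarrow> refl_product Bs S = smat \<mu> (act P S))
       \<or> (\<forall>S. skew S \<longrightarrow> refl_product Bs S = smat \<mu> (act P (refl A S)))"
    using refl_product_lift[OF A Bs(1)] by blast
  then show ?thesis using TX d(1) by (intro exI[of _ P] exI[of _ "d * \<mu>"]) auto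
qed

section \<open>Coordinates on exterior powers\<close>

lemmas vlinear_iff = Vector_Spaces.linear_iff

lemma coordinates_exist:
  fixes sV :: "complex \<Rightarrow> 'v::ab_group_add \<Rightarrow> 'v"
  assumes "vector_space sV" "vector_space.dim sV UNIV = 4"
  shows "\<exists>\<psi> :: 'v \<Rightarrow> complex ^ 4. Vector_Spaces.linear sV (*s) \<psi> \<and> bij \<psi>"
proof -
  interpret V: vector_space sV by fact
  obtain B where B: "V.independent B" "UNIV \<subseteq> V.span B" "card B = 4"
    using V.basis_exists[of UNIV] assms(2) by metis
  have "finite B" using B(3) card.infinite by fastforce
  then obtain e :: "4 \<Rightarrow> 'v" where e: "bij_betw e UNIV B"
    using finite_same_card_bij[of "UNIV :: 4 set" B] B(3) by auto
  have eB: "e i \<in> B" for i using e by (auto simp: bij_betw_def)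
  have sp: "v \<in> V.span B" for v using B(2) by auto
  define \<psi> :: "'v \<Rightarrow> complex ^ 4" where "\<psi> v = (\<chi> i. V.representation B v (e i))" for v
  have lin: "Vector_Spaces.linear sV (*s) \<psi>"
    unfolding vlinear_iff
    using assms(1) vec.vector_space_axioms V.representation_add[OF B(1) sp sp]
      V.representation_scale[OF B(1) sp] by (simp add: \<psi>_def vec_eq_iff)
  interpret p: Vector_Spaces.linear sV "(*s)" \<psi> by fact
  have "v = 0" if "\<psi> v = 0" for v
  proof -
    have "V.representation B v (e i) = 0" for i using that by (simp add: \<psi>_def vec_eq_iff)
    then have "V.representation B v b = 0" if "b \<in> B" for b
      using e that by (metis bij_betw_iff_bijections)
    then show "v = 0"
      using V.sum_representation_eq[OF B(1) sp[of v] \<open>finite B\<close> order_refl] by simp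
  qed
  then have inj: "inj \<psi>" by (metis injI p.diff right_minus_eq)
  have surj: "surj \<psi>"
  proof (rule surjI)
    fix v :: "complex ^ 4"
    have "\<psi> (e i) = axis i 1" for i
      using V.representation_basis[OF B(1) eB] e
      by (auto simp: \<psi>_def vec_eq_iff axis_def bij_betw_def inj_eq)
    then show "\<psi> (\<Sum>i\<in>UNIV. sV (v $ i) (e i)) = v"
      by (simp add: p.sum p.scale basis_expansion)
  qed
  show ?thesis using lin inj surj by (auto simp: bij_def)
qed

lemma vector_space_complex: "vector_space ((*) :: complex \<Rightarrow> complex \<Rightarrow> complex)"
  by unfold_locales (auto simp: algebra_simps)

text \<open>By uniqueness in the universal property, the decomposable vectors span.\<close>

lemma exterior_power_span:
  fixes s :: "complex \<Rightarrow> 'v::ab_group_add \<Rightarrow> 'v" and t :: "complex \<Rightarrow> 'e::ab_group_add \<Rightarrow> 'e"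
  assumes ext: "is_exterior_power k s t w"
  shows "module.span t {w vs | vs. length vs = k} = UNIV"
proof (rule ccontr)
  have V: "vector_space s" and E: "vector_space t" using ext by (auto simp: is_exterior_power_def)
  interpret E: vector_space t by fact
  interpret C: vector_space "(*) :: complex \<Rightarrow> complex \<Rightarrow> complex" by (rule vector_space_complex)
  interpret EC: vector_space_pair t "(*) :: complex \<Rightarrow> complex \<Rightarrow> complex" ..
  define D where "D = {w vs | vs. length vs = k}"
  assume "E.span {w vs | vs. length vs = k} \<noteq> UNIV"
  then obtain x where x: "x \<notin> E.span D" unfolding D_def by blast
  obtain B where B: "B \<subseteq> D" "E.independent B" "D \<subseteq> E.span B"
    by (rule E.maximal_independent_subset)
  have span: "E.span B = E.span D"
    using B by (meson E.span_minimal E.span_mono E.subspace_span subset_antisym)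
  have "E.independent (insert x B)" using x B(2) span by (simp add: E.independent_insertI)
  from EC.linear_independent_extend[OF this, of "\<lambda>b. if b = x then 1 else 0"] obtain g where
    g: "Vector_Spaces.linear t (*) g" "\<And>b. b \<in> insert x B \<Longrightarrow> g b = (if b = x then 1 else 0)"
    by blast
  interpret g: Vector_Spaces.linear t "(*)" g by fact
  have "x \<notin> B" using x span E.span_base by blast
  then have gB: "g b = 0" if "b \<in> B" for b using g(2)[of b] that by auto
  have "g y = 0" if "y \<in> E.span B" for y
    using that by (induction rule: E.span_induct_alt) (simp_all add: g.add g.scale gB)
  then have gw: "g (w vs) = 0" if "length vs = k" for vs
    using that span E.span_base[of "w vs" D] by (auto simp: D_def)
  have zero: "Vector_Spaces.linear t (*) (\<lambda>_. 0 :: complex)"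
    unfolding vlinear_iff using E vector_space_complex by simp
  have "alternating_map k s ((*) :: complex \<Rightarrow> complex \<Rightarrow> complex) (\<lambda>_. 0)"
    unfolding alternating_map_def vlinear_iff using V vector_space_complex by simp
  then have "\<exists>!\<phi>. Vector_Spaces.linear t (*) \<phi> \<and> (\<forall>vs. length vs = k \<longrightarrow> \<phi> (w vs) = 0)"
    using ext unfolding is_exterior_power_def by blast
  then have "g = (\<lambda>_. 0)" using g(1) gw zero by (metis (no_types, lifting))
  moreover have "g x = 1" using g(2)[of x] by simp
  ultimately show False by simp
qed

lemma exterior_power_eqI:
  assumes ext: "is_exterior_power k s t w"
    and f: "\<And>x y. f (x + y) = f x + f y" "\<And>c x. f (t c x) = r c (f x)" "f 0 = 0"
    and g: "\<And>x y. g (x + y) = g x + g y" "\<And>c x. g (t c x) = r c (g x)" "g 0 = 0"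
    and eq: "\<And>vs. length vs = k \<Longrightarrow> f (w vs) = g (w vs)"
  shows "f x = g x"
proof -
  interpret E: vector_space t using ext by (simp add: is_exterior_power_def)
  have "x \<in> E.span {w vs | vs. length vs = k}" using exterior_power_span[OF ext] by simp
  then show ?thesis
    by (induction rule: E.span_induct_alt) (use f g eq in auto)
qed

definition wd :: "complex ^ 4 \<Rightarrow> complex ^ 4 \<Rightarrow> complex ^ 4 ^ 4" where
  "wd p q = (\<chi> i k. p $ i * q $ k - q $ i * p $ k)"

lemma mult_axis_entry: "(A *v axis k 1) $ i = A $ i $ k" for A :: "complex ^ 4 ^ 4"
  by (simp add: matrix_vector_mult_def axis_def if_distrib[of "\<lambda>x. _ * x"] cong: if_cong)

lemma skew_wd: "skew (wd p q)"
  by (simp add: skew_def wd_def)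

lemma act_wd: "act g (wd p q) = wd (g *v p) (g *v q)"
proof -
  have "act g (wd p q) $ i $ k = wd (g *v p) (g *v q) $ i $ k" for i k
    by (simp add: act_def wd_def matrix_matrix_mult_def matrix_vector_mult_def transpose_def sum_4)
      (simp add: algebra_simps)
  then show ?thesis by (simp add: vec_eq_iff)
qed

text \<open>Coordinates \<open>\<psi>\<close> on the space and the induced coordinates \<open>\<Phi>\<close> on its exterior square.\<close>

locale wedge_coords =
  fixes sV :: "complex \<Rightarrow> 'v::ab_group_add \<Rightarrow> 'v" and s2 :: "complex \<Rightarrow> 'e::ab_group_add \<Rightarrow> 'e"
    and w :: "'v list \<Rightarrow> 'e" and \<psi> :: "'v \<Rightarrow> complex ^ 4" and \<Phi> :: "'e \<Rightarrow> complex ^ 4 ^ 4"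
  assumes ext: "is_exterior_power 2 sV s2 w"
    and psi_linear: "Vector_Spaces.linear sV (*s) \<psi>" and psi_bij: "bij \<psi>"
    and Phi_add: "\<Phi> (x + y) = \<Phi> x + \<Phi> y" and Phi_scale: "\<Phi> (s2 c x) = smat c (\<Phi> x)"
    and Phi_wedge: "\<Phi> (w [u, v]) = wd (\<psi> u) (\<psi> v)"
    and Phi_bij: "bij_betw \<Phi> UNIV {S. skew S}"

text \<open>Applies to the wedge product of two vectors, and to one of four vectors in the first and in the
  last two arguments.\<close>

lemma alternating2_expand:
  fixes t :: "complex \<Rightarrow> 'f::ab_group_add \<Rightarrow> 'f"
  assumes t: "vector_space t"
    and add: "\<And>u u' v. F (u + u') v = F u v + F u' v" "\<And>u v v'. F u (v + v') = F u v + F u v'"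
    and scale: "\<And>c u v. F (s c u) v = t c (F u v)" "\<And>c u v. F u (s c v) = t c (F u v)"
    and alt: "\<And>u. F u u = 0"
    and u: "u = s (p $ 1) b1 + s (p $ 2) b2 + s (p $ 3) b3 + s (p $ 4) b4"
    and v: "v = s (q $ 1) b1 + s (q $ 2) b2 + s (q $ 3) b3 + s (q $ 4) b4"
  shows "F u v = t (wd p q $ 1 $ 2) (F b1 b2) + t (wd p q $ 1 $ 3) (F b1 b3)
    + t (wd p q $ 1 $ 4) (F b1 b4) + t (wd p q $ 2 $ 3) (F b2 b3)
    + t (wd p q $ 2 $ 4) (F b2 b4) + t (wd p q $ 3 $ 4) (F b3 b4)"
proof -
  interpret T: vector_space t by fact
  have swap: "F y x = - F x y" for x y
  proof -
    have "F (x + y) (x + y) = F x y + F y x" unfolding add by (simp add: alt)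
    then show ?thesis by (simp add: alt add_eq_0_iff)
  qed
  show ?thesis
    unfolding u v add scale T.scale_scale alt swap[of b2 b1] swap[of b3 b1] swap[of b4 b1]
      swap[of b3 b2] swap[of b4 b2] swap[of b4 b3] T.scale_right_distrib
    by (simp add: wd_def T.scale_left_diff_distrib T.scale_right_diff_distrib algebra_simps)
qed

lemma alternating2:
  assumes "alternating_map 2 s t f"
  shows "f [u + u', v] = f [u, v] + f [u', v]" "f [u, v + v'] = f [u, v] + f [u, v']"
    "f [s c u, v] = t c (f [u, v])" "f [u, s c v] = t c (f [u, v])" "f [u, u] = 0"
proof -
  have lin: "Vector_Spaces.linear s t (\<lambda>x. f ([u, v][i := x]))" if "i < 2" for i u v
    using assms that unfolding alternating_map_def by (metis One_nat_def Suc_1 length_Cons list.size(3))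
  show "f [u + u', v] = f [u, v] + f [u', v]" "f [s c u, v] = t c (f [u, v])"
    using lin[of 0 u v] unfolding vlinear_iff by auto
  show "f [u, v + v'] = f [u, v] + f [u, v']" "f [u, s c v] = t c (f [u, v])"
    using lin[of 1 u v] unfolding vlinear_iff by auto
  have "\<forall>vs i j. length vs = 2 \<and> i < j \<and> j < 2 \<and> vs ! i = vs ! j \<longrightarrow> f vs = 0"
    using assms unfolding alternating_map_def by blast
  from this[rule_format, of "[u, u]" 0 1] show "f [u, u] = 0" by simp
qed

lemma alternating4:
  assumes "alternating_map 4 s t f"
  shows "f [a + a', b, c, d] = f [a, b, c, d] + f [a', b, c, d]"
    "f [a, b + b', c, d] = f [a, b, c, d] + f [a, b', c, d]"
    "f [a, b, c + c', d] = f [a, b, c, d] + f [a, b, c', d]"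
    "f [a, b, c, d + d'] = f [a, b, c, d] + f [a, b, c, d']"
    "f [s z a, b, c, d] = t z (f [a, b, c, d])" "f [a, s z b, c, d] = t z (f [a, b, c, d])"
    "f [a, b, s z c, d] = t z (f [a, b, c, d])" "f [a, b, c, s z d] = t z (f [a, b, c, d])"
    "f [a, a, c, d] = 0" "f [a, b, a, d] = 0" "f [a, b, c, a] = 0"
    "f [a, b, b, d] = 0" "f [a, b, c, b] = 0" "f [a, b, c, c] = 0"
proof -
  have lin: "Vector_Spaces.linear s t (\<lambda>x. f ([a, b, c, d][i := x]))" if "i < 4" for i
    using assms that unfolding alternating_map_def
    by (elim conjE allE[of _ "[a, b, c, d]"] allE[of _ i]) simp
  show "f [a + a', b, c, d] = f [a, b, c, d] + f [a', b, c, d]"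
    "f [s z a, b, c, d] = t z (f [a, b, c, d])"
    using lin[of 0] unfolding vlinear_iff by auto
  show "f [a, b + b', c, d] = f [a, b, c, d] + f [a, b', c, d]"
    "f [a, s z b, c, d] = t z (f [a, b, c, d])"
    using lin[of 1] unfolding vlinear_iff by auto
  show "f [a, b, c + c', d] = f [a, b, c, d] + f [a, b, c', d]"
    "f [a, b, s z c, d] = t z (f [a, b, c, d])"
    using lin[of 2] unfolding vlinear_iff by (auto simp: numeral_2_eq_2)
  show "f [a, b, c, d + d'] = f [a, b, c, d] + f [a, b, c, d']"
    "f [a, b, c, s z d] = t z (f [a, b, c, d])"
    using lin[of 3] unfolding vlinear_iff by (auto simp: numeral_3_eq_3)
  have "\<forall>vs i j. length vs = 4 \<and> i < j \<and> j < 4 \<and> vs ! i = vs ! j \<longrightarrow> f vs = 0"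
    using assms unfolding alternating_map_def by blast
  note z = this[rule_format]
  show "f [a, a, c, d] = 0" "f [a, b, a, d] = 0" "f [a, b, c, a] = 0"
    "f [a, b, b, d] = 0" "f [a, b, c, b] = 0" "f [a, b, c, c] = 0"
    using z[of "[a, a, c, d]" 0 1] z[of "[a, b, a, d]" 0 2] z[of "[a, b, c, a]" 0 3]
      z[of "[a, b, b, d]" 1 2] z[of "[a, b, c, b]" 1 3] z[of "[a, b, c, c]" 2 3]
    by (simp_all add: numeral_2_eq_2 numeral_3_eq_3)
qed

lemma list_length_2: "length vs = 2 \<longleftrightarrow> (\<exists>u v. vs = [u, v])"
  by (auto simp: numeral_2_eq_2 length_Suc_conv)

lemma list_length_4: "length vs = 4 \<longleftrightarrow> (\<exists>a b c d. vs = [a, b, c, d])"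
  by (auto simp: eval_nat_numeral length_Suc_conv)

lemma psi_expansion:
  fixes sV :: "complex \<Rightarrow> 'v::ab_group_add \<Rightarrow> 'v" and \<psi> :: "'v \<Rightarrow> complex ^ 4"
  assumes "Vector_Spaces.linear sV (*s) \<psi>" "bij \<psi>"
  shows "u = sV (\<psi> u $ 1) (inv_into UNIV \<psi> (axis 1 1)) + sV (\<psi> u $ 2) (inv_into UNIV \<psi> (axis 2 1))
    + sV (\<psi> u $ 3) (inv_into UNIV \<psi> (axis 3 1)) + sV (\<psi> u $ 4) (inv_into UNIV \<psi> (axis 4 1))" (is "u = ?r")
proof -
  interpret p: Vector_Spaces.linear sV "(*s)" \<psi> by fact
  have inv: "\<psi> (inv_into UNIV \<psi> x) = x" for x using assms(2) by (simp add: bij_is_surj surj_f_inv_f)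
  have "\<psi> u = (\<Sum>i\<in>UNIV. \<psi> u $ i *s axis i 1)" by (simp add: basis_expansion)
  also have "\<dots> = \<psi> ?r" by (simp add: p.add p.scale inv sum_4)
  finally show ?thesis using assms(2) by (simp add: bij_is_inj inj_eq)
qed

lemma wedge_coords_exist:
  fixes sV :: "complex \<Rightarrow> 'v::ab_group_add \<Rightarrow> 'v" and s2 :: "complex \<Rightarrow> 'e::ab_group_add \<Rightarrow> 'e"
  assumes V: "vector_space.dim sV UNIV = 4" and ext: "is_exterior_power 2 sV s2 w"
  shows "\<exists>\<psi> \<Phi>. wedge_coords sV s2 w \<psi> \<Phi>"
proof -
  have vs: "vector_space sV" "vector_space s2" and altw: "alternating_map 2 sV s2 w"
    using ext by (auto simp: is_exterior_power_def)
  interpret E: vector_space s2 by fact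
  obtain \<psi> :: "'v \<Rightarrow> complex ^ 4" where \<psi>: "Vector_Spaces.linear sV (*s) \<psi>" "bij \<psi>"
    using coordinates_exist[OF vs(1) V] by blast
  interpret p: Vector_Spaces.linear sV "(*s)" \<psi> by fact
  note w = alternating2[OF altw]
  have "\<exists>\<phi>. Vector_Spaces.linear s2 (*) \<phi> \<and> (\<forall>vs. length vs = 2 \<longrightarrow> \<phi> (w vs) = wd (\<psi> (vs ! 0)) (\<psi> (vs ! 1)) $ i $ k)"
    for i k
  proof -
    have "alternating_map 2 sV (*) (\<lambda>vs. wd (\<psi> (vs ! 0)) (\<psi> (vs ! 1)) $ i $ k)"
      unfolding alternating_map_def
    proof (intro conjI allI impI)
      fix vs :: "'v list" and j :: nat assume a: "length vs = 2 \<and> j < 2"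
      then obtain u v where uv: "vs = [u, v]" by (auto simp: list_length_2)
      from a consider "j = 0" | "j = 1" by linarith
      then show "Vector_Spaces.linear sV (*) (\<lambda>x. wd (\<psi> (vs[j := x] ! 0)) (\<psi> (vs[j := x] ! 1)) $ i $ k)"
        by cases (use vs(1) vector_space_complex in
          \<open>auto simp: uv vlinear_iff wd_def p.add p.scale algebra_simps\<close>)
    next
      fix vs :: "'v list" and j l assume "length vs = 2 \<and> j < l \<and> l < 2 \<and> vs ! j = vs ! l"
      then have "vs ! 0 = vs ! 1" by (auto simp: less_2_cases_iff)
      then show "wd (\<psi> (vs ! 0)) (\<psi> (vs ! 1)) $ i $ k = 0" by (simp add: wd_def)
    qed
    then show ?thesis using ext unfolding is_exterior_power_def by blast
  qed
  then obtain \<phi> where \<phi>: "\<And>i k. Vector_Spaces.linear s2 (*) (\<phi> i k)"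
    "\<And>i k vs. length vs = 2 \<Longrightarrow> \<phi> i k (w vs) = wd (\<psi> (vs ! 0)) (\<psi> (vs ! 1)) $ i $ k" by metis
  define \<Phi> where "\<Phi> x = (\<chi> i k. \<phi> i k x)" for x
  have add: "\<Phi> (x + y) = \<Phi> x + \<Phi> y" and scale: "\<Phi> (s2 c x) = smat c (\<Phi> x)" for x y c
    using \<phi>(1) unfolding vlinear_iff by (auto simp: \<Phi>_def vec_eq_iff)
  have zero: "\<Phi> 0 = 0" using add[of 0 0] by simp
  have wedge: "\<Phi> (w [u, v]) = wd (\<psi> u) (\<psi> v)" for u v
    using \<phi>(2)[of "[u, v]"] by (simp add: \<Phi>_def vec_eq_iff)
  have skew: "skew (\<Phi> x)" for x
  proof -
    have "transpose (\<Phi> x) = smat (-1) (\<Phi> x)"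
    proof (rule exterior_power_eqI[OF ext, where f = "\<lambda>x. transpose (\<Phi> x)" and r = smat])
      show "transpose (\<Phi> (w vs)) = smat (-1) (\<Phi> (w vs))" if "length vs = 2" for vs
        using that skew_wd by (auto simp: list_length_2 wedge skew_transpose)
    qed (auto simp: add scale zero transpose_smat smat_add vec_eq_iff transpose_def)
    then show ?thesis by (simp add: skew_transpose)
  qed
  define b where "b i = inv_into UNIV \<psi> (axis i 1)" for i
  define \<Psi> where "\<Psi> S = s2 (S $ 1 $ 2) (w [b 1, b 2]) + s2 (S $ 1 $ 3) (w [b 1, b 3])
    + s2 (S $ 1 $ 4) (w [b 1, b 4]) + s2 (S $ 2 $ 3) (w [b 2, b 3])
    + s2 (S $ 2 $ 4) (w [b 2, b 4]) + s2 (S $ 3 $ 4) (w [b 3, b 4])" for S :: "complex ^ 4 ^ 4"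
  have "\<Psi> (\<Phi> x) = x" for x
  proof (rule exterior_power_eqI[OF ext, where f = "\<lambda>x. \<Psi> (\<Phi> x)" and r = s2])
    show "\<Psi> (\<Phi> (w vs)) = w vs" if len: "length vs = 2" for vs
    proof -
      obtain u v where uv: "vs = [u, v]" using len by (auto simp: list_length_2)
      have "w [u, v] = \<Psi> (wd (\<psi> u) (\<psi> v))"
        unfolding \<Psi>_def
        by (rule alternating2_expand[OF vs(2), where F = "\<lambda>u v. w [u, v]" and s = sV])
          (use w psi_expansion[OF \<psi>] in \<open>simp_all add: b_def\<close>)
      then show ?thesis unfolding uv wedge by (rule sym)
    qed
  qed (simp_all add: add scale zero \<Psi>_def E.scale_left_distrib E.scale_right_distrib)
  moreover have "\<Phi> (\<Psi> S) = S" if "skew S" for S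
  proof -
    have "\<psi> (b i) = axis i 1" for i using \<psi>(2) by (simp add: b_def bij_is_surj surj_f_inv_f)
    then have "\<Phi> (\<Psi> S) = skew6 (S $ 1 $ 2) (S $ 1 $ 3) (S $ 1 $ 4) (S $ 2 $ 3) (S $ 2 $ 4) (S $ 3 $ 4)"
      unfolding vec_eq_iff forall_4
      by (simp add: \<Psi>_def add scale wedge wd_def axis_def)
    then show ?thesis using skew_eq_skew6[OF that] by simp
  qed
  ultimately have "bij_betw \<Phi> UNIV {S. skew S}"
    using skew by (intro bij_betw_byWitness[where f' = \<Psi>]) auto
  then show ?thesis using ext \<psi> add scale wedge
    by (intro exI[of _ \<psi>] exI[of _ \<Phi>]) (simp add: wedge_coords_def)
qed

context wedge_coords
begin

lemma psi_inv: "\<psi> (inv_into UNIV \<psi> x) = x" "inv_into UNIV \<psi> (\<psi> v) = v"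
  using psi_bij by (simp_all add: bij_is_surj surj_f_inv_f bij_is_inj)

lemma psi_eq_iff: "\<psi> u = \<psi> v \<longleftrightarrow> u = v"
  using psi_bij by (simp add: bij_is_inj inj_eq)

lemma psi_add: "\<psi> (u + v) = \<psi> u + \<psi> v" and psi_scale: "\<psi> (sV c u) = c *s \<psi> u"
  using psi_linear unfolding vlinear_iff by auto

lemma Phi_skew: "skew (\<Phi> x)"
  using Phi_bij by (auto simp: bij_betw_def)

lemma Phi_eq_iff: "\<Phi> x = \<Phi> y \<longleftrightarrow> x = y"
  using Phi_bij by (auto simp: bij_betw_def inj_eq)

definition Phi_inv :: "complex ^ 4 ^ 4 \<Rightarrow> 'e" where
  "Phi_inv S = inv_into UNIV \<Phi> S"

lemma Phi_inv: "skew S \<Longrightarrow> \<Phi> (Phi_inv S) = S" "Phi_inv (\<Phi> x) = x"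
  using Phi_bij by (auto simp: Phi_inv_def bij_betw_def intro: f_inv_into_f)

lemma Phi_zero: "\<Phi> 0 = 0"
  using Phi_add[of 0 0] by simp

lemma change_coords:
  assumes "invertible P"
  shows "wedge_coords sV s2 w (\<lambda>v. P *v \<psi> v) (\<lambda>x. act P (\<Phi> x))"
proof -
  obtain P' where P': "P ** P' = mat 1" "P' ** P = mat 1" using assms unfolding invertible_def by blast
  have "Vector_Spaces.linear sV (*s) (\<lambda>v. P *v \<psi> v)"
    using psi_linear unfolding vlinear_iff by (simp add: matrix_vector_right_distrib vec.scale)
  moreover have "bij (\<lambda>v. P *v \<psi> v)"
    by (rule bij_betw_byWitness[where f' = "\<lambda>x. inv_into UNIV \<psi> (P' *v x)"])
      (auto simp: psi_inv matrix_vector_mul_assoc P')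
  moreover have "bij_betw (\<lambda>x. act P (\<Phi> x)) UNIV {S. skew S}"
    by (rule bij_betw_byWitness[where f' = "\<lambda>S. Phi_inv (act P' S)"])
      (auto simp: skew_act Phi_skew Phi_inv act_mult[symmetric] P')
  ultimately show ?thesis
    using ext by (simp add: wedge_coords_def Phi_add Phi_scale act_add act_smat Phi_wedge act_wd)
qed

definition lmap :: "complex ^ 4 ^ 4 \<Rightarrow> 'v \<Rightarrow> 'v" where
  "lmap M v = inv_into UNIV \<psi> (M *v \<psi> v)"

definition emap :: "complex ^ 4 ^ 4 \<Rightarrow> 'e \<Rightarrow> 'e" where
  "emap M x = Phi_inv (act M (\<Phi> x))"

lemma psi_lmap: "\<psi> (lmap M v) = M *v \<psi> v"
  by (simp add: lmap_def psi_inv)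

lemma Phi_emap: "\<Phi> (emap M x) = act M (\<Phi> x)"
  by (simp add: emap_def Phi_inv skew_act Phi_skew)

lemma vs: "vector_space sV" "vector_space s2"
  using ext by (auto simp: is_exterior_power_def)

lemma emap_linear: "Vector_Spaces.linear s2 s2 (emap M)"
proof -
  have "\<Phi> (emap M (x + y)) = \<Phi> (emap M x + emap M y)" "\<Phi> (emap M (s2 c x)) = \<Phi> (s2 c (emap M x))"
    for x y c by (simp_all add: Phi_emap Phi_add Phi_scale act_add act_smat)
  then show ?thesis unfolding vlinear_iff using vs by (simp add: Phi_eq_iff)
qed

lemma exterior_power_map_lmap: "exterior_power_map 2 s2 w (lmap M) = emap M"
  unfolding exterior_power_map_def
proof (rule the_equality)
  have "\<Phi> (emap M (w [u, v])) = \<Phi> (w [lmap M u, lmap M v])" for u v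
    by (simp add: Phi_emap Phi_wedge act_wd psi_lmap)
  then have wedge: "emap M (w vs) = w (map (lmap M) vs)" if "length vs = 2" for vs
    using that by (auto simp: list_length_2 Phi_eq_iff)
  then show "Vector_Spaces.linear s2 s2 (emap M) \<and>
      (\<forall>vs. length vs = 2 \<longrightarrow> emap M (w vs) = w (map (lmap M) vs))"
    using emap_linear by blast
  fix h assume h: "Vector_Spaces.linear s2 s2 h \<and> (\<forall>vs. length vs = 2 \<longrightarrow> h (w vs) = w (map (lmap M) vs))"
  have z: "h 0 = 0" if "Vector_Spaces.linear s2 s2 h" for h
    using that unfolding vlinear_iff by (metis add_cancel_right_right)
  show "h = emap M"
    by (rule HOL.ext, rule exterior_power_eqI[OF local.ext, where r = s2])
      (use h wedge emap_linear[of M] z in \<open>auto simp: vlinear_iff\<close>)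
qed

text \<open>Both sides of the formula for the form are determined by their values on decomposable
  vectors, where it says that a fourfold wedge is a multiple of one determinant.\<close>

lemma beta_wedge_eq_pfb:
  fixes s4 :: "complex \<Rightarrow> 'f::ab_group_add \<Rightarrow> 'f"
  assumes ext4: "is_exterior_power 4 sV s4 w4" and gen: "module.span s4 {\<epsilon>} = UNIV"
  shows "\<exists>\<kappa>. \<kappa> \<noteq> 0 \<and> (\<forall>x y. beta_wedge s2 s4 w w4 \<epsilon> x y = \<kappa> * pfb (\<Phi> x) (\<Phi> y))"
proof -
  have vs4: "vector_space s4" and alt: "alternating_map 4 sV s4 w4"
    using ext4 by (auto simp: is_exterior_power_def)
  interpret F: vector_space s4 by fact
  note w4 = alternating4[OF alt]
  define b where "b i = inv_into UNIV \<psi> (axis i 1)" for i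
  define D where "D = w4 [b 1, b 2, b 3, b 4]"
  have swap1: "w4 [y, x, c, d] = - w4 [x, y, c, d]" for x y c d
  proof -
    have "0 = w4 [x + y, x + y, c, d]" by (simp add: w4(9))
    also have "\<dots> = w4 [x, y, c, d] + w4 [y, x, c, d]"
      unfolding w4(1) unfolding w4(2) by (simp add: w4(9))
    finally show ?thesis by (metis add.commute eq_neg_iff_add_eq_0)
  qed
  have swap2: "w4 [a, y, x, d] = - w4 [a, x, y, d]" for x y a d
  proof -
    have "0 = w4 [a, x + y, x + y, d]" by (simp add: w4(12))
    also have "\<dots> = w4 [a, x, y, d] + w4 [a, y, x, d]"
      unfolding w4(2) unfolding w4(3) by (simp add: w4(12))
    finally show ?thesis by (metis add.commute eq_neg_iff_add_eq_0)
  qed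
  have swap3: "w4 [a, c, y, x] = - w4 [a, c, x, y]" for x y a c
  proof -
    have "0 = w4 [a, c, x + y, x + y]" by (simp add: w4(14))
    also have "\<dots> = w4 [a, c, x, y] + w4 [a, c, y, x]"
      unfolding w4(3) unfolding w4(4) by (simp add: w4(14))
    finally show ?thesis by (metis add.commute eq_neg_iff_add_eq_0)
  qed
  have exp: "u = sV (\<psi> u $ 1) (b 1) + sV (\<psi> u $ 2) (b 2) + sV (\<psi> u $ 3) (b 3) + sV (\<psi> u $ 4) (b 4)" for u
    unfolding b_def by (rule psi_expansion[OF psi_linear psi_bij])
  have inner: "w4 [u, v, x, y] = s4 (wd (\<psi> x) (\<psi> y) $ 1 $ 2) (w4 [u, v, b 1, b 2])
    + s4 (wd (\<psi> x) (\<psi> y) $ 1 $ 3) (w4 [u, v, b 1, b 3])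
    + s4 (wd (\<psi> x) (\<psi> y) $ 1 $ 4) (w4 [u, v, b 1, b 4])
    + s4 (wd (\<psi> x) (\<psi> y) $ 2 $ 3) (w4 [u, v, b 2, b 3])
    + s4 (wd (\<psi> x) (\<psi> y) $ 2 $ 4) (w4 [u, v, b 2, b 4])
    + s4 (wd (\<psi> x) (\<psi> y) $ 3 $ 4) (w4 [u, v, b 3, b 4])" for u v x y
    by (rule alternating2_expand[OF vs4, where F = "\<lambda>x y. w4 [u, v, x, y]" and s = sV])
      (simp_all add: w4 exp[symmetric])
  have outer: "w4 [u, v, x, y] = s4 (wd (\<psi> u) (\<psi> v) $ 1 $ 2) (w4 [b 1, b 2, x, y])
    + s4 (wd (\<psi> u) (\<psi> v) $ 1 $ 3) (w4 [b 1, b 3, x, y])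
    + s4 (wd (\<psi> u) (\<psi> v) $ 1 $ 4) (w4 [b 1, b 4, x, y])
    + s4 (wd (\<psi> u) (\<psi> v) $ 2 $ 3) (w4 [b 2, b 3, x, y])
    + s4 (wd (\<psi> u) (\<psi> v) $ 2 $ 4) (w4 [b 2, b 4, x, y])
    + s4 (wd (\<psi> u) (\<psi> v) $ 3 $ 4) (w4 [b 3, b 4, x, y])" for u v x y
    by (rule alternating2_expand[OF vs4, where F = "\<lambda>u v. w4 [u, v, x, y]" and s = sV])
      (simp_all add: w4 exp[symmetric])
  have perms: "w4 [b 1, b 3, b 2, b 4] = - D" "w4 [b 1, b 4, b 2, b 3] = D" "w4 [b 2, b 3, b 1, b 4] = D"
    "w4 [b 2, b 4, b 1, b 3] = - D" "w4 [b 3, b 4, b 1, b 2] = D"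
    using swap2[of "b 1" "b 3" "b 2" "b 4"] swap2[of "b 1" "b 4" "b 2" "b 3"] swap3[of "b 1" "b 2" "b 4" "b 3"]
      swap2[of "b 2" "b 3" "b 1" "b 4"] swap1[of "b 2" "b 1" "b 3" "b 4"] swap2[of "b 2" "b 4" "b 1" "b 3"]
      swap1[of "b 2" "b 1" "b 4" "b 3"] swap2[of "b 3" "b 4" "b 1" "b 2"] swap1[of "b 3" "b 1" "b 4" "b 2"] swap3[of "b 1" "b 3" "b 4" "b 2"]
    by (simp_all add: D_def)
  have w4_D: "w4 [u, v, x, y] = s4 (pfb (wd (\<psi> u) (\<psi> v)) (wd (\<psi> x) (\<psi> y))) D" for u v x y
    unfolding outer[of u v x y] inner[of "b 1" "b 2" x y] inner[of "b 1" "b 3" x y]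
      inner[of "b 1" "b 4" x y] inner[of "b 2" "b 3" x y] inner[of "b 2" "b 4" x y]
      inner[of "b 3" "b 4" x y]
    by (simp add: w4(9-14) perms D_def[symmetric] pfb_def F.scale_left_distrib
        F.scale_left_diff_distrib)
  have prod: "exterior_product 2 2 s2 s2 s4 w w w4 = (\<lambda>x y. s4 (pfb (\<Phi> x) (\<Phi> y)) D)"
    unfolding exterior_product_def
  proof (rule the_equality)
    show "(\<forall>x. Vector_Spaces.linear s2 s4 (\<lambda>y. s4 (pfb (\<Phi> x) (\<Phi> y)) D)) \<and>
      (\<forall>y. Vector_Spaces.linear s2 s4 (\<lambda>x. s4 (pfb (\<Phi> x) (\<Phi> y)) D)) \<and>
      (\<forall>us us'. length us = 2 \<and> length us' = 2 \<longrightarrow>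
        s4 (pfb (\<Phi> (w us)) (\<Phi> (w us'))) D = w4 (us @ us'))"
      using vs vs4 by (auto simp: vlinear_iff Phi_add Phi_scale pfb_add pfb_smat F.scale_left_distrib
          list_length_2 Phi_wedge w4_D)
    fix m assume m: "(\<forall>x. Vector_Spaces.linear s2 s4 (m x)) \<and>
      (\<forall>y. Vector_Spaces.linear s2 s4 (\<lambda>x. m x y)) \<and>
      (\<forall>us us'. length us = 2 \<and> length us' = 2 \<longrightarrow> m (w us) (w us') = w4 (us @ us'))"
    have z: "h 0 = 0" if "Vector_Spaces.linear s2 s4 h" for h
      using that unfolding vlinear_iff by (metis add_cancel_right_right)
    have m0: "m x 0 = 0" "m 0 x = 0" for x
      using z[of "m x"] z[of "\<lambda>y. m y x"] m by auto
    have one: "m (w us) y = s4 (pfb (\<Phi> (w us)) (\<Phi> y)) D" if "length us = 2" for us y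
    proof (rule exterior_power_eqI[OF ext, where r = s4 and f = "m (w us)"])
      fix vs :: "'v list" assume "length vs = 2"
      then show "m (w us) (w vs) = s4 (pfb (\<Phi> (w us)) (\<Phi> (w vs))) D"
        using m that by (auto simp: list_length_2 Phi_wedge w4_D)
    qed (use m in \<open>auto simp: m0 vlinear_iff Phi_add Phi_scale Phi_zero pfb_add pfb_smat
        F.scale_left_distrib pfb_def[of _ 0]\<close>)
    have "m x y = s4 (pfb (\<Phi> x) (\<Phi> y)) D" for x y
      by (rule exterior_power_eqI[OF ext, where r = s4 and f = "\<lambda>x. m x y"])
        (use m one in \<open>auto simp: m0 vlinear_iff Phi_add Phi_scale Phi_zero pfb_add pfb_smat
          F.scale_left_distrib pfb_def[of 0]\<close>)
    then show "m = (\<lambda>x y. s4 (pfb (\<Phi> x) (\<Phi> y)) D)" by auto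
  qed
  have "D \<noteq> 0"
  proof
    assume D: "D = 0"
    have len: "length vs = 4 \<longleftrightarrow> (\<exists>a b c d. vs = [a, b, c, d])" for vs :: "'v list"
      by (rule list_length_4)
    let ?f = "\<lambda>vs. pfb (wd (\<psi> (vs ! 0)) (\<psi> (vs ! 1))) (wd (\<psi> (vs ! 2)) (\<psi> (vs ! 3)))"
    have "alternating_map 4 sV (*) ?f"
      unfolding alternating_map_def
    proof (intro conjI allI impI)
      fix vs :: "'v list" and j :: nat assume a: "length vs = 4 \<and> j < 4"
      then obtain p q r s where l: "vs = [p, q, r, s]" by (auto simp: len)
      from a consider "j = 0" | "j = 1" | "j = 2" | "j = 3" by linarith
      then show "Vector_Spaces.linear sV (*) (\<lambda>x. ?f (vs[j := x]))"
        by cases (use vs(1) vector_space_complex in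
          \<open>auto simp: l vlinear_iff wd_def pfb_def psi_add psi_scale algebra_simps
             numeral_2_eq_2 numeral_3_eq_3\<close>)
    next
      fix vs :: "'v list" and i j assume a: "length vs = 4 \<and> i < j \<and> j < 4 \<and> vs ! i = vs ! j"
      then have "(i = 0 \<and> j = 1) \<or> (i = 0 \<and> j = 2) \<or> (i = 0 \<and> j = 3) \<or> (i = 1 \<and> j = 2)
        \<or> (i = 1 \<and> j = 3) \<or> (i = 2 \<and> j = 3)" by linarith
      then show "?f vs = 0"
        using a by (elim disjE) (auto simp: wd_def pfb_def algebra_simps)
    qed
    then obtain \<phi> where \<phi>: "Vector_Spaces.linear s4 (*) \<phi>" "\<And>vs. length vs = 4 \<Longrightarrow> \<phi> (w4 vs) = ?f vs"
      using ext4 unfolding is_exterior_power_def by blast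
    have "\<phi> D = 1"
      using \<phi>(2)[of "[b 1, b 2, b 3, b 4]"]
      by (simp add: D_def b_def psi_inv wd_def pfb_def axis_def numeral_2_eq_2 numeral_3_eq_3)
    moreover have "\<phi> 0 = 0" using \<phi>(1) unfolding vlinear_iff by (metis add_cancel_right_right)
    ultimately show False using D by simp
  qed
  have "D \<in> F.span {\<epsilon>}" using gen by simp
  then obtain \<kappa> where \<kappa>: "D = s4 \<kappa> \<epsilon>" using F.span_singleton by auto
  have nz: "\<kappa> \<noteq> 0" "\<epsilon> \<noteq> 0" using \<open>D \<noteq> 0\<close> \<kappa> by auto
  have "beta_wedge s2 s4 w w4 \<epsilon> x y = \<kappa> * pfb (\<Phi> x) (\<Phi> y)" for x y
    unfolding beta_wedge_def prod
    by (rule the_equality) (use nz in \<open>auto simp: \<kappa> mult.commute\<close>)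
  then show ?thesis using nz(1) by blast
qed

end

section \<open>A normal form for the simple roots\<close>

lemma GL_mult: "g \<otimes>\<^bsub>GL s\<^esub> h = g \<circ> h" and GL_one: "\<one>\<^bsub>GL s\<^esub> = id"
  by (simp_all add: GL_def)

lemma GL_carrier: "g \<in> carrier (GL s) \<longleftrightarrow> Vector_Spaces.linear s s g \<and> bij g"
  by (simp add: GL_def)

lemma GL_group:
  assumes "vector_space s"
  shows "group (GL s)"
proof (rule groupI)
  fix g h assume gh: "g \<in> carrier (GL s)" "h \<in> carrier (GL s)"
  then show "g \<otimes>\<^bsub>GL s\<^esub> h \<in> carrier (GL s)"
    by (auto simp: GL_carrier GL_mult vlinear_iff intro: bij_comp)
next
  show "\<one>\<^bsub>GL s\<^esub> \<in> carrier (GL s)" using assms by (simp add: GL_carrier GL_one vlinear_iff)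
next
  fix g h k
  show "g \<otimes>\<^bsub>GL s\<^esub> h \<otimes>\<^bsub>GL s\<^esub> k = g \<otimes>\<^bsub>GL s\<^esub> (h \<otimes>\<^bsub>GL s\<^esub> k)"
    by (simp add: GL_mult comp_assoc)
next
  fix g show "\<one>\<^bsub>GL s\<^esub> \<otimes>\<^bsub>GL s\<^esub> g = g" by (simp add: GL_mult GL_one)
next
  fix g assume g: "g \<in> carrier (GL s)"
  then have lin: "\<And>x y. g (x + y) = g x + g y" "\<And>c x. g (s c x) = s c (g x)" and bij: "bij g"
    by (auto simp: GL_carrier vlinear_iff)
  define h where "h = inv_into UNIV g"
  have h: "g (h x) = x" "h (g x) = x" for x
    using bij by (simp_all add: h_def bij_is_surj surj_f_inv_f bij_is_inj)
  have "h (x + y) = h x + h y" "h (s c x) = s c (h x)" for x y c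
    using h by (metis lin(1), metis lin(2))
  moreover have "bij h" by (rule bij_betw_byWitness[where f' = g]) (auto simp: h)
  ultimately show "\<exists>h\<in>carrier (GL s). h \<otimes>\<^bsub>GL s\<^esub> g = \<one>\<^bsub>GL s\<^esub>"
    using assms h by (intro bexI[of _ h]) (auto simp: GL_carrier vlinear_iff GL_mult GL_one)
qed

lemma one_to_six: "i \<in> {1..6} \<longleftrightarrow> i = 1 \<or> i = 2 \<or> i = 3 \<or> i = 4 \<or> i = 5 \<or> i = (6::nat)"
  by auto

lemma cartan_sym: "cartan_E6 i k = cartan_E6 k i"
  by (auto simp: cartan_E6_def)

lemma cartan_diag: "cartan_E6 i i = 2"
  by (simp add: cartan_E6_def)

definition simple_system ::
    "(complex \<Rightarrow> 'e::ab_group_add \<Rightarrow> 'e) \<Rightarrow> (nat \<Rightarrow> 'e) \<Rightarrow> (nat \<Rightarrow> 'e \<Rightarrow> 'e) \<Rightarrow> ('e \<Rightarrow> 'e) set \<Rightarrow> bool" where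
  "simple_system s \<alpha> \<sigma> H \<longleftrightarrow> module.span s (\<alpha> ` {1..6}) = UNIV \<and>
     (\<forall>i\<in>{1..6}. \<sigma> i \<in> carrier (GL s) \<and>
        (\<forall>k\<in>{1..6}. \<sigma> i (\<alpha> k) = \<alpha> k - s (cartan_E6 i k) (\<alpha> i))) \<and>
     H = generate (GL s) (\<sigma> ` {1..6})"

lemma linear_eq_on_spanning:
  assumes s: "vector_space s" and sp: "module.span s D = UNIV"
    and f: "\<And>x y. f (x + y) = f x + f y" "\<And>c x. f (s c x) = r c (f x)"
    and g: "\<And>x y. g (x + y) = g x + g y" "\<And>c x. g (s c x) = r c (g x)"
    and eq: "\<And>x. x \<in> D \<Longrightarrow> f x = g x" and zero: "f 0 = g 0"
  shows "f x = g x"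
proof -
  interpret vector_space s by fact
  have "x \<in> span D" using sp by simp
  then show ?thesis by (induction rule: span_induct_alt) (simp_all add: f g eq zero)
qed

lemma simple_reflection_involution:
  assumes s: "vector_space s" and S: "simple_system s \<alpha> \<sigma> H" and i: "i \<in> {1..6}"
  shows "\<sigma> i (\<sigma> i x) = x"
proof -
  interpret vector_space s by fact
  have \<sigma>: "\<sigma> i (x + y) = \<sigma> i x + \<sigma> i y" "\<sigma> i (s c x) = s c (\<sigma> i x)" for x y c
    using S i by (auto simp: simple_system_def GL_carrier vlinear_iff)
  have \<sigma>_diff: "\<sigma> i (x - y) = \<sigma> i x - \<sigma> i y" for x y using \<sigma>(1)[of "x - y" y] by simp
  have \<alpha>: "\<sigma> i (\<alpha> k) = \<alpha> k - s (cartan_E6 i k) (\<alpha> i)" if "k \<in> {1..6}" for k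
    using S i that by (simp add: simple_system_def)
  have \<alpha>i: "\<sigma> i (\<alpha> i) = - \<alpha> i"
    using \<alpha>[OF i] scale_left_distrib[of 1 1 "\<alpha> i"] by (simp add: cartan_diag)
  have "\<sigma> i (\<sigma> i x) = id x"
  proof (rule linear_eq_on_spanning[OF s, where f = "\<lambda>x. \<sigma> i (\<sigma> i x)" and D = "\<alpha> ` {1..6}" and r = s])
    show "\<sigma> i (\<sigma> i x) = id x" if "x \<in> \<alpha> ` {1..6}" for x
      using that by (auto simp: \<alpha> \<sigma>_diff \<sigma> \<alpha>i)
    show "\<sigma> i (\<sigma> i 0) = id 0" using \<sigma>(1)[of 0 0] by simp
  qed (use S in \<open>auto simp: simple_system_def \<sigma>\<close>)
  then show ?thesis by simp
qed

lemma simple_system_reflected: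
  assumes s: "vector_space s" and S: "simple_system s \<alpha> \<sigma> H" and j: "j \<in> {1..6}"
  shows "simple_system s (\<lambda>k. \<sigma> j (\<alpha> k)) (\<lambda>i. \<sigma> j \<circ> \<sigma> i \<circ> \<sigma> j) H"
proof -
  interpret vector_space s by fact
  interpret G: group "GL s" by (rule GL_group[OF s])
  have gl: "\<sigma> i \<in> carrier (GL s)" if "i \<in> {1..6}" for i using S that by (simp add: simple_system_def)
  have \<sigma>: "\<sigma> i (x + y) = \<sigma> i x + \<sigma> i y" "\<sigma> i (s c x) = s c (\<sigma> i x)" if "i \<in> {1..6}" for i x y c
    using gl[OF that] by (auto simp: GL_carrier vlinear_iff)
  have \<sigma>_diff: "\<sigma> j (x - y) = \<sigma> j x - \<sigma> j y" for x y using \<sigma>(1)[OF j, of "x - y" y] by simp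
  have \<alpha>: "\<sigma> i (\<alpha> k) = \<alpha> k - s (cartan_E6 i k) (\<alpha> i)" if "i \<in> {1..6}" "k \<in> {1..6}" for i k
    using S that by (simp add: simple_system_def)
  note inv = simple_reflection_involution[OF s S j]
  have gl': "\<sigma> j \<circ> \<sigma> i \<circ> \<sigma> j \<in> carrier (GL s)" if "i \<in> {1..6}" for i
    using G.m_closed[OF G.m_closed[OF gl[OF j] gl[OF that]] gl[OF j]] by (simp add: GL_mult)
  let ?\<sigma> = "\<lambda>i. \<sigma> j \<circ> \<sigma> i \<circ> \<sigma> j" and ?\<alpha> = "\<lambda>k. \<sigma> j (\<alpha> k)"
  have sub: "generate (GL s) (\<sigma> ` {1..6}) \<subseteq> carrier (GL s)" "generate (GL s) (?\<sigma> ` {1..6}) \<subseteq> carrier (GL s)"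
    using gl gl' by (auto intro!: G.generate_incl)
  have subgrp: "subgroup (generate (GL s) (\<sigma> ` {1..6})) (GL s)" "subgroup (generate (GL s) (?\<sigma> ` {1..6})) (GL s)"
    using gl gl' by (auto intro!: G.generate_is_subgroup)
  have mem: "\<sigma> i \<in> generate (GL s) (\<sigma> ` {1..6})" if "i \<in> {1..6}" for i
    using that by (intro generate.incl) auto
  have mem': "?\<sigma> i \<in> generate (GL s) (?\<sigma> ` {1..6})" if "i \<in> {1..6}" for i
    using that by (intro generate.incl) auto
  have "?\<sigma> j = \<sigma> j" by (auto simp: inv)
  then have j': "\<sigma> j \<in> generate (GL s) (?\<sigma> ` {1..6})" using mem'[OF j] by simp
  have "\<sigma> i \<in> generate (GL s) (?\<sigma> ` {1..6})" if "i \<in> {1..6}" for i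
  proof -
    have "\<sigma> i = \<sigma> j \<otimes>\<^bsub>GL s\<^esub> ?\<sigma> i \<otimes>\<^bsub>GL s\<^esub> \<sigma> j" by (auto simp: GL_mult inv)
    then show ?thesis using subgroup.m_closed[OF subgrp(2)] j' mem'[OF that] by metis
  qed
  then have "generate (GL s) (\<sigma> ` {1..6}) \<subseteq> generate (GL s) (?\<sigma> ` {1..6})"
    by (intro G.generate_subgroup_incl subgrp) auto
  moreover have "?\<sigma> i \<in> generate (GL s) (\<sigma> ` {1..6})" if "i \<in> {1..6}" for i
    using subgroup.m_closed[OF subgrp(1) subgroup.m_closed[OF subgrp(1) mem[OF j] mem[OF that]] mem[OF j]]
    by (simp add: GL_mult)
  then have "generate (GL s) (?\<sigma> ` {1..6}) \<subseteq> generate (GL s) (\<sigma> ` {1..6})"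
    by (intro G.generate_subgroup_incl subgrp) auto
  ultimately have gen: "H = generate (GL s) (?\<sigma> ` {1..6})" using S by (auto simp: simple_system_def)
  have act: "?\<sigma> i (?\<alpha> k) = ?\<alpha> k - s (cartan_E6 i k) (?\<alpha> i)" if "i \<in> {1..6}" "k \<in> {1..6}" for i k
    using that by (simp add: inv \<alpha> \<sigma>_diff \<sigma>[OF j])
  have "\<alpha> k \<in> span (?\<alpha> ` {1..6})" if "k \<in> {1..6}" for k
  proof -
    have "\<alpha> k = ?\<sigma> j (?\<alpha> k)" by (simp add: inv)
    also have "\<dots> = ?\<alpha> k - s (cartan_E6 j k) (?\<alpha> j)" by (rule act[OF j that])
    also have "\<dots> \<in> span (?\<alpha> ` {1..6})"
      using that j by (intro span_diff span_scale span_base) auto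
    finally show ?thesis .
  qed
  then have "span (\<alpha> ` {1..6}) \<subseteq> span (?\<alpha> ` {1..6})" by (intro span_minimal) auto
  then have "span (?\<alpha> ` {1..6}) = UNIV" using S by (auto simp: simple_system_def)
  then show ?thesis using gl' act gen by (simp add: simple_system_def)
qed

context wedge_coords
begin

text \<open>Invariance of the form under the \<open>i\<close>-th reflection gives $2 b_{ik} = C_{ik} b_{ii}$; as the diagram
  is connected, all $b_{ii}$ agree, and they do not vanish because the form is not zero.\<close>

lemma gram_of_simple_system:
  assumes S: "simple_system s2 \<alpha> \<sigma> H" and H: "H \<subseteq> orthogonal_group s2 \<beta>"
    and \<beta>: "\<kappa> \<noteq> 0" "\<And>x y. \<beta> x y = \<kappa> * pfb (\<Phi> x) (\<Phi> y)"
  shows "\<exists>c. c \<noteq> 0 \<and> (\<forall>i\<in>{1..6}. \<forall>k\<in>{1..6}. pfb (\<Phi> (\<alpha> i)) (\<Phi> (\<alpha> k)) = c * cartan_E6 i k)"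
proof -
  interpret E: vector_space s2 by (rule vs(2))
  define b where "b i k = pfb (\<Phi> (\<alpha> i)) (\<Phi> (\<alpha> k))" for i k
  have Phi_diff: "\<Phi> (x - y) = \<Phi> x - \<Phi> y" for x y using Phi_add[of "x - y" y] by simp
  have half: "2 * b i k = cartan_E6 i k * b i i" if "i \<in> {1..6}" "k \<in> {1..6}" for i k
  proof -
    have "\<sigma> i \<in> H" using S that unfolding simple_system_def by (auto intro: generate.incl)
    then have "\<sigma> i \<in> orthogonal_group s2 \<beta>" using H by blast
    then have "pfb (\<Phi> (\<sigma> i (\<alpha> i))) (\<Phi> (\<sigma> i (\<alpha> k))) = b i k"
      using \<beta> by (simp add: orthogonal_group_def b_def)
    moreover have "\<sigma> i (\<alpha> i) = \<alpha> i - s2 2 (\<alpha> i)" "\<sigma> i (\<alpha> k) = \<alpha> k - s2 (cartan_E6 i k) (\<alpha> i)"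
      using S that by (auto simp: simple_system_def cartan_diag)
    ultimately have "pfb (\<Phi> (\<alpha> i) - smat 2 (\<Phi> (\<alpha> i))) (\<Phi> (\<alpha> k) - smat (cartan_E6 i k) (\<Phi> (\<alpha> i))) = b i k"
      by (simp add: Phi_diff Phi_scale)
    then have "(b i k - cartan_E6 i k * b i i) - 2 * (b i k - cartan_E6 i k * b i i) = b i k"
      by (simp add: pfb_diff pfb_smat b_def)
    then show ?thesis by (simp add: algebra_simps)
  qed
  have sym: "b i k = b k i" for i k by (simp add: b_def pfb_sym)
  have edge: "b i i = b k k" if "i \<in> {1..6}" "k \<in> {1..6}" "cartan_E6 i k = -1" for i k
    using half[OF that(1,2)] half[OF that(2,1)] sym[of i k] that(3) cartan_sym[of i k] by simp
  have eq: "b i i = b 1 1" if "i \<in> {1..6}" for i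
  proof -
    have "b 1 1 = b 3 3" "b 3 3 = b 4 4" "b 4 4 = b 5 5" "b 5 5 = b 6 6" "b 2 2 = b 4 4"
      by (rule edge; simp add: cartan_E6_def E6_edges_def)+
    then show ?thesis using that unfolding one_to_six by (elim disjE) simp_all
  qed
  define c where "c = b 1 1 / 2"
  have bc: "b i k = c * cartan_E6 i k" if "i \<in> {1..6}" "k \<in> {1..6}" for i k
    using half[OF that] eq[OF that(1)] by (simp add: c_def mult.commute)
  have "c \<noteq> 0"
  proof
    assume "c = 0"
    have sp: "E.span (\<alpha> ` {1..6}) = UNIV" using S by (simp add: simple_system_def)
    have one: "pfb (\<Phi> (\<alpha> i)) (\<Phi> y) = 0" if "i \<in> {1..6}" for i y
      by (rule linear_eq_on_spanning[OF vs(2) sp, where f = "\<lambda>y. pfb (\<Phi> (\<alpha> i)) (\<Phi> y)" and g = "\<lambda>_. 0" and r = "(*)"])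
        (use bc[OF that] \<open>c = 0\<close> in \<open>auto simp: b_def Phi_add Phi_scale pfb_add pfb_smat Phi_zero pfb_def[of _ 0]\<close>)
    have "pfb (\<Phi> x) (\<Phi> y) = 0" for x y
      by (rule linear_eq_on_spanning[OF vs(2) sp, where f = "\<lambda>x. pfb (\<Phi> x) (\<Phi> y)" and g = "\<lambda>_. 0" and r = "(*)"])
        (use one in \<open>auto simp: Phi_add Phi_scale pfb_add pfb_smat Phi_zero pfb_def[of 0]\<close>)
    from this[of "Phi_inv (skew6 1 0 0 0 0 0)" "Phi_inv (skew6 0 0 0 0 0 1)"] show False
      by (simp add: Phi_inv skew_skew6 pfb_def)
  qed
  then show ?thesis using bc unfolding b_def by blast
qed

text \<open>The simple roots can be moved to any other realisation \<open>A\<close> of the same Gram matrix by a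
  similitude.  Its lift to the space provides new coordinates, after a reflection of the simple
  system if the similitude is improper.\<close>

lemma simple_system_normal_form:
  assumes weyl: "is_weyl_group_E6 s2 H" and H: "H \<subseteq> orthogonal_group s2 \<beta>"
    and \<beta>: "\<kappa> \<noteq> 0" "\<And>x y. \<beta> x y = \<kappa> * pfb (\<Phi> x) (\<Phi> y)"
    and A: "\<And>i. i \<in> {1..6} \<Longrightarrow> skew (A i)"
      "\<And>i k. i \<in> {1..6} \<Longrightarrow> k \<in> {1..6} \<Longrightarrow> pfb (A i) (A k) = cartan_E6 i k"
  shows "\<exists>\<psi>' \<Phi>' \<alpha> \<sigma> \<mu>. wedge_coords sV s2 w \<psi>' \<Phi>' \<and> simple_system s2 \<alpha> \<sigma> H \<and>
    \<mu> \<noteq> 0 \<and> (\<forall>k\<in>{1..6}. \<Phi>' (\<alpha> k) = smat \<mu> (A k))"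
proof -
  interpret E: vector_space s2 by (rule vs(2))
  interpret EE: vector_space_pair s2 s2 ..
  obtain \<alpha> \<sigma> where inj: "inj_on \<alpha> {1..6}" and indep: "E.independent (\<alpha> ` {1..6})"
    and S: "simple_system s2 \<alpha> \<sigma> H"
    using weyl unfolding is_weyl_group_E6_def simple_system_def by blast
  have sp: "E.span (\<alpha> ` {1..6}) = UNIV" using S by (simp add: simple_system_def)
  obtain c where c: "c \<noteq> 0" "\<And>i k. i \<in> {1..6} \<Longrightarrow> k \<in> {1..6} \<Longrightarrow>
      pfb (\<Phi> (\<alpha> i)) (\<Phi> (\<alpha> k)) = c * cartan_E6 i k"
    using gram_of_simple_system[OF S H \<beta>] by blast
  obtain \<tau> where \<tau>: "Vector_Spaces.linear s2 s2 \<tau>"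
    "\<And>x. x \<in> \<alpha> ` {1..6} \<Longrightarrow> \<tau> x = Phi_inv (A (inv_into {1..6} \<alpha> x))"
    using EE.linear_independent_extend[OF indep, of "\<lambda>x. Phi_inv (A (inv_into {1..6} \<alpha> x))"] by blast
  have \<tau>\<alpha>: "\<Phi> (\<tau> (\<alpha> k)) = A k" if "k \<in> {1..6}" for k
    using \<tau>(2)[of "\<alpha> k"] that inj A(1) by (simp add: Phi_inv)
  have \<tau>_lin: "\<tau> (x + y) = \<tau> x + \<tau> y" "\<tau> (s2 d x) = s2 d (\<tau> x)" for x y d
    using \<tau>(1) unfolding vlinear_iff by auto
  have \<tau>0: "\<tau> 0 = 0" using \<tau>_lin(1)[of 0 0] by simp
  have one: "pfb (A i) (\<Phi> (\<tau> y)) = (1 / c) * pfb (\<Phi> (\<alpha> i)) (\<Phi> y)" if "i \<in> {1..6}" for i y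
    by (rule linear_eq_on_spanning[OF vs(2) sp, where f = "\<lambda>y. pfb (A i) (\<Phi> (\<tau> y))" and r = "(*)"])
      (use c that A(2) in \<open>auto simp: \<tau>_lin \<tau>\<alpha> \<tau>0 Phi_add Phi_scale pfb_add pfb_smat Phi_zero
        pfb_def[of _ 0] add_divide_distrib\<close>)
  have sim: "pfb (\<Phi> (\<tau> x)) (\<Phi> (\<tau> y)) = (1 / c) * pfb (\<Phi> x) (\<Phi> y)" for x y
    by (rule linear_eq_on_spanning[OF vs(2) sp, where f = "\<lambda>x. pfb (\<Phi> (\<tau> x)) (\<Phi> (\<tau> y))" and r = "(*)"])
      (use one in \<open>auto simp: \<tau>_lin \<tau>\<alpha> \<tau>0 Phi_add Phi_scale pfb_add pfb_smat Phi_zero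
        pfb_def[of 0] add_divide_distrib\<close>)
  define B where "B = \<Phi> (\<alpha> 2)"
  have B: "skew B" "pfb B B = 2 * c" using c(2)[of 2 2] by (auto simp: B_def Phi_skew cartan_diag)
  have Phi_inv_lin: "Phi_inv (S + Y) = Phi_inv S + Phi_inv Y" "Phi_inv (smat d S) = s2 d (Phi_inv S)"
    if "skew S" "skew Y" for S Y d
  proof -
    have "\<Phi> (Phi_inv (S + Y)) = \<Phi> (Phi_inv S + Phi_inv Y)"
      using that by (simp add: Phi_add Phi_inv skew_add)
    then show "Phi_inv (S + Y) = Phi_inv S + Phi_inv Y" by (simp add: Phi_eq_iff)
    have "\<Phi> (Phi_inv (smat d S)) = \<Phi> (s2 d (Phi_inv S))"
      using that by (simp add: Phi_scale Phi_inv skew_smat)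
    then show "Phi_inv (smat d S) = s2 d (Phi_inv S)" by (simp add: Phi_eq_iff)
  qed
  have "\<exists>P \<mu>. invertible P \<and> \<mu> \<noteq> 0 \<and>
      ((\<forall>S. skew S \<longrightarrow> \<Phi> (\<tau> (Phi_inv S)) = smat \<mu> (act P S))
       \<or> (\<forall>S. skew S \<longrightarrow> \<Phi> (\<tau> (Phi_inv S)) = smat \<mu> (act P (refl B S))))"
  proof (rule similitude_lift[where c = "1 / c"])
    show "\<Phi> (\<tau> (Phi_inv (smat d S))) = smat d (\<Phi> (\<tau> (Phi_inv S)))" if "skew S" for d S
      using Phi_inv_lin(2)[OF that that] by (simp add: \<tau>_lin Phi_scale)
  qed (use B c(1) in \<open>auto simp: Phi_skew Phi_inv_lin \<tau>_lin Phi_add sim Phi_inv\<close>)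
  then obtain P \<mu> where P: "invertible P" "\<mu> \<noteq> 0" and
    alt: "(\<forall>S. skew S \<longrightarrow> \<Phi> (\<tau> (Phi_inv S)) = smat \<mu> (act P S))
       \<or> (\<forall>S. skew S \<longrightarrow> \<Phi> (\<tau> (Phi_inv S)) = smat \<mu> (act P (refl B S)))" by blast
  have coords: "wedge_coords sV s2 w (\<lambda>v. P *v \<psi> v) (\<lambda>x. act P (\<Phi> x))"
    by (rule change_coords[OF P(1)])
  from alt show ?thesis
  proof
    assume *: "\<forall>S. skew S \<longrightarrow> \<Phi> (\<tau> (Phi_inv S)) = smat \<mu> (act P S)"
    have "act P (\<Phi> (\<alpha> k)) = smat (1 / \<mu>) (A k)" if "k \<in> {1..6}" for k
      using *[rule_format, OF Phi_skew, of "\<alpha> k"] \<tau>\<alpha>[OF that] P(2) by (simp add: Phi_inv)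
    then show ?thesis using coords S P(2) 
      by (intro exI[of _ "\<lambda>v. P *v \<psi> v"] exI[of _ "\<lambda>x. act P (\<Phi> x)"]
          exI[of _ \<alpha>] exI[of _ \<sigma>] exI[of _ "1 / \<mu>"]) simp
  next
    assume *: "\<forall>S. skew S \<longrightarrow> \<Phi> (\<tau> (Phi_inv S)) = smat \<mu> (act P (refl B S))"
    have "act P (\<Phi> (\<sigma> 2 (\<alpha> k))) = smat (1 / \<mu>) (A k)" if "k \<in> {1..6}" for k
    proof -
      have "\<Phi> (x - y) = \<Phi> x - \<Phi> y" for x y using Phi_add[of "x - y" y] by simp
      moreover have "\<sigma> 2 (\<alpha> k) = \<alpha> k - s2 (cartan_E6 2 k) (\<alpha> 2)"
        using S that by (auto simp: simple_system_def)
      moreover have "2 * pfb (\<Phi> (\<alpha> k)) B / pfb B B = cartan_E6 2 k"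
        unfolding B(2) using c that cartan_sym[of k 2] by (simp add: B_def)
      ultimately have "refl B (\<Phi> (\<alpha> k)) = \<Phi> (\<sigma> 2 (\<alpha> k))"
        by (simp add: refl_def Phi_scale B_def)
      then show ?thesis
        using *[rule_format, OF Phi_skew, of "\<alpha> k"] \<tau>\<alpha>[OF that] P(2) by (simp add: Phi_inv)
    qed
    moreover have "simple_system s2 (\<lambda>k. \<sigma> 2 (\<alpha> k)) (\<lambda>i. \<sigma> 2 \<circ> \<sigma> i \<circ> \<sigma> 2) H"
      by (rule simple_system_reflected[OF vs(2) S]) simp
    ultimately show ?thesis using coords P(2)
      by (intro exI[of _ "\<lambda>v. P *v \<psi> v"] exI[of _ "\<lambda>x. act P (\<Phi> x)"]
          exI[of _ "\<lambda>k. \<sigma> 2 (\<alpha> k)"] exI[of _ "\<lambda>i. \<sigma> 2 \<circ> \<sigma> i \<circ> \<sigma> 2"] exI[of _ "1 / \<mu>"]) simp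
  qed
qed

end

section \<open>The group generated by four reflections of order three\<close>

definition idx :: "4 \<Rightarrow> nat" where
  "idx i = (if i = 1 then 0 else if i = 2 then 1 else if i = 3 then 2 else 3)"

lemma idx_simps [simp]: "idx 1 = 0" "idx 2 = 1" "idx 3 = 2" "idx 4 = 3"
  by (simp_all add: idx_def)

lemma bij_idx: "bij_betw idx UNIV {..<4}"
  unfolding bij_betw_def inj_on_def UNIV_4
  by (auto simp: numeral_eq_Suc lessThan_Suc)

definition wf_mat :: "eis list list \<Rightarrow> bool" where
  "wf_mat A \<longleftrightarrow> length A = 4 \<and> (\<forall>i<4. length (A ! i) = 4)"

lemma list4_cases:
  assumes "length xs = 4"
  obtains a b c d where "xs = [a, b, c, d]"
  using assms by (auto simp: list_length_4)

lemma wf_mmul: "wf_mat (mmul A B)"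
  by (simp add: wf_mat_def mmul_def)

lemma all_less_4: "(\<forall>i<4. P i) \<longleftrightarrow> P 0 \<and> P 1 \<and> P 2 \<and> P (3::nat)"
  by (auto simp: eval_nat_numeral less_Suc_eq)

locale cube_root =
  fixes w :: complex
  assumes w: "w\<^sup>2 + w + 1 = 0"
begin

lemma w_sq: "w * w = - 1 - w"
  using w by (simp add: power2_eq_square algebra_simps eq_neg_iff_add_eq_0)

lemma ev_simps [simp]: "ev w (0, 0) = 0" "ev w (1, 0) = 1" "ev w (0, 1) = w" "ev w (-1, -1) = w * w" "ev w (-1, 0) = - 1"
  by (simp_all add: ev_def w_sq)

lemma ev_eadd: "ev w (eadd x y) = ev w x + ev w y"
  by (cases x; cases y) (simp add: ev_def algebra_simps)

lemma ev_emul: "ev w (emul x y) = ev w x * ev w y"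
proof (cases x; cases y)
  fix a b c d assume x: "x = (a, b)" and y: "y = (c, d)"
  have "ev w x * ev w y = of_int (a * c) + of_int (a * d + b * c) * w + of_int (b * d) * (w * w)"
    by (simp add: x y ev_def algebra_simps)
  then show ?thesis unfolding w_sq by (simp add: x y ev_def Let_def algebra_simps)
qed

lemma ev_neg: "ev w (emul (-1, 0) x) = - ev w x"
  by (simp add: ev_emul)

lemma ev_epow: "ev w (epow x n) = ev w x ^ n"
  by (induction n) (simp_all add: ev_emul)

definition theta :: complex where "theta = ev w e_theta"

lemma theta_sq: "theta * theta = -3"
proof -
  have "theta * theta = 1 + 4 * w + 4 * (w * w)" by (simp add: theta_def e_theta_def ev_def algebra_simps)
  then show ?thesis by (simp add: w_sq)
qed

lemma theta_nz: "theta \<noteq> 0"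
  using theta_sq by auto

lemma w_nz: "w \<noteq> 0" and w_ne_1: "w \<noteq> 1" and w_cube: "w ^ 3 = 1"
proof -
  show "w \<noteq> 0" using w by auto
  show "w \<noteq> 1" using w by auto
  have "w ^ 3 = w * (w * w)" by (simp add: power3_eq_cube)
  then show "w ^ 3 = 1" unfolding w_sq by (simp add: algebra_simps w_sq)
qed

text \<open>An Eisenstein integer vanishes only if both coordinates do, since \<open>w\<close> is not real.\<close>

lemma ev_eq_0: "ev w x = 0 \<longleftrightarrow> x = (0, 0)"
proof
  assume z: "ev w x = 0"
  obtain a b where x: "x = (a, b)" by (cases x)
  have "ev w x * ev w (econj x) = of_int (a * a - a * b) - of_int (b * b) * (w + w * w)"
    by (simp add: x ev_def algebra_simps)
  then have "complex_of_int (a * a - a * b + b * b) = ev w x * ev w (econj x)"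
    by (simp add: w_sq)
  then have "complex_of_int (a * a - a * b + b * b) = 0" using z by simp
  then have "a * a - a * b + b * b = 0" by (simp only: of_int_eq_0_iff)
  then have "(2 * a - b)\<^sup>2 + 3 * b\<^sup>2 = 0" by (simp add: power2_eq_square algebra_simps)
  moreover have "(2 * a - b)\<^sup>2 \<ge> 0" "b\<^sup>2 \<ge> 0" by simp_all
  ultimately have "(2 * a - b)\<^sup>2 = 0" "b\<^sup>2 = 0" by linarith+
  then show "x = (0, 0)" by (simp add: x)
qed simp

definition vec4 :: "eis list \<Rightarrow> complex ^ 4" where
  "vec4 x = (\<chi> i. ev w (x ! idx i))"

definition mat4 :: "eis list list \<Rightarrow> complex ^ 4 ^ 4" where
  "mat4 A = (\<chi> i k. ev w (A ! idx i ! idx k))"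

lemma ev_edot:
  assumes "length x = 4" "length y = 4"
  shows "ev w (edot x y) = (\<Sum>i\<in>UNIV. vec4 x $ i * vec4 y $ i)"
proof -
  obtain a b c d where x: "x = [a, b, c, d]" using assms(1) by (rule list4_cases)
  obtain a' b' c' d' where y: "y = [a', b', c', d']" using assms(2) by (rule list4_cases)
  show ?thesis by (simp add: x y sum_4 vec4_def ev_eadd ev_emul numeral_2_eq_2 numeral_3_eq_3)
qed

lemma vec4_vscale: "length x = 4 \<Longrightarrow> vec4 (vscale u x) = ev w u *s vec4 x"
  by (elim list4_cases)
    (simp add: vec_eq_iff forall_4 vec4_def vscale_def ev_emul numeral_2_eq_2 numeral_3_eq_3)

lemma vec4_vadd: "length x = 4 \<Longrightarrow> length y = 4 \<Longrightarrow> vec4 (vadd x y) = vec4 x + vec4 y"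
  by (elim list4_cases)
    (simp add: vec_eq_iff forall_4 vec4_def ev_eadd numeral_2_eq_2 numeral_3_eq_3)

lemma mat4_mmul:
  assumes "wf_mat A" "wf_mat B"
  shows "mat4 (mmul A B) = mat4 A ** mat4 B"
proof -
  have "ev w (mmul A B ! i ! k) = (\<Sum>j\<in>UNIV. ev w (A ! i ! idx j) * ev w (B ! idx j ! k))"
    if "i < 4" "k < 4" for i k
  proof -
    have "length (A ! i) = 4" "length (map (\<lambda>r. r ! k) B) = 4"
      using assms that by (auto simp: wf_mat_def)
    moreover have "idx j < length B" for j
      using assms(2) bij_idx by (auto simp: wf_mat_def bij_betw_def)
    ultimately show ?thesis using that by (simp add: mmul_def ev_edot vec4_def)
  qed
  moreover have "idx i < 4" for i using bij_idx by (auto simp: bij_betw_def)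
  ultimately show ?thesis by (simp add: vec_eq_iff mat4_def matrix_matrix_mult_def)
qed

lemma mat4_mscale:
  assumes "wf_mat A"
  shows "mat4 (mscale u A) = smat (ev w u) (mat4 A)"
proof -
  have "idx i < 4" for i using bij_idx by (auto simp: bij_betw_def)
  then show ?thesis
    using assms by (simp add: vec_eq_iff mat4_def mscale_def vscale_def wf_mat_def ev_emul)
qed

lemma mat4_eid: "mat4 eid = mat 1"
  unfolding vec_eq_iff forall_4 by (simp add: mat4_def eid_def mat_def numeral_2_eq_2 numeral_3_eq_3)

lemma wf_eid: "wf_mat eid"
  by (simp add: wf_mat_def eid_def)

lemma wf_mprod: "wf_mat A \<Longrightarrow> wf_mat (mprod A Bs)"
  by (induction Bs arbitrary: A) (simp_all add: wf_mmul)

lemma mat4_mprod: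
  "wf_mat A \<Longrightarrow> \<forall>B\<in>set Bs. wf_mat B \<Longrightarrow> mat4 (mprod A Bs) = foldl (**) (mat4 A) (map mat4 Bs)"
  by (induction Bs arbitrary: A) (simp_all add: wf_mmul mat4_mmul)

definition eform :: "eis list \<Rightarrow> complex ^ 4 \<Rightarrow> complex" where
  "eform b v = (\<Sum>i\<in>UNIV. vec4 b $ i * v $ i)"

definition cvec :: "eis list \<Rightarrow> complex ^ 4" where
  "cvec b = vec4 (map econj b)"

text \<open>The reflection of order three whose fixed hyperplane is the kernel of the form \<open>b\<close> and whose
  root is the conjugate vector.\<close>

definition rmat :: "eis list \<Rightarrow> complex ^ 4 ^ 4" where
  "rmat b = (\<chi> i k. (if i = k then 1 else 0) + w\<^sup>2 / theta * cvec b $ i * vec4 b $ k)"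

lemma wf_erefl: "wf_mat (erefl b)"
  by (simp add: wf_mat_def erefl_def)

lemma mat4_erefl:
  assumes "length b = 4"
  shows "mat4 (erefl b) = smat theta (rmat b)"
proof -
  have "mat4 (erefl b) $ i $ k = smat theta (rmat b) $ i $ k" for i k
  proof -
    have ik: "idx i < 4" "idx k < 4" using bij_idx by (auto simp: bij_betw_def)
    have "idx i = idx k \<longleftrightarrow> i = k" using bij_idx by (auto simp: bij_betw_def inj_eq)
    then show ?thesis using ik assms theta_nz
      by (simp add: mat4_def erefl_def rmat_def ev_eadd ev_emul cvec_def vec4_def theta_def[symmetric]
        power2_eq_square algebra_simps)
  qed
  then show ?thesis by (simp add: vec_eq_iff)
qed

lemma rmat_mult: "rmat b *v v = v + (w\<^sup>2 / theta * eform b v) *s cvec b"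
proof -
  have "(rmat b *v v) $ i = (v + (w\<^sup>2 / theta * eform b v) *s cvec b) $ i" for i
    by (simp add: rmat_def matrix_vector_mult_def eform_def algebra_simps sum.distrib
        sum_distrib_left if_distrib[of "\<lambda>x. _ * x"] cong: if_cong)
  then show ?thesis by (simp add: vec_eq_iff)
qed

lemma witting_length: "b \<in> set witting \<Longrightarrow> length b = 4"
  by (auto simp: witting_def)

lemma witting_card: "length witting = 40"
  by (simp add: witting_def cube_units_def)

definition gen_forms :: "eis list list" where
  "gen_forms = map ((!) witting) gens"

lemma gen_forms_witting: "b \<in> set gen_forms \<Longrightarrow> b \<in> set witting"
  using witting_card by (auto simp: gen_forms_def gens_def)

text \<open>Products of generators suffice, as the generators have finite order.\<close>

inductive_set G32 :: "(complex ^ 4 ^ 4) set" where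
  one: "mat 1 \<in> G32"
| step: "M \<in> G32 \<Longrightarrow> b \<in> set gen_forms \<Longrightarrow> rmat b ** M \<in> G32"

lemma G32_mult: "M \<in> G32 \<Longrightarrow> N \<in> G32 \<Longrightarrow> M ** N \<in> G32"
  by (induction rule: G32.induct) (auto simp: matrix_mul_assoc[symmetric] intro: G32.step)

lemma G32_gen: "b \<in> set gen_forms \<Longrightarrow> rmat b \<in> G32"
  using G32.step[OF G32.one] by simp

lemma G32_foldl: "M \<in> G32 \<Longrightarrow> \<forall>N\<in>set Ns. N \<in> G32 \<Longrightarrow> foldl (**) M Ns \<in> G32"
  by (induction Ns arbitrary: M) (auto intro: G32_mult)

lemma foldl_smat:
  "foldl (**) (smat c M) (map (smat d) Ns) = smat (c * d ^ length Ns) (foldl (**) M Ns)"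
  by (induction Ns arbitrary: c M) (simp_all add: smat_mult mult_ac)

lemma mat4_erefl_word:
  assumes "set ks \<subseteq> {1..4}"
  shows "\<exists>P\<in>G32. mat4 (erefl_word ks) = smat (theta ^ length ks) P"
proof -
  define bs where "bs = map (\<lambda>k. witting ! (gens ! (k - 1))) ks"
  have "witting ! (gens ! (k - 1)) \<in> set gen_forms" if "k \<in> {1..4}" for k
  proof -
    have "k - 1 < length gens" using that by (auto simp: gens_def)
    then show ?thesis by (simp add: gen_forms_def)
  qed
  then have gen: "b \<in> set gen_forms" if "b \<in> set bs" for b using that assms by (auto simp: bs_def)
  have maps: "map mat4 (map erefl bs) = map (smat theta) (map rmat bs)"
    using gen gen_forms_witting witting_length by (auto simp: mat4_erefl)
  have "erefl_word ks = mprod eid (map erefl bs)" by (simp add: erefl_word_def bs_def comp_def)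
  then have "mat4 (erefl_word ks) = foldl (**) (mat4 eid) (map mat4 (map erefl bs))"
    using mat4_mprod[OF wf_eid, of "map erefl bs"] by (simp add: wf_erefl)
  also have "\<dots> = foldl (**) (smat 1 (mat 1)) (map (smat theta) (map rmat bs))"
    unfolding maps by (simp add: mat4_eid)
  also have "\<dots> = smat (theta ^ length ks) (foldl (**) (mat 1) (map rmat bs))"
    unfolding foldl_smat by (simp add: bs_def)
  finally have "mat4 (erefl_word ks) = smat (theta ^ length ks) (foldl (**) (mat 1) (map rmat bs))" .
  moreover have "foldl (**) (mat 1) (map rmat bs) \<in> G32"
    by (rule G32_foldl[OF G32.one]) (use gen G32_gen in auto)
  ultimately show ?thesis by blast
qed

lemma central_element: "mat (- (w * w)) \<in> G32"
proof -
  have "set (concat (replicate 5 [1, 2, 3, 4])) \<subseteq> {1..4 :: nat}" by (simp add: numeral_eq_Suc)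
  from mat4_erefl_word[OF this] obtain P where P: "P \<in> G32"
    "mat4 (erefl_word (concat (replicate 5 [1, 2, 3, 4]))) = smat (theta ^ 20) P"
    by (auto simp: numeral_eq_Suc)
  have "smat (theta ^ 20) P = smat (theta ^ 20 * ev w (1, 1)) (mat 1)"
    using P(2) unfolding center_word_correct
    by (simp add: mat4_mscale wf_eid mat4_eid ev_emul ev_epow theta_def)
  then have "P = smat (ev w (1, 1)) (mat 1)"
    using smat_cancel[of "theta ^ 20" P "theta ^ 20 * ev w (1, 1)" "mat 1"] theta_nz by simp
  also have "\<dots> = mat (- (w * w))" by (simp add: smat_mat ev_def w_sq add.commute)
  finally show ?thesis using P(1) by simp
qed

lemma mat_in_G32: "mat (w * w) \<in> G32" "mat w \<in> G32" "mat (-1) \<in> G32" "mat (- w) \<in> G32"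
proof -
  have w3: "w * (w * w) = 1" using w_cube by (simp only: power3_eq_cube mult.assoc)
  then have w4: "w * w * (w * w) = w" by (simp only: mult.assoc mult_1_right)
  show m: "mat w \<in> G32" using G32_mult[OF central_element central_element] by (simp add: mat_mult w4)
  show "mat (w * w) \<in> G32" using G32_mult[OF m m] by (simp add: mat_mult)
  show n: "mat (-1) \<in> G32" using G32_mult[OF m central_element] by (simp add: mat_mult w3)
  show "mat (- w) \<in> G32" using G32_mult[OF m n] by (simp add: mat_mult)
qed

definition root :: "nat \<Rightarrow> complex ^ 4 ^ 4" where
  "root i = smat (1 / theta) (mat4 (eskew (eroots ! (i - 1))))"

lemma mat4_eskew:
  "mat4 (eskew x) = skew6 (ev w (x ! 0)) (ev w (x ! 1)) (ev w (x ! 2)) (ev w (x ! 3)) (ev w (x ! 4)) (ev w (x ! 5))"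
  unfolding vec_eq_iff forall_4
  by (simp add: mat4_def eskew_def Let_def ev_neg numeral_2_eq_2 numeral_3_eq_3)

lemma mat4_estar: "mat4 (eskew (estar x)) = dual (mat4 (eskew x))"
  by (simp add: mat4_eskew estar_def dual_def ev_neg numeral_eq_Suc)

lemma root_skew: "skew (root i)"
  by (simp add: root_def mat4_eskew skew_skew6 skew_smat)

end

definition epfb :: "eis list \<Rightarrow> eis list \<Rightarrow> eis" where
  "epfb x y = edot [x ! 0, x ! 5, emul (-1, 0) (x ! 1), emul (-1, 0) (x ! 4), x ! 2, x ! 3]
    [y ! 5, y ! 0, y ! 4, y ! 1, y ! 3, y ! 2]"

definition cartan_int :: "nat \<Rightarrow> nat \<Rightarrow> int" where
  "cartan_int i k = (if i = k then 2 else if (i, k) \<in> E6_edges \<or> (k, i) \<in> E6_edges then - 1 else 0)"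

definition edge_list :: "(nat \<times> nat) list" where
  "edge_list = [(1,3), (2,4), (5,6), (3,4), (4,5)]"

lemma gen_words_shape:
  "list_all (\<lambda>es. length es = 12 \<and> list_all (\<lambda>(i, k). (i, k) \<in> set edge_list \<or> (k, i) \<in> set edge_list) es)
    gen_words"
  by code_simp

lemma root_gram_check:
  "list_all (\<lambda>i. list_all (\<lambda>k. epfb (eroots ! (i - 1)) (eroots ! (k - 1))
     = (-3 * cartan_int i k, 0)) [1..<7]) [1..<7]"
  by code_simp

context cube_root
begin

lemma pfb_mat4: "pfb (mat4 (eskew x)) (mat4 (eskew y)) = ev w (epfb x y)"
  by (simp add: mat4_eskew pfb_def epfb_def ev_eadd ev_emul ev_neg)

lemma root_gram:
  assumes "i \<in> {1..6}" "k \<in> {1..6}"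
  shows "pfb (root i) (root k) = cartan_E6 i k"
proof -
  have "i \<in> set [1..<7]" "k \<in> set [1..<7]" using assms by auto
  then have "epfb (eroots ! (i - 1)) (eroots ! (k - 1)) = (-3 * cartan_int i k, 0)"
    using root_gram_check unfolding list_all_iff by blast
  then have "pfb (root i) (root k) = 1 / (theta * theta) * (-3 * of_int (cartan_int i k))"
    by (simp add: root_def pfb_smat pfb_mat4 ev_def)
  then show ?thesis by (simp add: theta_sq cartan_int_def cartan_E6_def)
qed

text \<open>The lift of a product of two simple reflections, by \<open>act_mult_dual\<close>.\<close>

definition spin :: "nat \<times> nat \<Rightarrow> complex ^ 4 ^ 4" where
  "spin = (\<lambda>(i, k). root i ** dual (root k))"

lemma wf_eskew: "wf_mat (eskew x)"
  by (simp add: wf_mat_def eskew_def Let_def all_less_4 numeral_2_eq_2 numeral_3_eq_3)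

lemma mat4_eroot_prod: "mat4 (eroot_prod e) = smat (theta ^ 2) (spin e)"
  using theta_nz by (cases e) (simp add: eroot_prod_def mat4_mmul wf_eskew mat4_estar spin_def root_def
      dual_smat smat_mult power2_eq_square)

lemma wf_eroot_prod: "wf_mat (eroot_prod e)"
  by (cases e) (simp add: eroot_prod_def wf_mmul)

lemma six_units_in_G32: "u \<in> {1, w, w * w, - 1, - w, - (w * w)} \<Longrightarrow> mat u \<in> G32"
  using mat_in_G32 central_element G32.one by auto

lemma spin_in_G32:
  assumes "e \<in> set edge_list"
  shows "spin e \<in> G32"
proof -
  have "\<exists>u ks. (e, u, ks) \<in> set edge_words \<and> ev w u \<in> {1, w, w * w, - 1, - w, - (w * w)}
    \<and> set ks \<subseteq> {1..4} \<and> length ks \<ge> 2"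
    using assms by (auto simp: edge_words_def edge_list_def ev_def w_sq)
  then obtain u ks where e: "(e, u, ks) \<in> set edge_words"
    and u: "ev w u \<in> {1, w, w * w, - 1, - w, - (w * w)}" and ks: "set ks \<subseteq> {1..4}" "length ks \<ge> 2"
    by blast
  obtain P where P: "P \<in> G32" "mat4 (erefl_word ks) = smat (theta ^ length ks) P"
    using mat4_erefl_word[OF ks(1)] by blast
  have wf: "wf_mat (erefl_word ks)" by (simp add: erefl_word_def wf_mprod wf_eid)
  have len: "theta ^ 2 * theta ^ (length ks - 2) = theta ^ length ks"
    using ks(2) by (metis le_add_diff_inverse power_add)
  have "mscale (epow e_theta (length ks - 2)) (eroot_prod e) = mscale u (erefl_word ks)"
    using edge_words_correct e unfolding list_all_iff by auto
  then have "mat4 (mscale (epow e_theta (length ks - 2)) (eroot_prod e)) = mat4 (mscale u (erefl_word ks))"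
    by simp
  then have "smat (theta ^ length ks) (spin e) = smat (theta ^ length ks * ev w u) P"
    by (simp add: mat4_mscale wf wf_eroot_prod ev_epow theta_def[symmetric] mat4_eroot_prod P(2) len mult.commute)
  then have "spin e = smat (ev w u) P"
    using smat_cancel[of "theta ^ length ks" "spin e"] theta_nz by simp
  then show ?thesis using G32_mult[OF six_units_in_G32[OF u] P(1)] by (simp add: smat_eq_mat)
qed

lemma rmat_eq_spin_product:
  assumes "b \<in> set gen_forms"
  shows "\<exists>es. (\<forall>(i, k)\<in>set es. (i, k) \<in> set edge_list \<or> (k, i) \<in> set edge_list) \<and> rmat b = smat w (foldl (**) (mat 1) (map spin es))"
proof -
  obtain g es where g: "(g, es) \<in> set (zip gens gen_words)" "b = witting ! g"
    using assms by (auto simp: gen_forms_def gens_def gen_words_def)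
  have "es \<in> set gen_words" using g(1) by (rule set_zip_rightD)
  then have es: "length es = 12" "\<forall>(i, k)\<in>set es. (i, k) \<in> set edge_list \<or> (k, i) \<in> set edge_list"
    using gen_words_shape unfolding list_all_iff by auto
  have "b \<in> set witting" using assms by (rule gen_forms_witting)
  then have b: "length b = 4" by (rule witting_length)
  have "mscale (epow e_theta 23) (erefl b) = mscale (0, 1) (eroot_word es)"
    using gen_words_correct g unfolding list_all_iff by auto
  moreover have "wf_mat (eroot_word es)" by (simp add: eroot_word_def wf_mprod wf_eid)
  ultimately have eq: "smat (theta ^ 23) (smat theta (rmat b)) = smat w (mat4 (eroot_word es))"
    using b by (metis ev_epow ev_simps(3) mat4_erefl mat4_mscale theta_def wf_erefl)
  have "mat4 (eroot_word es) = foldl (**) (mat4 eid) (map mat4 (map eroot_prod es))"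
    unfolding eroot_word_def by (rule mat4_mprod) (auto simp: wf_eid wf_eroot_prod)
  also have "\<dots> = foldl (**) (smat 1 (mat 1)) (map (smat (theta ^ 2)) (map spin es))"
    by (simp add: mat4_eid mat4_eroot_prod comp_def)
  also have "\<dots> = smat (theta ^ 24) (foldl (**) (mat 1) (map spin es))"
    unfolding foldl_smat by (simp add: es(1) flip: power_mult)
  finally have "mat4 (eroot_word es) = smat (theta ^ 24) (foldl (**) (mat 1) (map spin es))" .
  note word = this
  have t: "theta ^ 23 * theta = theta ^ 24" by (simp flip: power_Suc2)
  have "smat (theta ^ 24) (rmat b) = smat (theta ^ 23) (smat theta (rmat b))"
    unfolding smat_smat t ..
  also have "\<dots> = smat w (smat (theta ^ 24) (foldl (**) (mat 1) (map spin es)))"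
    unfolding eq word ..
  also have "\<dots> = smat (w * theta ^ 24) (foldl (**) (mat 1) (map spin es))" by (rule smat_smat)
  finally have "smat (theta ^ 24) (rmat b) = smat (theta ^ 24 * w) (foldl (**) (mat 1) (map spin es))"
    by (simp only: mult.commute)
  then have "rmat b = smat w (foldl (**) (mat 1) (map spin es))"
    using smat_cancel[of "theta ^ 24" "rmat b"] theta_nz by simp
  then show ?thesis using es(2) by blast
qed

end

section \<open>The invariants of the group\<close>

lemma witting_norms: "list_all (\<lambda>b. edot b (map econj b) = (3, 0)) witting"
  by code_simp

lemma witting_distinct: "distinct witting"
  by code_simp

lemma chain_bounds: "list_all (\<lambda>(c, b, g). c < 40 \<and> b < 40) chain"
  by code_simp

context cube_root
begin

lemma eform_linear: "Vector_Spaces.linear (*s) (*) (eform b)"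
  unfolding eform_def[abs_def] by (rule linear_form_sum)

lemma eform_add: "eform b (u + v) = eform b u + eform b v"
  and eform_scale: "eform b (c *s v) = c * eform b v"
  and eform_diff: "eform b (u - v) = eform b u - eform b v"
proof -
  interpret l: Vector_Spaces.linear "(*s)" "(*)" "eform b" by (rule eform_linear)
  show "eform b (u + v) = eform b u + eform b v" by (rule l.add)
  show "eform b (c *s v) = c * eform b v" by (rule l.scale)
  show "eform b (u - v) = eform b u - eform b v" by (rule l.diff)
qed

lemma eform_cvec:
  assumes "length b = 4" "length a = 4"
  shows "eform b (cvec a) = ev w (edot b (map econj a))"
  using ev_edot[of b "map econj a"] assms by (simp add: eform_def cvec_def)

lemma eform_cvec_self: "b \<in> set witting \<Longrightarrow> eform b (cvec b) = 3"
  using witting_norms by (auto simp: list_all_iff eform_cvec witting_length ev_def)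

text \<open>With this coefficient the root of the reflection, on which the form takes the value 3, is an
  eigenvector with eigenvalue \<open>w\<close>.\<close>

lemma kappa: "1 + w\<^sup>2 / theta * 3 = w"
proof -
  have "w\<^sup>2 / theta * 3 = - (w * w * theta)"
    using theta_sq theta_nz by (simp add: field_simps power2_eq_square)
  also have "w * w * theta = w * w + 2 * (w * (w * w))"
    by (simp add: theta_def e_theta_def ev_def algebra_simps)
  also have "w * (w * w) = 1" using w_cube by (simp only: power3_eq_cube mult.assoc)
  finally show ?thesis by (simp add: w_sq)
qed

lemma eform_rmat_self:
  assumes "b \<in> set witting"
  shows "eform b (rmat b *v v) = w * eform b v"
proof -
  have "eform b (rmat b *v v) = (1 + w\<^sup>2 / theta * 3) * eform b v"
    by (simp add: rmat_mult eform_add eform_scale eform_cvec_self[OF assms] algebra_simps)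
  then show ?thesis by (simp only: kappa)
qed

lemma rmat_fixed: "eform b v = 0 \<Longrightarrow> rmat b *v v = v"
  by (simp add: rmat_mult)

lemma rmat_cube:
  assumes "b \<in> set witting"
  shows "rmat b ** rmat b ** rmat b = mat 1"
proof -
  have "(rmat b ** rmat b ** rmat b) *v v = mat 1 *v v" for v
  proof -
    let ?k = "w\<^sup>2 / theta"
    note two = rmat_mult[of b "rmat b *v v", unfolded eform_rmat_self[OF assms]]
    note three = rmat_mult[of b "rmat b *v (rmat b *v v)", unfolded eform_rmat_self[OF assms]]
    have "(rmat b ** rmat b ** rmat b) *v v = rmat b *v (rmat b *v (rmat b *v v))"
      by (simp add: matrix_vector_mul_assoc matrix_mul_assoc)
    also have "\<dots> = v + (?k * eform b v) *s cvec b + (?k * (w * eform b v)) *s cvec b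
        + (?k * (w * (w * eform b v))) *s cvec b"
      unfolding three unfolding two unfolding rmat_mult[of b v] ..
    also have "\<dots> = v + (?k * eform b v * (1 + w + w * w)) *s cvec b"
      by (simp add: vec_eq_iff algebra_simps add_divide_distrib)
    finally show ?thesis by (simp add: w_sq)
  qed
  then show ?thesis by (simp add: matrix_eq)
qed

lemma rmat_det_nz: "b \<in> set witting \<Longrightarrow> det (rmat b) \<noteq> 0"
  using arg_cong[OF rmat_cube, of b det] by (auto simp: det_mul)

lemma G32_inverse: "M \<in> G32 \<Longrightarrow> \<exists>N\<in>G32. N ** M = mat 1 \<and> M ** N = mat 1"
proof (induction rule: G32.induct)
  case one
  show ?case by (rule bexI[OF _ G32.one]) simp
next
  case (step M b)
  then obtain N where N: "N \<in> G32" "N ** M = mat 1" "M ** N = mat 1" by blast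
  have b: "rmat b ** rmat b ** rmat b = mat 1" by (rule rmat_cube[OF gen_forms_witting[OF step(2)]])
  let ?I = "N ** (rmat b ** rmat b)"
  have "?I \<in> G32" using N(1) G32_gen[OF step(2)] by (intro G32_mult)
  moreover have "?I ** (rmat b ** M) = N ** (rmat b ** rmat b ** rmat b) ** M"
    "(rmat b ** M) ** ?I = rmat b ** (M ** N) ** rmat b ** rmat b"
    by (simp_all add: matrix_mul_assoc)
  then have "?I ** (rmat b ** M) = mat 1" "(rmat b ** M) ** ?I = mat 1"
    using N b by (simp_all)
  ultimately show ?case by blast
qed

lemma gens_gen_forms: "g \<in> set gens \<Longrightarrow> witting ! g \<in> set gen_forms"
  by (simp add: gen_forms_def)

lemma nth_witting: "k < 40 \<Longrightarrow> witting ! k \<in> set witting"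
  using witting_card by simp

lemma det_rmat_0: "det (rmat (witting ! 0)) = w"
proof -
  have b: "witting ! 0 = [e_theta, (0,0), (0,0), (0,0)]" by (simp add: witting_def)
  have c: "ev w (econj e_theta) = - theta" by (simp add: theta_def e_theta_def ev_def w_sq)
  have off: "rmat (witting ! 0) $ i $ k = 0" if "i \<noteq> k" for i k
    using that unfolding b rmat_def cvec_def vec4_def
    by (cases "i = 1"; cases "k = 1") (auto simp: idx_def numeral_2_eq_2 numeral_3_eq_3)
  have "rmat (witting ! 0) $ 1 $ 1 = 1 + w\<^sup>2 / theta * (- theta) * theta"
    unfolding b by (simp add: rmat_def cvec_def vec4_def c theta_def[symmetric])
  also have "\<dots> = 1 + w\<^sup>2 / theta * 3"
  proof -
    have "(- theta) * theta = 3" using theta_sq by simp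
    then show ?thesis by (simp only: mult.assoc)
  qed
  also have "\<dots> = w" by (rule kappa)
  finally have "rmat (witting ! 0) $ 1 $ 1 = w" .
  moreover have "rmat (witting ! 0) $ 2 $ 2 = 1" "rmat (witting ! 0) $ 3 $ 3 = 1" "rmat (witting ! 0) $ 4 $ 4 = 1"
    unfolding b by (simp_all add: rmat_def cvec_def vec4_def numeral_2_eq_2 numeral_3_eq_3)
  moreover have "det (rmat (witting ! 0)) = (\<Prod>i\<in>UNIV. rmat (witting ! 0) $ i $ i)"
    by (rule det_diagonal) (rule off)
  moreover have "(\<Prod>i\<in>UNIV. f i) = f 1 * f 2 * f 3 * f 4" for f :: "4 \<Rightarrow> complex"
    unfolding UNIV_4 by simp
  ultimately show ?thesis by (simp only: mult_1_right)
qed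

definition good :: "nat \<Rightarrow> bool" where
  "good k \<longleftrightarrow> k < 40 \<and> rmat (witting ! k) \<in> G32 \<and> det (rmat (witting ! k)) = w"

lemma good_conjugate:
  assumes "good b" "g \<in> set gens" "c < 40" and
    eq: "mmul (erefl (witting ! g)) (erefl (witting ! c)) = mmul (erefl (witting ! b)) (erefl (witting ! g))"
  shows "good c"
proof -
  have g: "witting ! g \<in> set gen_forms" "witting ! g \<in> set witting"
    using gens_gen_forms[OF assms(2)] gen_forms_witting by auto
  have len: "length (witting ! g) = 4" "length (witting ! b) = 4" "length (witting ! c) = 4"
    using assms(1,3) g nth_witting witting_length by (auto simp: good_def)
  have "smat (theta * theta) (rmat (witting ! g) ** rmat (witting ! c))
    = smat (theta * theta) (rmat (witting ! b) ** rmat (witting ! g))"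
    using arg_cong[OF eq, of mat4] len by (simp add: mat4_mmul wf_erefl mat4_erefl smat_mult)
  then have comm: "rmat (witting ! g) ** rmat (witting ! c) = rmat (witting ! b) ** rmat (witting ! g)"
    using smat_cancel[of "theta * theta"] theta_nz by fastforce
  obtain N where N: "N \<in> G32" "N ** rmat (witting ! g) = mat 1"
    using G32_inverse[OF G32_gen[OF g(1)]] by blast
  have "rmat (witting ! c) = N ** (rmat (witting ! g) ** rmat (witting ! c))"
    by (simp add: matrix_mul_assoc N(2))
  then have "rmat (witting ! c) = N ** (rmat (witting ! b) ** rmat (witting ! g))" by (simp only: comm)
  then have "rmat (witting ! c) \<in> G32"
    using N(1) G32_gen[OF g(1)] assms(1) G32_mult good_def by metis
  moreover have "det (rmat (witting ! g)) * det (rmat (witting ! c)) = det (rmat (witting ! g)) * w"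
    using arg_cong[OF comm, of det] assms(1) by (simp add: det_mul good_def mult.commute)
  then have "det (rmat (witting ! c)) = w" using rmat_det_nz[OF g(2)] by simp
  ultimately show ?thesis using assms(3) by (simp add: good_def)
qed

lemma covered_good:
  assumes "\<forall>k\<in>set acc. good k" "list_all (\<lambda>(c, b, g). c < 40 \<and> b < 40) ch"
  shows "\<forall>k\<in>set (covered acc ch). good k"
  using assms
proof (induction acc ch rule: covered.induct)
  case (2 acc c b g ch)
  let ?cond = "b \<in> set acc \<and> g \<in> set gens \<and>
     mmul (erefl (witting ! g)) (erefl (witting ! c)) = mmul (erefl (witting ! b)) (erefl (witting ! g))"
  have bounds: "c < 40" "list_all (\<lambda>(c, b, g). c < 40 \<and> b < 40) ch" using 2(3) by simp_all
  show ?case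
  proof (cases ?cond)
    case True
    have "covered acc ((c, b, g) # ch) = covered (c # acc) ch"
      unfolding covered.simps using True by (rule if_P)
    moreover have "good c"
      by (rule good_conjugate[of b g c]) (use True 2(2) bounds in blast)+
    then have "\<forall>k\<in>set (c # acc). good k" using 2(2) by simp
    ultimately show ?thesis using 2(1)[OF True _ bounds(2)] by argo
  next
    case False
    have "covered acc ((c, b, g) # ch) = acc"
      unfolding covered.simps using False by (rule if_not_P)
    then show ?thesis using 2(2) by argo
  qed
qed simp

lemma witting_good: "b \<in> set witting \<Longrightarrow> rmat b \<in> G32 \<and> det (rmat b) = w"
proof -
  assume "b \<in> set witting"
  then obtain k where k: "k < 40" "b = witting ! k" by (auto simp: in_set_conv_nth witting_card)
  have "good 0"
    using det_rmat_0 G32_gen[OF gens_gen_forms[of 0]] by (simp add: good_def gens_def)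
  then have "\<forall>k\<in>set [0]. good k" by simp
  then have "\<forall>k\<in>set (covered [0] chain). good k" using chain_bounds by (rule covered_good)
  moreover have "k \<in> set (covered [0] chain)" using all_covered k(1) unfolding list_all_iff by auto
  ultimately have "good k" by blast
  then show ?thesis using k by (simp add: good_def)
qed

text \<open>A nonvanishing minor of the coefficients of the two forms supplies the point.\<close>

lemma eform_indep:
  assumes "b \<in> set witting" "c \<in> set witting" "b \<noteq> c"
  shows "\<exists>p. eform b p = 0 \<and> eform c p \<noteq> 0"
proof -
  have "list_ex (\<lambda>(i, j). minor b c i j \<noteq> (0, 0)) [(0,1),(0,2),(0,3),(1,2),(1,3),(2,3)]"
    using minors assms unfolding list_all_iff by blast
  then obtain i j where ij: "minor b c i j \<noteq> (0, 0)" "i < 4" "j < 4" "i \<noteq> j"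
    by (auto simp: list_ex_iff)
  obtain p q :: 4 where pq: "idx p = i" "idx q = j"
    using ij bij_idx by (metis bij_betw_iff_bijections lessThan_iff)
  have "p \<noteq> q" using pq ij by auto
  define x where "x = vec4 b $ q *s axis p 1 - vec4 b $ p *s axis q 1"
  have f: "eform a x = vec4 b $ q * vec4 a $ p - vec4 b $ p * vec4 a $ q" for a
  proof -
    have ax: "eform a (axis k 1) = vec4 a $ k" for k
      by (simp add: eform_def axis_def if_distrib[of "\<lambda>x. _ * x"] cong: if_cong)
    show ?thesis by (simp add: x_def eform_diff eform_scale ax)
  qed
  have "ev w (minor b c i j) = vec4 b $ p * vec4 c $ q - vec4 b $ q * vec4 c $ p"
    by (simp add: minor_def ev_eadd ev_emul vec4_def pq)
  then have "vec4 b $ p * vec4 c $ q - vec4 b $ q * vec4 c $ p \<noteq> 0"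
    using ij(1) ev_eq_0 by metis
  then have "eform c x \<noteq> 0" unfolding f by auto
  moreover have "eform b x = 0" by (simp add: f)
  ultimately show ?thesis by blast
qed

lemma six_unit_power: "u \<in> set six_units \<Longrightarrow> ev w u ^ 6 = 1"
proof -
  have w6: "w ^ 6 = 1" using w_cube by (metis mult_2 numeral_Bit0 power_add mult_1)
  assume "u \<in> set six_units"
  then have "ev w u \<in> {1, w, w * w, -1, -w, -(w * w)}"
    unfolding six_units_def cube_units_def by (auto simp: ev_def w_sq)
  moreover have "(w * w) ^ 6 = 1" using w6 by (simp add: power_mult_distrib)
  ultimately show ?thesis using w6 by auto
qed

lemma length_vscale: "length (vscale u x) = length x"
  by (simp add: vscale_def)

lemma eform_gen_move:
  assumes g: "g \<in> set gens" and b: "b \<in> set witting"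
  shows "\<exists>c\<in>set witting. \<exists>u\<in>set six_units. \<forall>v. eform b (rmat (witting ! g) *v v) = ev w u * eform c v"
proof -
  have a: "witting ! g \<in> set witting" using gens_gen_forms[OF g] gen_forms_witting by auto
  have "move (witting ! g) b \<in> set move_targets"
    using moves g b unfolding moves_into_def list_all_iff by blast
  then obtain c u where c: "c \<in> set witting" and u: "u \<in> set six_units"
    and mv: "move (witting ! g) b = vscale (emul e_theta u) c"
    unfolding move_targets_def by auto
  let ?a = "witting ! g"
  have len: "length ?a = 4" "length b = 4" "length c = 4" using a b c witting_length by auto
  define k where "k = w * w * eform b (cvec ?a)"
  have eq: "theta *s vec4 b + k *s vec4 ?a = (theta * ev w u) *s vec4 c"
    using arg_cong[OF mv, of vec4] len
    by (simp add: move_def vec4_vadd vec4_vscale ev_emul eform_cvec theta_def length_vscale k_def)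
  have "theta * eform b v + k * eform ?a v = theta * ev w u * eform c v" for v
  proof -
    have "theta * eform b v + k * eform ?a v = (\<Sum>i\<in>UNIV. (theta *s vec4 b + k *s vec4 ?a) $ i * v $ i)"
      by (simp add: eform_def sum_distrib_left distrib_right sum.distrib mult.assoc)
    also have "\<dots> = theta * ev w u * eform c v"
      unfolding eq by (simp add: eform_def sum_distrib_left mult.assoc)
    finally show ?thesis .
  qed
  then have "eform b v + k / theta * eform ?a v = ev w u * eform c v" for v
    using theta_nz by (simp add: field_simps)
  then have "eform b (rmat ?a *v v) = ev w u * eform c v" for v
    by (simp add: rmat_mult eform_add eform_scale power2_eq_square k_def mult_ac)
  then show ?thesis using c u by blast
qed

text \<open>The 40 forms are permuted up to sixth roots of unity, which disappear in powers whose exponents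
  are divisible by 6.\<close>

definition inv_form :: "nat \<Rightarrow> complex ^ 4 \<Rightarrow> complex" where
  "inv_form d v = (\<Sum>b\<in>set witting. eform b v ^ d)"

lemma inv_form_gen:
  assumes g: "g \<in> set gens" and d: "6 dvd d"
  shows "inv_form d (rmat (witting ! g) *v v) = inv_form d v"
proof -
  let ?r = "rmat (witting ! g)"
  obtain \<pi> \<upsilon> where \<pi>: "\<And>b. b \<in> set witting \<Longrightarrow> \<pi> b \<in> set witting"
    "\<And>b. b \<in> set witting \<Longrightarrow> \<upsilon> b \<in> set six_units"
    "\<And>b v. b \<in> set witting \<Longrightarrow> eform b (?r *v v) = ev w (\<upsilon> b) * eform (\<pi> b) v"
    using eform_gen_move[OF g] by metis
  have unit: "ev w (\<upsilon> b) \<noteq> 0" "ev w (\<upsilon> b) ^ d = 1" if "b \<in> set witting" for b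
  proof -
    show "ev w (\<upsilon> b) \<noteq> 0" using six_unit_power[OF \<pi>(2)[OF that]] by auto
    show "ev w (\<upsilon> b) ^ d = 1" using six_unit_power[OF \<pi>(2)[OF that]] d by (auto simp: dvd_def power_mult)
  qed
  have "inj_on \<pi> (set witting)"
  proof (rule inj_onI, rule ccontr)
    fix b c assume bc: "b \<in> set witting" "c \<in> set witting" "\<pi> b = \<pi> c" "b \<noteq> c"
    obtain p where p: "eform b p = 0" "eform c p \<noteq> 0" using eform_indep[OF bc(1,2,4)] by blast
    obtain N where "?r ** N = mat 1" using G32_inverse[OF G32_gen[OF gens_gen_forms[OF g]]] by blast
    then have "?r *v (N *v p) = p" by (simp add: matrix_vector_mul_assoc)
    then have "eform (\<pi> b) (N *v p) = 0" "eform (\<pi> c) (N *v p) \<noteq> 0"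
      using p \<pi>(3)[OF bc(1), of "N *v p"] \<pi>(3)[OF bc(2), of "N *v p"] unit(1)[OF bc(1)] by auto
    then show False using bc(3) by simp
  qed
  then have "\<pi> ` set witting = set witting" by (intro endo_inj_surj) (use \<pi> in auto)
  then have "inv_form d v = (\<Sum>b\<in>set witting. eform (\<pi> b) v ^ d)"
    unfolding inv_form_def
    using sum.reindex[OF \<open>inj_on \<pi> (set witting)\<close>, of "\<lambda>b. eform b v ^ d"] by (simp add: comp_def)
  also have "\<dots> = inv_form d (?r *v v)"
    unfolding inv_form_def by (rule sum.cong) (simp_all add: \<pi>(3) power_mult_distrib unit)
  finally show ?thesis by simp
qed

lemma inv_form_invariant:
  assumes "6 dvd d" "M \<in> G32"
  shows "inv_form d (M *v v) = inv_form d v"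
  using assms(2)
proof (induction arbitrary: v rule: G32.induct)
  case (step M b)
  obtain g where "g \<in> set gens" "b = witting ! g" using step(2) by (auto simp: gen_forms_def)
  then have "inv_form d (rmat b *v (M *v v)) = inv_form d (M *v v)"
    using inv_form_gen[OF _ assms(1)] by simp
  then show ?case using step.IH by (simp add: matrix_vector_mul_assoc[symmetric])
qed simp

lemma inv_form_homog: "homog d (inv_form d)"
proof -
  have "(\<lambda>v. \<Sum>b\<in>set witting. eform b v ^ d) \<in> Poly"
    by (rule Poly_sum, rule Poly_power, rule Poly_linear, rule eform_linear)
  then show ?thesis
    by (simp add: homog_def inv_form_def[abs_def] eform_scale power_mult_distrib sum_distrib_left)
qed

lemma grad_inv_form: "grad (inv_form d) v $ i = of_nat d * (\<Sum>b\<in>set witting. eform b v ^ (d - 1) * vec4 b $ i)"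
proof (rule grad_eqI)
  have lin: "(eform b has_derivative eform b) (at v)" for b
    unfolding eform_def[abs_def]
    by (intro has_derivative_sum has_derivative_mult_right bounded_linear_imp_has_derivative
        bounded_linear_vec_nth)
  have "(inv_form d has_derivative (\<lambda>u. \<Sum>b\<in>set witting. of_nat d * eform b u * eform b v ^ (d - 1))) (at v)"
    unfolding inv_form_def[abs_def]
    by (intro has_derivative_sum has_derivative_power lin)
  also have "(\<lambda>u. \<Sum>b\<in>set witting. of_nat d * eform b u * eform b v ^ (d - 1))
    = (\<lambda>u. \<Sum>i\<in>UNIV. of_nat d * (\<Sum>b\<in>set witting. eform b v ^ (d - 1) * vec4 b $ i) * u $ i)"
    unfolding eform_def
    by (rule HOL.ext, simp add: sum_distrib_left sum_distrib_right, subst sum.swap)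
      (simp add: mult_ac)
  finally show "(inv_form d has_derivative (\<lambda>u. \<Sum>i\<in>UNIV. of_nat d *
    (\<Sum>b\<in>set witting. eform b v ^ (d - 1) * vec4 b $ i) * u $ i)) (at v)" .
qed

abbreviation deg_list :: "nat list" where "deg_list \<equiv> [12, 18, 24, 30]"

lemma epows_entry: "i < 4 \<Longrightarrow> ev w (epows x ! i) = ev w x ^ (deg_list ! i - 1)"
proof -
  assume "i < 4"
  then consider "i = 0" | "i = 1" | "i = 2" | "i = 3" by linarith
  then show ?thesis
    by cases (simp_all add: epows_def Let_def ev_emul numeral_2_eq_2 numeral_3_eq_3 eval_nat_numeral mult_ac)
qed

lemma madd_wf: "wf_mat A \<Longrightarrow> wf_mat B \<Longrightarrow> wf_mat (madd A B) \<and> mat4 (madd A B) = mat4 A + mat4 B"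
proof -
  assume A: "wf_mat A" and B: "wf_mat B"
  obtain a b c d where a: "A = [a, b, c, d]" using A by (auto simp: wf_mat_def elim: list4_cases)
  obtain a' b' c' d' where b: "B = [a', b', c', d']" using B by (auto simp: wf_mat_def elim: list4_cases)
  have len: "length x = 4" if "x \<in> {a, b, c, d, a', b', c', d'}" for x
    using A B that by (auto simp: wf_mat_def all_less_4 a b numeral_2_eq_2 numeral_3_eq_3)
  have row: "length (vadd x y) = 4 \<and> (\<forall>i<4. ev w (vadd x y ! i) = ev w (x ! i) + ev w (y ! i))"
    if "length x = 4" "length y = 4" for x y
    using that by (elim list4_cases) (simp add: all_less_4 ev_eadd numeral_2_eq_2 numeral_3_eq_3)
  have "idx k < 4" for k using bij_idx by (auto simp: bij_betw_def)
  then show ?thesis using row len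
    by (simp add: a b wf_mat_def all_less_4 vec_eq_iff forall_4 mat4_def numeral_2_eq_2 numeral_3_eq_3)
qed

lemma mat4_msum:
  "\<forall>A\<in>set As. wf_mat A \<Longrightarrow> wf_mat (msum As) \<and> mat4 (msum As) = sum_list (map mat4 As)"
proof (induction As)
  case Nil
  have "wf_mat (msum [])" by (simp add: wf_mat_def)
  moreover have "mat4 (msum []) = 0"
    unfolding vec_eq_iff forall_4 by (simp add: mat4_def)
  ultimately show ?case by simp
next
  case (Cons A As)
  then show ?case using madd_wf[of A "msum As"] by simp
qed

lemma sum_list_entry: "(sum_list Ms :: complex ^ 4 ^ 4) $ i $ k = sum_list (map (\<lambda>M. M $ i $ k) Ms)"
  by (induction Ms) simp_all

definition jac_row :: "eis list \<Rightarrow> eis list list" where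
  "jac_row b = map (\<lambda>p. vscale p b) (epows (edot b e_point))"

lemma wf_jac_row: "length b = 4 \<Longrightarrow> wf_mat (jac_row b)"
  by (simp add: wf_mat_def jac_row_def epows_def Let_def vscale_def all_less_4 numeral_2_eq_2 numeral_3_eq_3)

lemma mat4_ejac:
  "wf_mat ejac \<and> mat4 ejac $ i $ k
    = (\<Sum>b\<in>set witting. eform b (vec4 e_point) ^ (deg_list ! idx i - 1) * vec4 b $ k)"
proof -
  have e: "ejac = msum (map jac_row witting)" by (simp add: ejac_def jac_row_def[abs_def])
  have wf: "\<forall>A\<in>set (map jac_row witting). wf_mat A" by (auto simp: wf_jac_row witting_length)
  have ent: "mat4 (jac_row b) $ i $ k = eform b (vec4 e_point) ^ (deg_list ! idx i - 1) * vec4 b $ k"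
    if "b \<in> set witting" for b
  proof -
    have ik: "idx i < 4" "idx k < 4" using bij_idx by (auto simp: bij_betw_def)
    have len: "length b = 4" using witting_length[OF that] .
    have "ev w (edot b e_point) = eform b (vec4 e_point)"
      using ev_edot[OF len, of e_point] by (simp add: eform_def e_point_def)
    moreover have "length (epows (edot b e_point)) = 4" by (simp add: epows_def Let_def)
    ultimately show ?thesis
      using ik len by (simp add: mat4_def jac_row_def vscale_def ev_emul epows_entry vec4_def)
  qed
  have "mat4 ejac $ i $ k = sum_list (map (\<lambda>b. mat4 (jac_row b) $ i $ k) witting)"
    unfolding e using mat4_msum[OF wf] by (simp add: sum_list_entry comp_def)
  also have "\<dots> = (\<Sum>b\<in>set witting. mat4 (jac_row b) $ i $ k)"
    by (rule sum_list_distinct_conv_sum_set[OF witting_distinct])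
  also have "\<dots> = (\<Sum>b\<in>set witting. eform b (vec4 e_point) ^ (deg_list ! idx i - 1) * vec4 b $ k)"
    by (rule sum.cong) (simp_all add: ent)
  finally show ?thesis using mat4_msum[OF wf] e by simp
qed

lemma ejac_det: "det (mat4 ejac) \<noteq> 0"
proof -
  define c where "c = mmul ejac (eadj ejac) ! 0 ! 0"
  have c: "c \<noteq> (0, 0)" "mmul ejac (eadj ejac) = mscale c eid"
    using ejac_regular by (simp_all add: c_def)
  have "wf_mat (eadj ejac)" by (simp add: wf_mat_def eadj_def)
  then have "mat4 ejac ** mat4 (eadj ejac) = smat (ev w c) (mat 1)"
    using arg_cong[OF c(2), of mat4] mat4_ejac by (simp add: mat4_mmul mat4_mscale wf_eid mat4_eid)
  then have "mat4 ejac ** mat4 (eadj ejac) = mat (ev w c)" by (simp add: smat_mat)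
  then have "invertible (mat4 ejac)" by (rule invertible_if_mult_mat) (simp add: ev_eq_0 c)
  then show ?thesis by (simp add: invertible_det_nz)
qed

lemma jacobian_system_G32:
  "jacobian_system G32 (\<lambda>i. inv_form (deg_list ! i)) ((!) deg_list) idx (set witting) eform
    (\<lambda>b. (1 / 3) *s cvec b) rmat w (vec4 e_point)"
proof (rule jacobian_system.intro)
  have d6: "6 dvd deg_list ! i" "deg_list ! i > 0" if "i < 4" for i
  proof -
    from that consider "i = 0" | "i = 1" | "i = 2" | "i = 3" by linarith
    then show "6 dvd deg_list ! i" "deg_list ! i > 0" by (cases; simp)+
  qed
  show "bij_betw idx UNIV {..<CARD(4)}" using bij_idx by simp
  show "homog (deg_list ! i) (inv_form (deg_list ! i))" for i by (rule inv_form_homog)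
  show "0 < deg_list ! i" if "i < CARD(4)" for i using that d6(2) by simp
  show "inv_form (deg_list ! i) (g *v v) = inv_form (deg_list ! i) v" if "i < CARD(4)" "g \<in> G32" for i g v
    using that d6(1) inv_form_invariant by simp
  show "det g \<noteq> 0" if "g \<in> G32" for g
    using G32_inverse[OF that] by (metis det_I det_mul mult_zero_left zero_neq_one mult_zero_right)
  show "finite (set witting)" by simp
  show "Vector_Spaces.linear (*s) (*) (eform b)" for b by (rule eform_linear)
  show "eform b ((1 / 3) *s cvec b) = 1" if "b \<in> set witting" for b
    by (simp add: eform_scale eform_cvec_self that)
  show "\<exists>p. eform b p = 0 \<and> eform c p \<noteq> 0" if "b \<in> set witting" "c \<in> set witting" "b \<noteq> c" for b c
    using eform_indep that by blast
  show "rmat b \<in> G32" "det (rmat b) = w" if "b \<in> set witting" for b using witting_good[OF that] by auto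
  show "rmat b *v v = v" if "eform b v = 0" for b v by (rule rmat_fixed[OF that])
  show "eform b (rmat b *v v) = w * eform b v" if "b \<in> set witting" for b v
    by (rule eform_rmat_self[OF that])
  show "w \<noteq> 1" by (rule w_ne_1)
  show "w\<^sup>2 \<noteq> 1"
  proof
    assume "w\<^sup>2 = 1"
    then have "w ^ 3 = w" by (simp add: power3_eq_cube power2_eq_square)
    then show False using w_cube w_ne_1 by simp
  qed
  have rows: "(\<chi> i. grad (inv_form (deg_list ! idx i)) (vec4 e_point))
    = (\<chi> i. of_nat (deg_list ! idx i) *s (mat4 ejac $ i))"
    by (simp add: vec_eq_iff grad_inv_form mat4_ejac)
  have "of_nat (deg_list ! idx i) \<noteq> (0 :: complex)" for i
    using d6(2)[of "idx i"] bij_idx by (auto simp: bij_betw_def)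
  then show "det (\<chi> i. grad (inv_form (deg_list ! idx i)) (vec4 e_point)) \<noteq> 0"
    unfolding rows using ejac_det by (simp add: det_rows_mul vec_lambda_eta)
  have "card (set witting) = 40" using distinct_card[OF witting_distinct] witting_card by simp
  then show "(\<Sum>i\<in>UNIV. deg_list ! idx i) = 2 * card (set witting) + CARD(4)"
    by (simp add: sum_4 numeral_2_eq_2 numeral_3_eq_3)
qed

definition G32_maps :: "(complex ^ 4 \<Rightarrow> complex ^ 4) set" where
  "G32_maps = (*v) ` G32"

lemma G32_degrees: "has_degrees (*s) G32_maps deg_list"
proof -
  interpret js: jacobian_system G32 "\<lambda>i. inv_form (deg_list ! i)" "(!) deg_list" idx "set witting" eform
    "\<lambda>b. (1 / 3) *s cvec b" rmat w "vec4 e_point" by (rule jacobian_system_G32)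
  let ?f = "\<lambda>i. inv_form (deg_list ! i)"
  have inv: "f \<in> invariant_ring (*s) G32_maps \<longleftrightarrow> f \<in> Poly \<and> (\<forall>M\<in>G32. \<forall>v. f (M *v v) = f v)" for f
    by (auto simp: invariant_ring_def G32_maps_def)
  have "invariant_ring (*s) G32_maps = subalgebra_gen (?f ` {..<4})"
  proof (intro equalityI subsetI)
    fix f assume "f \<in> invariant_ring (*s) G32_maps"
    then show "f \<in> subalgebra_gen (?f ` {..<4})" using js.invariants_generated[of f] by (simp add: inv)
  next
    fix f assume "f \<in> subalgebra_gen (?f ` {..<4})"
    then have "f \<in> Poly \<and> (\<forall>M\<in>G32. \<forall>v. f (M *v v) = f v)"
    proof (induction rule: subalgebra_gen.induct)
      case (base f)
      then show ?case using js.F_inv inv_form_homog by (auto simp: homog_def)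
    qed (auto intro: Poly_const Poly_add Poly_mult)
    then show "f \<in> invariant_ring (*s) G32_maps" by (simp add: inv)
  qed
  moreover have "algebraically_independent 4 ?f" using js.algebraically_independent by simp
  moreover have "?f i (c *s v) = c ^ (deg_list ! i) * ?f i v" for i c v
    using inv_form_homog by (simp add: homog_def)
  moreover have "length deg_list = 4" "vec.dim (UNIV :: (complex ^ 4) set) = 4"
    by (simp, unfold vec_dim_card, simp)
  ultimately show ?thesis
    unfolding has_degrees_def by (intro conjI exI[of _ ?f]) (simp_all only: simp_thms)
qed

end

section \<open>Reflections, irreducibility and primitivity\<close>

context cube_root
begin

lemma mult_vec_in_GL:
  assumes "M ** N = mat 1" "N ** M = mat 1"
  shows "(*v) M \<in> carrier (GL ((*s) :: complex \<Rightarrow> complex ^ 4 \<Rightarrow> complex ^ 4))"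
proof -
  have "bij ((*v) M)"
    by (rule bij_betw_byWitness[where f' = "(*v) N"]) (auto simp: matrix_vector_mul_assoc assms)
  then show ?thesis by (simp add: GL_carrier)
qed

lemma G32_maps_carrier: "G32_maps \<subseteq> carrier (GL (*s))"
proof
  fix g assume "g \<in> G32_maps"
  then obtain M where M: "M \<in> G32" "g = (*v) M" by (auto simp: G32_maps_def)
  then show "g \<in> carrier (GL (*s))" using G32_inverse[OF M(1)] mult_vec_in_GL by blast
qed

lemma GL_vec_group: "group (GL ((*s) :: complex \<Rightarrow> complex ^ 4 \<Rightarrow> complex ^ 4))"
  by (rule GL_group) (rule vec.vector_space_axioms)

lemma mult_vec_comp: "(*v) M \<circ> (*v) N = (*v) (M ** N :: complex ^ 4 ^ 4)"
  by (rule HOL.ext) (simp add: matrix_vector_mul_assoc)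

lemma mult_vec_one: "(*v) (mat 1 :: complex ^ 4 ^ 4) = id"
  by (rule HOL.ext) simp

lemma subgroup_G32: "subgroup G32_maps (GL (*s))"
proof -
  interpret group "GL ((*s) :: complex \<Rightarrow> complex ^ 4 \<Rightarrow> complex ^ 4)" by (rule GL_vec_group)
  show ?thesis
  proof (rule subgroupI)
    show "G32_maps \<subseteq> carrier (GL (*s))" by (rule G32_maps_carrier)
    show "G32_maps \<noteq> {}" using G32.one by (auto simp: G32_maps_def)
  next
    fix g assume g: "g \<in> G32_maps"
    then obtain M where M: "M \<in> G32" "g = (*v) M" by (auto simp: G32_maps_def)
    obtain N where N: "N \<in> G32" "N ** M = mat 1" using G32_inverse[OF M(1)] by blast
    have gN: "(*v) N \<in> G32_maps" using N by (simp add: G32_maps_def)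
    have "inv\<^bsub>GL (*s)\<^esub> g = (*v) N"
      by (rule inv_equality)
        (use g gN G32_maps_carrier N M in \<open>auto simp: GL_mult GL_one mult_vec_comp mult_vec_one\<close>)
    then show "inv\<^bsub>GL (*s)\<^esub> g \<in> G32_maps" using gN by simp
  next
    fix g h assume "g \<in> G32_maps" "h \<in> G32_maps"
    then show "g \<otimes>\<^bsub>GL (*s)\<^esub> h \<in> G32_maps"
      by (auto simp: G32_maps_def GL_mult mult_vec_comp intro: G32_mult)
  qed
qed

lemma eform_move:
  "M \<in> G32 \<Longrightarrow> b \<in> set witting \<Longrightarrow>
    \<exists>c\<in>set witting. \<exists>z. z ^ 6 = 1 \<and> (\<forall>v. eform b (M *v v) = z * eform c v)"
proof (induction arbitrary: b rule: G32.induct)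
  case one
  then show ?case by (intro bexI[of _ b] exI[of _ 1]) auto
next
  case (step M a)
  obtain g where g: "g \<in> set gens" "a = witting ! g" using step(2) by (auto simp: gen_forms_def)
  obtain c u where c: "c \<in> set witting" "u \<in> set six_units"
    "\<And>v. eform b (rmat a *v v) = ev w u * eform c v"
    using eform_gen_move[OF g(1) step(4)] g(2) by blast
  obtain d z where d: "d \<in> set witting" "z ^ 6 = 1" "\<And>v. eform c (M *v v) = z * eform d v"
    using step(3)[OF c(1)] by blast
  have "eform b ((rmat a ** M) *v v) = (ev w u * z) * eform d v" for v
    by (simp add: matrix_vector_mul_assoc[symmetric] c(3) d(3))
  then show ?case using d(1,2) six_unit_power[OF c(2)]
    by (intro bexI[of _ d] exI[of _ "ev w u * z"]) (auto simp: power_mult_distrib)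
qed

lemma coord_eform: "eform (witting ! idx i) v = theta * v $ i"
proof -
  have "vec4 (witting ! idx i) = theta *s axis i 1"
    using exhaust_4[of i]
    by (elim disjE)
      (simp_all add: witting_def vec_eq_iff forall_4 vec4_def axis_def theta_def numeral_2_eq_2 numeral_3_eq_3)
  then have "vec4 (witting ! idx i) $ k * v $ k = (if k = i then theta * v $ i else 0)" for k
    by (simp add: axis_def)
  then show ?thesis by (simp add: eform_def)
qed

text \<open>An element of the group is determined by the multiples of forms into which it transforms the
  coordinates, which leaves finitely many possibilities.\<close>

lemma finite_G32: "finite G32"
proof -
  define S where "S = {z :: complex. z ^ 6 = 1} \<times> set witting"
  define mk :: "(4 \<Rightarrow> complex \<times> eis list) \<Rightarrow> complex ^ 4 ^ 4" where
    "mk f = (\<chi> i k. fst (f i) / theta * vec4 (snd (f i)) $ k)" for f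
  have "finite {z :: complex. z ^ 6 = 1}" using finite_roots_unity[of 6] by simp
  then have "finite S" by (simp add: S_def)
  then have "finite (PiE (UNIV :: 4 set) (\<lambda>_. S))" by (intro finite_PiE) auto
  moreover have "G32 \<subseteq> mk ` PiE UNIV (\<lambda>_. S)"
  proof
    fix M assume M: "M \<in> G32"
    have "\<exists>p\<in>S. \<forall>v. eform (witting ! idx i) (M *v v) = fst p * eform (snd p) v" for i
    proof -
      have "idx i < 4" using bij_idx by (auto simp: bij_betw_def)
      then have "idx i < 40" by simp
      from eform_move[OF M nth_witting[OF this]] show ?thesis by (force simp: S_def)
    qed
    then obtain f where f: "\<And>i. f i \<in> S"
      "\<And>i v. eform (witting ! idx i) (M *v v) = fst (f i) * eform (snd (f i)) v" by metis
    have "M $ i $ k = mk f $ i $ k" for i k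
    proof -
      have "(M *v axis k 1) $ i = M $ i $ k" by (rule mult_axis_entry)
      moreover have "eform b (axis k 1) = vec4 b $ k" for b
        by (simp add: eform_def axis_def if_distrib[of "\<lambda>x. _ * x"] cong: if_cong)
      ultimately have "theta * M $ i $ k = fst (f i) * vec4 (snd (f i)) $ k"
        using f(2)[of i "axis k 1"] unfolding coord_eform by simp
      then show ?thesis using theta_nz by (simp add: mk_def field_simps)
    qed
    then have "M = mk f" by (simp add: vec_eq_iff)
    then show "M \<in> mk ` PiE UNIV (\<lambda>_. S)" using f(1) by blast
  qed
  ultimately show ?thesis by (meson finite_surj)
qed

lemma cvec_nz: "b \<in> set witting \<Longrightarrow> cvec b \<noteq> 0"
  using eform_cvec_self[of b] by (auto simp: eform_def)

lemma rmat_reflection: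
  assumes b: "b \<in> set witting"
  shows "is_reflection (*s) ((*v) (rmat b))"
proof -
  have fixed: "{v. rmat b *v v = v} = {v. eform b v = 0}"
    using rmat_fixed eform_rmat_self[OF b] w_ne_1 by (auto, metis mult_cancel_right1)
  have sub: "vec.subspace {v. eform b v = 0}"
    by (rule vec.subspaceI) (auto simp: eform_add eform_scale, simp add: eform_def)
  let ?T = "vec.span {cvec b}"
  have "{x + y | x y. x \<in> {v. eform b v = 0} \<and> y \<in> ?T} = UNIV"
  proof (intro equalityI subsetI UNIV_I)
    fix v
    have "v = (v - (eform b v / 3) *s cvec b) + (eform b v / 3) *s cvec b" by simp
    moreover have "eform b (v - (eform b v / 3) *s cvec b) = 0"
      by (simp add: eform_diff eform_scale eform_cvec_self[OF b])
    moreover have "(eform b v / 3) *s cvec b \<in> ?T" by (intro vec.span_scale vec.span_base) simp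
    ultimately show "v \<in> {x + y | x y. x \<in> {v. eform b v = 0} \<and> y \<in> ?T}" by blast
  qed
  moreover have "{v. eform b v = 0} \<inter> ?T = {0}"
  proof (intro equalityI subsetI)
    fix v assume "v \<in> {v. eform b v = 0} \<inter> ?T"
    then obtain c where "v = c *s cvec b" "eform b v = 0" by (auto simp: vec.span_singleton)
    then show "v \<in> {0}" using eform_cvec_self[OF b] by (auto simp: eform_scale)
  qed (auto simp: eform_def vec.span_zero)
  moreover have "vec.dim ?T = 1" using cvec_nz[OF b] by simp
  ultimately have "vec.dim {v. eform b v = 0} + 1 = vec.dim (UNIV :: (complex ^ 4) set)"
    using vec.dim_sums_Int[OF sub vec.subspace_span[of "{cvec b}"]] by simp
  moreover have "rmat b ** (rmat b ** rmat b) = mat 1" "(rmat b ** rmat b) ** rmat b = mat 1"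
    using rmat_cube[OF b] by (simp_all add: matrix_mul_assoc)
  ultimately show ?thesis
    using mult_vec_in_GL[of "rmat b"] unfolding is_reflection_def fixed by blast
qed

lemma reflection_group_G32: "is_reflection_group (*s) G32_maps"
proof -
  interpret group "GL ((*s) :: complex \<Rightarrow> complex ^ 4 \<Rightarrow> complex ^ 4)" by (rule GL_vec_group)
  let ?R = "{g \<in> G32_maps. is_reflection (*s) g}"
  have "(*v) M \<in> generate (GL (*s)) ?R" if "M \<in> G32" for M
    using that
  proof (induction rule: G32.induct)
    case one
    show ?case using generate.one[of "GL (*s)" ?R] unfolding mult_vec_one GL_one .
  next
    case (step M b)
    have "(*v) (rmat b) \<in> ?R"
      using G32_gen[OF step(2)] rmat_reflection[OF gen_forms_witting[OF step(2)]]
      by (simp add: G32_maps_def)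
    then have "(*v) (rmat b) \<in> generate (GL (*s)) ?R" by (rule generate.incl)
    from generate.eng[OF this step(3)] show ?case by (simp add: GL_mult mult_vec_comp)
  qed
  then have "G32_maps \<subseteq> generate (GL (*s)) ?R" by (auto simp: G32_maps_def)
  moreover have "generate (GL (*s)) ?R \<subseteq> G32_maps"
    by (rule generate_subgroup_incl[OF _ subgroup_G32]) auto
  ultimately show ?thesis
    using subgroup_G32 finite_G32 by (simp add: is_reflection_group_def G32_maps_def subset_antisym)
qed

text \<open>The roots of the four generators form a connected diagram and span the space.\<close>

lemma invariant_subspace:
  assumes U: "vec.subspace U" and inv: "\<And>b u. b \<in> set gen_forms \<Longrightarrow> u \<in> U \<Longrightarrow> rmat b *v u \<in> U"
  shows "U = {0} \<or> U = UNIV"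
proof (cases "U = {0}")
  case False
  define b1 b2 b3 b4 where "b1 = witting ! 0" and "b2 = witting ! 31" and "b3 = witting ! 1" and "b4 = witting ! 4"
  have bs: "set gen_forms = {b1, b2, b3, b4}"
    by (simp add: gen_forms_def gens_def b1_def b2_def b3_def b4_def)
  have vals: "b1 = [e_theta, (0,0), (0,0), (0,0)]" "b2 = [(1,0), (1,0), (-1,0), (0,0)]"
    "b3 = [(0,0), e_theta, (0,0), (0,0)]" "b4 = [(0,0), (1,0), (1,0), (1,0)]"
    by (simp_all add: b1_def b2_def b3_def b4_def witting_def cube_units_def)
  have "ev w (econj e_theta) = - theta" by (simp add: theta_def e_theta_def ev_def w_sq)
  then have c: "cvec b1 = - theta *s axis 1 1" "cvec b2 = axis 1 1 + axis 2 1 - axis 3 1"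
    "cvec b3 = - theta *s axis 2 1" "cvec b4 = axis 2 1 + axis 3 1 + axis 4 1"
    by (simp_all add: vals cvec_def vec4_def vec_eq_iff forall_4 axis_def numeral_2_eq_2 numeral_3_eq_3)
  have f: "eform b1 v = theta * v $ 1" "eform b2 v = v $ 1 + v $ 2 - v $ 3" "eform b3 v = theta * v $ 2"
    "eform b4 v = v $ 2 + v $ 3 + v $ 4" for v
    by (simp_all add: vals eform_def sum_4 vec4_def theta_def numeral_2_eq_2 numeral_3_eq_3)
  have root: "cvec b \<in> U" if b: "b \<in> set gen_forms" and u: "u \<in> U" "eform b u \<noteq> 0" for b u
  proof -
    have "rmat b *v u - u \<in> U" using U inv[OF b u(1)] u(1) by (simp add: vec.subspace_diff)
    moreover define k where "k = w\<^sup>2 / theta * eform b u"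
    ultimately have "k *s cvec b \<in> U" by (simp add: rmat_mult)
    then have "(1 / k) *s (k *s cvec b) \<in> U" by (rule vec.subspace_scale[OF U])
    moreover have "k \<noteq> 0" using u(2) w_nz theta_nz by (simp add: k_def)
    ultimately show ?thesis by simp
  qed
  obtain u where u: "u \<in> U" "u \<noteq> 0" using False vec.subspace_0[OF U] by blast
  have "eform b1 u \<noteq> 0 \<or> eform b2 u \<noteq> 0 \<or> eform b3 u \<noteq> 0 \<or> eform b4 u \<noteq> 0"
    using u(2) theta_nz by (auto simp: f vec_eq_iff forall_4)
  then have "cvec b1 \<in> U \<or> cvec b2 \<in> U \<or> cvec b3 \<in> U \<or> cvec b4 \<in> U"
    using root[of _ u] u(1) bs by auto
  moreover have "eform b2 (cvec b1) \<noteq> 0" "eform b1 (cvec b2) \<noteq> 0" "eform b3 (cvec b2) \<noteq> 0"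
    "eform b2 (cvec b3) \<noteq> 0" "eform b4 (cvec b3) \<noteq> 0" "eform b3 (cvec b4) \<noteq> 0"
    using theta_nz by (simp_all add: c f axis_def)
  ultimately have all: "cvec b1 \<in> U" "cvec b2 \<in> U" "cvec b3 \<in> U" "cvec b4 \<in> U"
    using root[of b1] root[of b2] root[of b3] root[of b4] bs by auto
  have e1: "axis 1 1 \<in> U"
    using vec.subspace_scale[OF U all(1), of "- (1 / theta)"] theta_nz by (simp add: c)
  have e2: "axis 2 1 \<in> U"
    using vec.subspace_scale[OF U all(3), of "- (1 / theta)"] theta_nz by (simp add: c)
  have "axis 3 1 = axis 1 1 + axis 2 1 - cvec b2" by (simp add: c)
  then have e3: "axis 3 1 \<in> U" using e1 e2 all(2) U by (metis vec.subspace_add vec.subspace_diff)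
  have "axis 4 1 = cvec b4 - axis 2 1 - axis 3 1" by (simp add: c)
  then have e4: "axis 4 1 \<in> U" using e2 e3 all(4) U by (metis vec.subspace_diff)
  have "v \<in> U" for v
  proof -
    have "v = v $ 1 *s axis 1 1 + v $ 2 *s axis 2 1 + v $ 3 *s axis 3 1 + v $ 4 *s axis 4 1"
      by (simp add: vec_eq_iff forall_4 axis_def)
    also have "\<dots> \<in> U" using U e1 e2 e3 e4 by (intro vec.subspace_add vec.subspace_scale)
    finally show ?thesis .
  qed
  then show ?thesis by blast
qed simp

lemma irreducible_G32: "irreducible_group (*s) G32_maps"
  unfolding irreducible_group_def
proof (intro conjI allI impI)
  have "axis 1 1 \<noteq> (0 :: complex ^ 4)" by (simp add: axis_eq_0_iff)
  then show "(UNIV :: (complex ^ 4) set) \<noteq> {0}" by blast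
  fix U :: "(complex ^ 4) set" assume U: "vec.subspace U \<and> (\<forall>g\<in>G32_maps. g ` U \<subseteq> U)"
  then show "U = {0} \<or> U = UNIV"
    by (intro invariant_subspace) (auto simp: G32_maps_def dest: G32_gen)
qed

text \<open>A reflection of order three that moves a summand has an orbit of three summands, so its
  powers act on a vector of that summand by linearly independent vectors; but they satisfy a
  quadratic relation.\<close>

lemma reflection_fixes_summand:
  assumes D: "is_direct_sum (*s) \<U>" and nz: "{0} \<notin> \<U>" and b: "b \<in> set witting"
    and perm: "\<And>U. U \<in> \<U> \<Longrightarrow> (*v) (rmat b) ` U \<in> \<U>" and U: "U \<in> \<U>"
  shows "(*v) (rmat b) ` U = U"
proof (rule ccontr)
  let ?r = "(*v) (rmat b)"
  assume ne: "?r ` U \<noteq> U"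
  have r3: "?r (?r (?r v)) = v" for v
    using rmat_cube[OF b] by (simp add: matrix_vector_mul_assoc matrix_mul_assoc)
  have img3: "?r ` ?r ` ?r ` S = S" for S using r3 by (force simp: image_image)
  define U1 U2 where "U1 = ?r ` U" and "U2 = ?r ` U1"
  have mem: "U1 \<in> \<U>" "U2 \<in> \<U>" using perm U by (auto simp: U1_def U2_def)
  have "?r ` U2 = U" by (simp add: U1_def U2_def img3)
  then have dist: "U1 \<noteq> U" "U2 \<noteq> U1" "U2 \<noteq> U"
    using ne img3[of U] by (auto simp: U1_def U2_def)
  have sub: "\<And>S. S \<in> \<U> \<Longrightarrow> vec.subspace S" and fin: "finite \<U>"
    and uniq: "\<And>v. \<exists>!u. (\<forall>U\<in>\<U>. u U \<in> U) \<and> (\<forall>U. U \<notin> \<U> \<longrightarrow> u U = 0) \<and> v = (\<Sum>U\<in>\<U>. u U)"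
    using D by (auto simp: is_direct_sum_def)
  have "U \<noteq> {0}" "0 \<in> U" using nz U sub[OF U] by (auto simp: vec.subspace_0)
  then obtain x where x: "x \<in> U" "x \<noteq> 0" by blast
  have rx: "?r x \<in> U1" "?r (?r x) \<in> U2" using x(1) by (auto simp: U1_def U2_def)
  define z where "z = (\<lambda>S. if S = U then w *s x else if S = U1 then - (1 + w) *s ?r x
    else if S = U2 then ?r (?r x) else 0)"
  have "(\<Sum>S\<in>\<U>. z S) = (\<Sum>S\<in>{U, U1, U2}. z S)"
    by (rule sum.mono_neutral_right) (use fin U mem in \<open>auto simp: z_def\<close>)
  also have "\<dots> = w *s x - (1 + w) *s ?r x + ?r (?r x)"
    using dist dist(1,2,3)[symmetric] by (simp add: z_def)
  also have "\<dots> = 0"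
  proof -
    define k where "k = w\<^sup>2 / theta * eform b x"
    have rx: "?r x = x + k *s cvec b" by (simp add: rmat_mult k_def)
    have "?r (?r x) = ?r x + (w\<^sup>2 / theta * (w * eform b x)) *s cvec b"
      by (subst rmat_mult) (simp only: eform_rmat_self[OF b])
    then have "?r (?r x) = ?r x + (w * k) *s cvec b" by (simp add: k_def mult_ac)
    then show ?thesis unfolding rx by (simp add: vec_eq_iff algebra_simps)
  qed
  finally have sum0: "0 = (\<Sum>S\<in>\<U>. z S)" by simp
  have z_mem: "\<forall>S\<in>\<U>. z S \<in> S"
  proof
    fix S assume S: "S \<in> \<U>"
    consider "S = U" | "S = U1" | "S = U2" | "S \<noteq> U" "S \<noteq> U1" "S \<noteq> U2" by blast
    then show "z S \<in> S"
    proof cases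
      case 1
      then have "z S = w *s x" by (simp only: z_def simp_thms if_True)
      then show ?thesis using 1 vec.subspace_scale[OF sub[OF S]] x(1) by simp
    next
      case 2
      then have "z S = - (1 + w) *s ?r x" using dist(1) by (simp only: z_def simp_thms if_True if_False)
      then show ?thesis using 2 vec.subspace_scale[OF sub[OF S]] rx(1) by (simp only:)
    next
      case 3
      then have "z S = ?r (?r x)" using dist by (simp only: z_def simp_thms if_True if_False)
      then show ?thesis using 3 rx(2) by simp
    next
      case 4
      then have "z S = 0" by (simp only: z_def simp_thms if_False)
      then show ?thesis using vec.subspace_0[OF sub[OF S]] by simp
    qed
  qed
  have z_out: "\<forall>S. S \<notin> \<U> \<longrightarrow> z S = 0" using U mem by (auto simp: z_def)
  have "(\<forall>S\<in>\<U>. (0 :: complex ^ 4) \<in> S)" using sub by (simp add: vec.subspace_0)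
  then have "z = (\<lambda>_. 0)" using uniq[of 0] z_mem z_out sum0 by (elim ex1E) (metis (mono_tags, lifting) sum.neutral_const)
  then have "z U = 0" by simp
  then show False using x(2) w_nz by (simp add: z_def)
qed

lemma primitive_G32: "primitive_group (*s) G32_maps"
  unfolding primitive_group_def
proof (rule notI, elim exE conjE)
  fix \<U> :: "(complex ^ 4) set set"
  assume D: "is_direct_sum (*s) \<U>" and card: "2 \<le> card \<U>" and nz: "{0} \<notin> \<U>"
    and perm: "\<forall>g\<in>G32_maps. \<forall>U\<in>\<U>. g ` U \<in> \<U>"
  have "U = UNIV" if U: "U \<in> \<U>" for U
  proof -
    have "rmat b *v u \<in> U" if b: "b \<in> set gen_forms" and u: "u \<in> U" for b u
    proof -
      have "(*v) (rmat b) ` U' \<in> \<U>" if "U' \<in> \<U>" for U'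
        using perm that G32_gen[OF b] by (auto simp: G32_maps_def)
      from reflection_fixes_summand[OF D nz gen_forms_witting[OF b] this U] show ?thesis
        using u by blast
    qed
    moreover have "vec.subspace U" using D U by (simp add: is_direct_sum_def)
    ultimately show ?thesis using invariant_subspace[of U] nz U by blast
  qed
  then have "\<U> \<subseteq> {UNIV}" by blast
  then have "card \<U> \<le> 1" using card_mono[of "{UNIV}" \<U>] by simp
  then show False using card by simp
qed

theorem G32_maps_shephard_todd: "is_shephard_todd_G32 (*s) G32_maps"
  unfolding is_shephard_todd_G32_def
  using reflection_group_G32 irreducible_G32 primitive_G32 G32_degrees vec.vector_space_axioms
  by (simp add: vec_dim_card[where 'a = complex and 'n = 4, simplified])

end

section \<open>The preimage of the extended derived group\<close>

text \<open>The coordinates of $p \wedge (p \wedge q) = 0$.\<close>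

lemma wd_support:
  assumes "wd p q = wd (axis i 1) (axis k 1)" "i \<noteq> k" "m \<noteq> i" "m \<noteq> k"
  shows "p $ m = 0"
proof -
  have wd: "wd p q $ a $ b = wd (axis i 1) (axis k 1) $ a $ b" for a b using assms(1) by simp
  have "wd p q $ i $ k = 1" "wd p q $ i $ m = 0" "wd p q $ k $ m = 0"
    using assms(2-4) unfolding wd by (auto simp: wd_def axis_def)
  moreover have "p $ m * wd p q $ i $ k - p $ k * wd p q $ i $ m + p $ i * wd p q $ k $ m = 0"
    by (simp add: wd_def algebra_simps)
  ultimately show ?thesis by simp
qed

text \<open>A matrix that acts trivially on the exterior square fixes every coordinate plane, hence every
  coordinate line, and is therefore a sign.\<close>
lemma act_trivial:
  assumes act: "\<And>S. skew S \<Longrightarrow> act K S = S"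
  shows "K = mat 1 \<or> K = mat (-1)"
proof -
  have wd: "wd (K *v axis i 1) (K *v axis k 1) = wd (axis i 1) (axis k 1)" for i k
    using act[OF skew_wd] by (simp add: act_wd)
  have col: "(K *v axis i 1) $ m = K $ m $ i" for i m
    by (rule mult_axis_entry)
  have zero: "K $ m $ i = 0" if "m \<noteq> i" for m i
  proof -
    have "\<exists>k. k \<noteq> i \<and> k \<noteq> m"
    proof (rule ccontr)
      assume "\<nexists>k. k \<noteq> i \<and> k \<noteq> m"
      then have "(UNIV :: 4 set) \<subseteq> {i, m}" by auto
      then have "card (UNIV :: 4 set) \<le> card {i, m}" by (intro card_mono) auto
      then show False using card_insert_le_m1[of 2 "{m}" i] by simp
    qed
    then obtain k where "k \<noteq> i" "k \<noteq> m" by blast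
    then show ?thesis using wd_support[OF wd, of i k m] that by (simp add: col)
  qed
  have prod: "K $ i $ i * K $ k $ k = 1" if "i \<noteq> k" for i k
  proof -
    have "wd (K *v axis i 1) (K *v axis k 1) $ i $ k = 1"
      unfolding wd using that by (simp add: wd_def axis_def)
    then show ?thesis using zero that by (simp add: wd_def col)
  qed
  have diag: "K $ k $ k = K $ 1 $ 1" for k
  proof (cases "k = 1")
    case False
    obtain m where m: "m \<noteq> 1" "m \<noteq> k"
    proof (cases "k = 2")
      case True then show ?thesis using that[of 3] by simp
    next
      case False then show ?thesis using that[of 2] by simp
    qed
    have "K $ k $ k * K $ m $ m = K $ 1 $ 1 * K $ m $ m" "K $ m $ m \<noteq> 0"
      using prod[of k m] prod[of 1 m] m by auto
    then show ?thesis by simp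
  qed simp
  have "K $ 1 $ 1 * K $ 1 $ 1 = 1" using prod[of 1 2] diag[of 2] by simp
  then have "K $ 1 $ 1 = 1 \<or> K $ 1 $ 1 = -1" by (simp add: square_eq_1_iff)
  moreover have "K = mat (K $ 1 $ 1)" using zero diag by (simp add: vec_eq_iff mat_def)
  ultimately show ?thesis by metis
qed

lemma act_eq_imp:
  assumes "\<And>S. skew S \<Longrightarrow> act M S = act N S" "N' ** N = mat 1" "N ** N' = mat 1"
  shows "M = N \<or> M = mat (-1) ** N"
proof -
  have "act (N' ** M) S = S" if "skew S" for S
    using assms(1)[OF that] by (simp add: act_mult) (simp add: act_mult[symmetric] assms(2))
  then have "N' ** M = mat 1 \<or> N' ** M = mat (-1)" by (rule act_trivial)
  moreover have "M = N ** (N' ** M)" by (simp add: matrix_mul_assoc assms(3))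
  moreover have "N ** mat (-1) = mat (-1) ** N"
    using smat_mult(2)[of N "-1" "mat 1"] smat_mult(1)[of "-1" "mat 1" N]
    by (simp add: vec_eq_iff mat_def matrix_matrix_mult_def if_distrib[of "\<lambda>x. _ * x"]
        if_distrib[of "\<lambda>x. x * _"] cong: if_cong)
  ultimately show ?thesis by (metis matrix_mul_rid)
qed

lemma word_closed:
  fixes G (structure)
  assumes G: "group G" and S: "S \<subseteq> carrier G"
  shows "set ss \<subseteq> S \<Longrightarrow> foldr (\<otimes>) ss \<one> \<in> carrier G"
proof -
  interpret group G by fact
  show "set ss \<subseteq> S \<Longrightarrow> foldr (\<otimes>) ss \<one> \<in> carrier G" using S by (induction ss) auto
qed

lemma word_append:
  fixes G (structure)
  assumes G: "group G" and S: "S \<subseteq> carrier G" and ts: "set ts \<subseteq> S"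
  shows "set ss \<subseteq> S \<Longrightarrow>
    foldr (\<otimes>) (ss @ ts) \<one> = foldr (\<otimes>) ss \<one> \<otimes> foldr (\<otimes>) ts \<one>"
proof (induction ss)
  case Nil
  interpret group G by fact
  show ?case using word_closed[OF G S ts] by simp
next
  case (Cons a ss)
  interpret group G by fact
  show ?case using Cons word_closed[OF G S, of ss] word_closed[OF G S ts] S by (auto simp: m_assoc)
qed

lemma generate_words:
  fixes G (structure)
  assumes G: "group G" and S: "S \<subseteq> carrier G" and inv: "\<And>s. s \<in> S \<Longrightarrow> inv\<^bsub>G\<^esub> s = s"
    and x: "x \<in> generate G S"
  shows "\<exists>ss. set ss \<subseteq> S \<and> x = foldr (\<otimes>\<^bsub>G\<^esub>) ss \<one>\<^bsub>G\<^esub> \<and> inv\<^bsub>G\<^esub> x = foldr (\<otimes>\<^bsub>G\<^esub>) (rev ss) \<one>\<^bsub>G\<^esub>"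
proof -
  interpret group G by fact
  note cl = word_closed[OF G S]
  note app = word_append[OF G S]
  have inv_word: "inv (foldr (\<otimes>) ss \<one>) = foldr (\<otimes>) (rev ss) \<one>" if "set ss \<subseteq> S" for ss
    using that
  proof (induction ss)
    case (Cons a ss)
    then have "a \<in> carrier G" "foldr (\<otimes>) ss \<one> \<in> carrier G" using S cl by auto
    then show ?case using Cons app[of "[a]" "rev ss"] inv[of a] by (simp add: inv_mult_group)
  qed simp
  have "\<exists>ss. set ss \<subseteq> S \<and> x = foldr (\<otimes>) ss \<one>" using x
  proof (induction rule: generate.induct)
    case one
    show ?case by (rule exI[of _ "[]"]) simp
  next
    case (incl h)
    then show ?case using S by (intro exI[of _ "[h]"]) auto
  next
    case (inv h)
    then show ?case using S assms(3) by (intro exI[of _ "[h]"]) auto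
  next
    case (eng g h)
    then obtain ss ts where "set ss \<subseteq> S" "g = foldr (\<otimes>) ss \<one>" "set ts \<subseteq> S" "h = foldr (\<otimes>) ts \<one>" by blast
    then show ?case using app by (intro exI[of _ "ss @ ts"]) auto
  qed
  then show ?thesis using inv_word by blast
qed

lemma even_word_in_subgroup:
  fixes G (structure)
  assumes G: "group G" and K: "subgroup K G" and S: "S \<subseteq> carrier G"
    and pairs: "\<And>s t. s \<in> S \<Longrightarrow> t \<in> S \<Longrightarrow> s \<otimes>\<^bsub>G\<^esub> t \<in> K"
  shows "even (length ss) \<Longrightarrow> set ss \<subseteq> S \<Longrightarrow> foldr (\<otimes>\<^bsub>G\<^esub>) ss \<one>\<^bsub>G\<^esub> \<in> K"
proof (induction ss rule: induct_list012)
  case 1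
  then show ?case using subgroup.one_closed[OF K] by simp
next
  case (3 s t ss)
  interpret group G by fact
  note cl = word_closed[OF G S]
  have "(s \<otimes> t) \<otimes> foldr (\<otimes>) ss \<one> \<in> K"
    by (rule subgroup.m_closed[OF K]) (use 3 pairs in auto)
  moreover have "s \<in> carrier G" "t \<in> carrier G" using 3 S by auto
  ultimately show ?case using cl[of ss] 3 by (simp add: m_assoc)
qed simp

text \<open>Words in the simple reflections: commutators have even length, and words of even length are
  products of pairs.\<close>
lemma derived_in_even_subgroup:
  fixes G (structure)
  assumes G: "group G" and K: "subgroup K G" and S: "S \<subseteq> carrier G"
    and inv: "\<And>s. s \<in> S \<Longrightarrow> inv\<^bsub>G\<^esub> s = s"
    and pairs: "\<And>s t. s \<in> S \<Longrightarrow> t \<in> S \<Longrightarrow> s \<otimes>\<^bsub>G\<^esub> t \<in> K"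
  shows "derived G (generate G S) \<subseteq> K"
proof -
  interpret group G by fact
  note cl = word_closed[OF G S]
  note app = word_append[OF G S]
  have "x \<otimes> y \<otimes> inv x \<otimes> inv y \<in> K" if x: "x \<in> generate G S" and y: "y \<in> generate G S" for x y
  proof -
    obtain ss where ss: "set ss \<subseteq> S" "x = foldr (\<otimes>) ss \<one>" "inv x = foldr (\<otimes>) (rev ss) \<one>"
      using generate_words[OF G S inv x] by blast
    obtain ts where ts: "set ts \<subseteq> S" "y = foldr (\<otimes>) ts \<one>" "inv y = foldr (\<otimes>) (rev ts) \<one>"
      using generate_words[OF G S inv y] by blast
    have "foldr (\<otimes>) (((ss @ ts) @ rev ss) @ rev ts) \<one> \<in> K"
      by (rule even_word_in_subgroup[OF G K S pairs]) (use ss(1) ts(1) in auto)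
    moreover have "foldr (\<otimes>) (((ss @ ts) @ rev ss) @ rev ts) \<one>
      = foldr (\<otimes>) ss \<one> \<otimes> foldr (\<otimes>) ts \<one> \<otimes> foldr (\<otimes>) (rev ss) \<one> \<otimes> foldr (\<otimes>) (rev ts) \<one>"
      using ss(1) ts(1)
      by (simp only: app[of "rev ts" "(ss @ ts) @ rev ss"] app[of "rev ss" "ss @ ts"] app[of ts ss]
          set_append set_rev Un_least)
    then have "foldr (\<otimes>) (((ss @ ts) @ rev ss) @ rev ts) \<one> = x \<otimes> y \<otimes> inv x \<otimes> inv y"
      by (simp only: ss(2)[symmetric] ss(3)[symmetric] ts(2)[symmetric] ts(3)[symmetric])
    ultimately show ?thesis by simp
  qed
  then show ?thesis unfolding derived_def by (intro generate_subgroup_incl K) auto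
qed

text \<open>By the braid relation, \<open>s t = t s t s\<close>, and \<open>s\<close> and \<open>t\<close> are their own inverses.\<close>

lemma braid_imp_commutator:
  fixes G (structure)
  assumes G: "group G" and c: "s \<in> carrier G" "t \<in> carrier G"
    and inv: "s \<otimes>\<^bsub>G\<^esub> s = \<one>\<^bsub>G\<^esub>" "t \<otimes>\<^bsub>G\<^esub> t = \<one>\<^bsub>G\<^esub>"
    and braid: "s \<otimes>\<^bsub>G\<^esub> t \<otimes>\<^bsub>G\<^esub> s = t \<otimes>\<^bsub>G\<^esub> s \<otimes>\<^bsub>G\<^esub> t"
    and H: "s \<in> H" "t \<in> H"
  shows "s \<otimes>\<^bsub>G\<^esub> t \<in> derived G H"
proof -
  interpret group G by fact
  have i: "inv s = s" "inv t = t" using c inv by (auto intro: inv_equality)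
  have "t \<otimes> s \<otimes> t \<otimes> s = s \<otimes> t \<otimes> s \<otimes> s" using braid by simp
  also have "\<dots> = s \<otimes> t" using c inv by (simp add: m_assoc)
  finally have "s \<otimes> t = t \<otimes> s \<otimes> inv t \<otimes> inv s" by (simp add: i)
  then show ?thesis unfolding derived_def using H by (intro generate.incl) auto
qed

context wedge_coords
begin

lemma lmap_comp: "lmap M \<circ> lmap N = lmap (M ** N)"
  by (rule HOL.ext) (simp add: lmap_def psi_inv matrix_vector_mul_assoc)

lemma lmap_in_GL:
  assumes "M ** N = mat 1" "N ** M = mat 1"
  shows "lmap M \<in> carrier (GL sV)"
proof -
  have "bij (lmap M)"
    by (rule bij_betw_byWitness[where f' = "lmap N"])
      (auto simp: lmap_def psi_inv matrix_vector_mul_assoc assms)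
  moreover have "\<psi> (lmap M (x + y)) = \<psi> (lmap M x + lmap M y)" "\<psi> (lmap M (sV c x)) = \<psi> (sV c (lmap M x))"
    for x y c by (simp_all add: psi_lmap psi_add psi_scale matrix_vector_right_distrib vec.scale)
  then have "Vector_Spaces.linear sV sV (lmap M)"
    unfolding vlinear_iff psi_eq_iff using vs by simp
  ultimately show ?thesis by (simp add: GL_carrier)
qed

lemma GL_eq_lmap:
  assumes "g \<in> carrier (GL sV)"
  shows "\<exists>M. g = lmap M"
proof -
  have g: "g (x + y) = g x + g y" "g (sV c x) = sV c (g x)" for x y c
    using assms by (auto simp: GL_carrier vlinear_iff)
  have "inv_into UNIV \<psi> (x + y) = inv_into UNIV \<psi> x + inv_into UNIV \<psi> y"
    "inv_into UNIV \<psi> (c *s x) = sV c (inv_into UNIV \<psi> x)" for x y c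
    using psi_eq_iff psi_inv psi_add psi_scale by metis+
  then have "Vector_Spaces.linear (*s) (*s) (\<lambda>x. \<psi> (g (inv_into UNIV \<psi> x)))"
    unfolding vlinear_iff by (simp add: g psi_add psi_scale vec.vector_space_axioms)
  then have "matrix (\<lambda>x. \<psi> (g (inv_into UNIV \<psi> x))) *v x = \<psi> (g (inv_into UNIV \<psi> x))" for x
    by (rule matrix_works)
  then have "g v = lmap (matrix (\<lambda>x. \<psi> (g (inv_into UNIV \<psi> x)))) v" for v
    by (simp add: lmap_def psi_inv)
  then show ?thesis by blast
qed

lemma emap_comp: "emap M \<circ> emap N = emap (M ** N)"
  by (rule HOL.ext) (simp add: Phi_eq_iff[symmetric] Phi_emap act_mult)

lemma emap_mat: "emap (mat c) = s2 (c\<^sup>2)"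
proof
  fix x
  have "act (mat c) S = smat (c\<^sup>2) S" for S
    using act_smat(2)[of c "mat 1" S] by (simp add: smat_mat)
  then show "emap (mat c) x = s2 (c\<^sup>2) x"
    by (simp add: Phi_eq_iff[symmetric] Phi_emap Phi_scale)
qed

lemma emap_one: "emap (mat 1) = id"
  by (rule HOL.ext) (simp add: Phi_eq_iff[symmetric] Phi_emap)

lemma emap_in_GL:
  assumes "M ** N = mat 1" "N ** M = mat 1"
  shows "emap M \<in> carrier (GL s2)"
proof -
  have "emap M (emap N x) = x" "emap N (emap M x) = x" for x
    using assms by (simp_all add: Phi_eq_iff[symmetric] Phi_emap act_mult[symmetric])
  then have "bij (emap M)" by (intro bij_betw_byWitness[where f' = "emap N"]) auto
  then show ?thesis using emap_linear by (simp add: GL_carrier)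
qed

lemma emap_eq_act: "emap M = emap N \<Longrightarrow> skew S \<Longrightarrow> act M S = act N S"
  by (metis Phi_emap Phi_inv(1))

end

locale G32_coords = wedge_coords sV s2 wd2 \<psi> \<Phi> + cube_root w
  for sV :: "complex \<Rightarrow> 'v::ab_group_add \<Rightarrow> 'v" and s2 :: "complex \<Rightarrow> 'e::ab_group_add \<Rightarrow> 'e"
    and wd2 \<psi> \<Phi> w +
  fixes \<alpha> :: "nat \<Rightarrow> 'e" and \<sigma> :: "nat \<Rightarrow> 'e \<Rightarrow> 'e" and H :: "('e \<Rightarrow> 'e) set" and \<mu> :: complex
  assumes simple: "simple_system s2 \<alpha> \<sigma> H" and mu: "\<mu> \<noteq> 0"
    and Phi_root: "k \<in> {1..6} \<Longrightarrow> \<Phi> (\<alpha> k) = smat \<mu> (root k)"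
begin

lemma sigma_GL: "i \<in> {1..6} \<Longrightarrow> \<sigma> i \<in> carrier (GL s2)"
  using simple by (simp add: simple_system_def)

lemma root_norm: "i \<in> {1..6} \<Longrightarrow> pfb (root i) (root i) = 2"
  using root_gram cartan_diag by simp

lemma Phi_sigma:
  assumes i: "i \<in> {1..6}"
  shows "\<Phi> (\<sigma> i x) = refl (root i) (\<Phi> x)"
proof (rule linear_eq_on_spanning[OF vs(2), where D = "\<alpha> ` {1..6}" and r = smat and f = "\<lambda>x. \<Phi> (\<sigma> i x)"])
  have lin: "\<sigma> i (x + y) = \<sigma> i x + \<sigma> i y" "\<sigma> i (s2 c x) = s2 c (\<sigma> i x)" for x y c
    using sigma_GL[OF i] by (auto simp: GL_carrier vlinear_iff)
  have "\<sigma> i 0 = 0" using lin(1)[of 0 0] by simp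
  then show "\<Phi> (\<sigma> i 0) = refl (root i) (\<Phi> 0)" by (simp add: Phi_zero refl_def pfb_def[of 0] vec_eq_iff)
  have Phi_diff: "\<Phi> (x - y) = \<Phi> x - \<Phi> y" for x y using Phi_add[of "x - y" y] by simp
  show "\<Phi> (\<sigma> i x) = refl (root i) (\<Phi> x)" if xk: "x \<in> \<alpha> ` {1..6}" for x
  proof -
    obtain k where k: "k \<in> {1..6}" "x = \<alpha> k" using xk by blast
    have "\<sigma> i x = \<alpha> k - s2 (cartan_E6 i k) (\<alpha> i)"
      using simple i k by (simp add: simple_system_def)
    then have "\<Phi> (\<sigma> i x) = smat \<mu> (root k) - smat (cartan_E6 i k * \<mu>) (root i)"
      using i k by (simp add: Phi_diff Phi_scale Phi_root)
    also have "\<dots> = smat \<mu> (refl (root i) (root k))"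
      using root_gram[OF k(1) i] root_norm[OF i] cartan_sym[of k i]
      by (simp add: refl_def smat_diff mult.commute)
    finally show ?thesis using k by (simp add: Phi_root refl_smat)
  qed
qed (use simple sigma_GL[OF i] in \<open>auto simp: simple_system_def GL_carrier vlinear_iff Phi_add Phi_scale
      refl_add refl_smat\<close>)

lemma emap_spin:
  assumes "i \<in> {1..6}" "k \<in> {1..6}"
  shows "emap (spin (i, k)) = \<sigma> i \<circ> \<sigma> k"
proof
  fix x
  have "\<Phi> (emap (spin (i, k)) x) = \<Phi> (\<sigma> i (\<sigma> k x))"
    using act_mult_dual[OF root_skew root_skew Phi_skew, of i k x] assms
    by (simp add: Phi_emap spin_def Phi_sigma root_norm)
  then show "emap (spin (i, k)) x = (\<sigma> i \<circ> \<sigma> k) x" by (simp add: Phi_eq_iff)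
qed

lemma sigma_invol: "i \<in> {1..6} \<Longrightarrow> \<sigma> i \<circ> \<sigma> i = id"
  by (rule HOL.ext) (simp add: simple_reflection_involution[OF vs(2) simple])

lemma sigma_braid:
  assumes e: "i \<in> {1..6}" "k \<in> {1..6}" "cartan_E6 i k = -1"
  shows "\<sigma> i \<circ> \<sigma> k \<circ> \<sigma> i = \<sigma> k \<circ> \<sigma> i \<circ> \<sigma> k"
proof
  fix x
  have g: "pfb (root i) (root i) = 2" "pfb (root k) (root k) = 2" "pfb (root i) (root k) = -1"
    "pfb (root k) (root i) = -1"
    using root_gram[OF e(1,2)] root_norm e pfb_sym[of "root k" "root i"] by auto
  have "\<Phi> (\<sigma> i (\<sigma> k (\<sigma> i x))) = \<Phi> (\<sigma> k (\<sigma> i (\<sigma> k x)))"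
  proof -
    have r: "refl (root i) S = S - smat (pfb S (root i)) (root i)"
      "refl (root k) S = S - smat (pfb S (root k)) (root k)" for S
      by (simp_all add: refl_def g)
    show ?thesis
      unfolding Phi_sigma[OF e(1)] Phi_sigma[OF e(2)] r
      by (simp add: pfb_add pfb_diff pfb_smat g vec_eq_iff algebra_simps)
  qed
  then show "(\<sigma> i \<circ> \<sigma> k \<circ> \<sigma> i) x = (\<sigma> k \<circ> \<sigma> i \<circ> \<sigma> k) x" by (simp add: Phi_eq_iff)
qed

lemma edge_cartan: "(i, k) \<in> set edge_list \<Longrightarrow> i \<in> {1..6} \<and> k \<in> {1..6} \<and> cartan_E6 i k = -1"
  by (auto simp: edge_list_def cartan_E6_def E6_edges_def)

lemma group2: "group (GL s2)"
  by (rule GL_group[OF vs(2)])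

lemma sigma_H: "i \<in> {1..6} \<Longrightarrow> \<sigma> i \<in> H"
  using simple by (auto simp: simple_system_def intro: generate.incl)

lemma edge_in_derived:
  assumes "(i, k) \<in> set edge_list \<or> (k, i) \<in> set edge_list"
  shows "emap (spin (i, k)) \<in> derived (GL s2) H"
proof -
  have e: "i \<in> {1..6}" "k \<in> {1..6}" "cartan_E6 i k = -1"
    using assms edge_cartan cartan_sym[of i k] by auto
  have "\<sigma> i \<otimes>\<^bsub>GL s2\<^esub> \<sigma> k \<in> derived (GL s2) H"
    by (rule braid_imp_commutator[OF group2 sigma_GL[OF e(1)] sigma_GL[OF e(2)] _ _ _ sigma_H[OF e(1)] sigma_H[OF e(2)]])
      (simp_all only: GL_mult GL_one sigma_invol[OF e(1)] sigma_invol[OF e(2)] sigma_braid[OF e])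
  then show ?thesis using emap_spin[OF e(1,2)] by (simp add: GL_mult)
qed

definition ext_derived :: "('e \<Rightarrow> 'e) set" where
  "ext_derived = generate (GL s2) (derived (GL s2) H \<union> {s2 w})"

lemma G32_emap_GL: "M \<in> G32 \<Longrightarrow> emap M \<in> carrier (GL s2)"
  using G32_inverse emap_in_GL by blast

lemma scalar_GL: "s2 w = emap (mat (w * w))" "s2 w \<in> carrier (GL s2)"
proof -
  have "(w * w)\<^sup>2 = w * w ^ 3" by (simp add: power2_eq_square power3_eq_cube)
  then show "s2 w = emap (mat (w * w))" by (simp add: emap_mat w_cube)
  then show "s2 w \<in> carrier (GL s2)" using G32_emap_GL[OF mat_in_G32(1)] by simp
qed

lemma H_carrier: "H \<subseteq> carrier (GL s2)"
proof -
  have "\<sigma> ` {1..6} \<subseteq> carrier (GL s2)" using sigma_GL by blast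
  from group.generate_incl[OF group2 this] show ?thesis using simple by (simp only: simple_system_def)
qed

lemma ext_derived_subgroup: "subgroup ext_derived (GL s2)"
  using group.generate_is_subgroup[OF group2] group.derived_in_carrier[OF group2 H_carrier] scalar_GL(2)
  by (simp add: ext_derived_def)

lemma ext_derived_comp: "f \<in> ext_derived \<Longrightarrow> g \<in> ext_derived \<Longrightarrow> f \<circ> g \<in> ext_derived"
  using subgroup.m_closed[OF ext_derived_subgroup] by (simp add: GL_mult)

lemma ext_derived_id: "id \<in> ext_derived"
  using subgroup.one_closed[OF ext_derived_subgroup] by (simp add: GL_one)

lemma emap_foldl: "emap M \<in> ext_derived \<Longrightarrow> \<forall>K\<in>set Ks. emap K \<in> ext_derived \<Longrightarrow> emap (foldl (**) M Ks) \<in> ext_derived"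
proof (induction Ks arbitrary: M)
  case (Cons K Ks)
  have "emap (M ** K) \<in> ext_derived" using ext_derived_comp[of "emap M" "emap K"] Cons.prems by (simp add: emap_comp)
  then show ?case using Cons by simp
qed simp

lemma emap_rmat_in_ext_derived:
  assumes "b \<in> set gen_forms"
  shows "emap (rmat b) \<in> ext_derived"
proof -
  obtain es where es: "\<forall>(i, k)\<in>set es. (i, k) \<in> set edge_list \<or> (k, i) \<in> set edge_list"
    "rmat b = smat w (foldl (**) (mat 1) (map spin es))" using rmat_eq_spin_product[OF assms] by blast
  have "emap (spin e) \<in> ext_derived" if "e \<in> set es" for e
    using es(1) that edge_in_derived by (cases e) (auto simp: ext_derived_def intro!: generate.incl)
  then have word: "emap (foldl (**) (mat 1) (map spin es)) \<in> ext_derived"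
    by (intro emap_foldl) (auto simp: emap_one ext_derived_id)
  have "s2 w \<in> ext_derived" unfolding ext_derived_def by (rule generate.incl) simp
  have "emap (mat w) \<in> ext_derived"
  proof -
    have "w * w * (w * w) = w * w ^ 3" by (simp add: power3_eq_cube)
    then have "w * w * (w * w) = w" by (simp add: w_cube)
    moreover have "emap (mat (w * w) ** mat (w * w)) \<in> ext_derived"
      using ext_derived_comp[of "s2 w" "s2 w"] \<open>s2 w \<in> ext_derived\<close> unfolding scalar_GL(1) emap_comp by blast
    ultimately show ?thesis by (simp only: mat_mult)
  qed
  from ext_derived_comp[OF this word] show ?thesis unfolding es(2) by (simp add: emap_comp smat_eq_mat)
qed

lemma G32_in_ext_derived: "M \<in> G32 \<Longrightarrow> emap M \<in> ext_derived"
proof (induction rule: G32.induct)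
  case one
  show ?case unfolding emap_one by (rule ext_derived_id)
next
  case (step M b)
  then show ?case using ext_derived_comp[OF emap_rmat_in_ext_derived[OF step(2)] step(3)] by (simp add: emap_comp)
qed

lemma emap_G32_subgroup: "subgroup (emap ` G32) (GL s2)"
proof -
  interpret group "GL s2" by (rule group2)
  show ?thesis
  proof (rule subgroupI)
    show "emap ` G32 \<subseteq> carrier (GL s2)" using G32_emap_GL by blast
    show "emap ` G32 \<noteq> {}" using G32.one by blast
  next
    fix f assume "f \<in> emap ` G32"
    then obtain M where M: "M \<in> G32" "f = emap M" by blast
    obtain M' where M': "M' \<in> G32" "M' ** M = mat 1" using G32_inverse[OF M(1)] by blast
    have "inv\<^bsub>GL s2\<^esub> f = emap M'"
      by (rule inv_equality) (use M M' G32_emap_GL in \<open>auto simp: GL_mult GL_one emap_comp emap_one\<close>)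
    then show "inv\<^bsub>GL s2\<^esub> f \<in> emap ` G32" using M'(1) by simp
  next
    fix f g assume "f \<in> emap ` G32" "g \<in> emap ` G32"
    then show "f \<otimes>\<^bsub>GL s2\<^esub> g \<in> emap ` G32" by (auto simp: GL_mult emap_comp intro: G32_mult)
  qed
qed

text \<open>The image contains the products along edges, and the diagram is connected: every node is joined
  to the node 4.\<close>

lemma sigma_pair_in_image:
  assumes "i \<in> {1..6}" "k \<in> {1..6}"
  shows "\<sigma> i \<circ> \<sigma> k \<in> emap ` G32"
proof -
  have comp: "f \<circ> g \<in> emap ` G32" if "f \<in> emap ` G32" "g \<in> emap ` G32" for f g
    using subgroup.m_closed[OF emap_G32_subgroup that] by (simp add: GL_mult)
  have edge: "\<sigma> a \<circ> \<sigma> b \<in> emap ` G32" if "(a, b) \<in> set edge_list" for a b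
    using emap_spin[of a b] edge_cartan[OF that] spin_in_G32[OF that] by (metis image_eqI)
  have path: "\<sigma> a \<circ> \<sigma> c \<in> emap ` G32"
    if "\<sigma> a \<circ> \<sigma> b \<in> emap ` G32" "\<sigma> b \<circ> \<sigma> c \<in> emap ` G32" "b \<in> {1..6}" for a b c
  proof -
    have "(\<sigma> a \<circ> \<sigma> b) \<circ> (\<sigma> b \<circ> \<sigma> c) = \<sigma> a \<circ> (\<sigma> b \<circ> \<sigma> b) \<circ> \<sigma> c" by (simp add: comp_assoc)
    then show ?thesis using comp[OF that(1,2)] sigma_invol[OF that(3)] by simp
  qed
  have flip: "\<sigma> b \<circ> \<sigma> a \<in> emap ` G32" if "\<sigma> a \<circ> \<sigma> b \<in> emap ` G32" "a \<in> {1..6}" "b \<in> {1..6}" for a b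
  proof -
    have "inv\<^bsub>GL s2\<^esub> (\<sigma> a \<circ> \<sigma> b) = \<sigma> b \<circ> \<sigma> a"
    proof (rule group.inv_equality[OF group2])
      have "\<sigma> b \<circ> \<sigma> a \<circ> (\<sigma> a \<circ> \<sigma> b) = \<sigma> b \<circ> (\<sigma> a \<circ> \<sigma> a) \<circ> \<sigma> b" by (simp add: comp_assoc)
      also have "\<dots> = id" by (simp only: sigma_invol[OF that(2)] sigma_invol[OF that(3)] comp_id)
      finally show "(\<sigma> b \<circ> \<sigma> a) \<otimes>\<^bsub>GL s2\<^esub> (\<sigma> a \<circ> \<sigma> b) = \<one>\<^bsub>GL s2\<^esub>"
        unfolding GL_mult GL_one .
    qed (use group.is_monoid[OF group2] sigma_GL that monoid.m_closed[of "GL s2"] in \<open>auto simp: GL_mult\<close>)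
    then show ?thesis using subgroup.m_inv_closed[OF emap_G32_subgroup that(1)] by simp
  qed
  have "\<sigma> 4 \<circ> \<sigma> a \<in> emap ` G32" if "a \<in> {1..6}" for a
  proof -
    have e: "\<sigma> 1 \<circ> \<sigma> 3 \<in> emap ` G32" "\<sigma> 3 \<circ> \<sigma> 4 \<in> emap ` G32" "\<sigma> 2 \<circ> \<sigma> 4 \<in> emap ` G32"
      "\<sigma> 4 \<circ> \<sigma> 5 \<in> emap ` G32" "\<sigma> 5 \<circ> \<sigma> 6 \<in> emap ` G32"
      by (auto intro!: edge simp: edge_list_def)
    have "\<sigma> 4 \<circ> \<sigma> 4 = id" by (rule sigma_invol) simp
    then have "\<sigma> 4 \<circ> \<sigma> 4 \<in> emap ` G32" using emap_one G32.one by (metis image_eqI)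
    moreover have "\<sigma> 4 \<circ> \<sigma> 3 \<in> emap ` G32" "\<sigma> 4 \<circ> \<sigma> 2 \<in> emap ` G32" "\<sigma> 3 \<circ> \<sigma> 1 \<in> emap ` G32"
      using flip[OF e(2)] flip[OF e(3)] flip[OF e(1)] by auto
    moreover have "\<sigma> 4 \<circ> \<sigma> 6 \<in> emap ` G32" using path[OF e(4,5)] by simp
    moreover have "\<sigma> 4 \<circ> \<sigma> 1 \<in> emap ` G32" using path[of 4 3 1] calculation by simp
    ultimately show ?thesis using e that unfolding one_to_six by (elim disjE) simp_all
  qed
  then have "\<sigma> i \<circ> \<sigma> 4 \<in> emap ` G32" "\<sigma> 4 \<circ> \<sigma> k \<in> emap ` G32"
    using flip[of 4 i] assms by auto
  then show ?thesis by (rule path) simp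
qed

lemma ext_derived_in_image: "ext_derived \<subseteq> emap ` G32"
proof -
  have "derived (GL s2) (generate (GL s2) (\<sigma> ` {1..6})) \<subseteq> emap ` G32"
  proof (rule derived_in_even_subgroup[OF group2 emap_G32_subgroup])
    show "\<sigma> ` {1..6} \<subseteq> carrier (GL s2)" using sigma_GL by blast
    show "inv\<^bsub>GL s2\<^esub> s = s" if "s \<in> \<sigma> ` {1..6}" for s
      using that sigma_GL sigma_invol
      by (auto intro!: group.inv_equality[OF group2] simp: GL_mult GL_one)
    show "s \<otimes>\<^bsub>GL s2\<^esub> t \<in> emap ` G32" if "s \<in> \<sigma> ` {1..6}" "t \<in> \<sigma> ` {1..6}" for s t
      using that sigma_pair_in_image by (auto simp: GL_mult)
  qed
  then have "derived (GL s2) H \<subseteq> emap ` G32" using simple by (simp add: simple_system_def)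
  moreover have "s2 w \<in> emap ` G32" using scalar_GL(1) mat_in_G32(1) by auto
  ultimately show ?thesis
    unfolding ext_derived_def by (intro group.generate_subgroup_incl[OF group2 _ emap_G32_subgroup]) auto
qed

text \<open>A matrix is determined up to sign by its action on the exterior square, and the signs belong to the
  group.\<close>

theorem preimage_eq_G32:
  "{g \<in> carrier (GL sV). exterior_power_map 2 s2 wd2 g
      \<in> generate (GL s2) (derived (GL s2) H \<union> {s2 w})} = lmap ` G32"
  unfolding ext_derived_def[symmetric]
proof (intro equalityI subsetI)
  fix g assume "g \<in> {g \<in> carrier (GL sV). exterior_power_map 2 s2 wd2 g \<in> ext_derived}"
  then have g: "g \<in> carrier (GL sV)" "exterior_power_map 2 s2 wd2 g \<in> ext_derived" by auto
  obtain M where "g = lmap M" using GL_eq_lmap[OF g(1)] by blast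
  with g(2) have M: "g = lmap M" "emap M \<in> ext_derived" by (simp_all add: exterior_power_map_lmap)
  then obtain M' where M': "M' \<in> G32" "emap M = emap M'" using ext_derived_in_image by blast
  obtain K where "K ** M' = mat 1" "M' ** K = mat 1" using G32_inverse[OF M'(1)] by blast
  from act_eq_imp[OF emap_eq_act[OF M'(2)] this] have "M = M' \<or> M = mat (-1) ** M'" by simp
  then have "M \<in> G32" using M'(1) G32_mult[OF mat_in_G32(3) M'(1)] by auto
  then show "g \<in> lmap ` G32" using M(1) by simp
next
  fix g assume "g \<in> lmap ` G32"
  then obtain M where M: "M \<in> G32" "g = lmap M" by blast
  have "lmap M \<in> carrier (GL sV)" using G32_inverse[OF M(1)] lmap_in_GL by blast
  then show "g \<in> {g \<in> carrier (GL sV). exterior_power_map 2 s2 wd2 g \<in> ext_derived}"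
    using G32_in_ext_derived[OF M(1)] M(2) by (simp add: exterior_power_map_lmap)
qed

theorem preimage_iso:
  "(GL sV)\<lparr>carrier := lmap ` G32\<rparr> \<cong> (GL (*s))\<lparr>carrier := G32_maps\<rparr>"
proof -
  define f where "f g = (\<lambda>x. \<psi> (g (inv_into UNIV \<psi> x)))" for g
  have f: "f (lmap M) = (*v) M" for M by (rule HOL.ext) (simp add: f_def lmap_def psi_inv)
  have "f \<in> hom ((GL sV)\<lparr>carrier := lmap ` G32\<rparr>) ((GL (*s))\<lparr>carrier := G32_maps\<rparr>)"
    by (rule homI) (auto simp: f G32_maps_def GL_mult lmap_comp mult_vec_comp)
  moreover have "inj_on f (lmap ` G32)"
  proof (rule inj_onI)
    fix g h assume "g \<in> lmap ` G32" "h \<in> lmap ` G32" "f g = f h"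
    then obtain M M' where "g = lmap M" "h = lmap M'" "(*v) M = (*v) M'" by (auto simp: f)
    then show "g = h" by (metis matrix_eq)
  qed
  moreover have "f ` lmap ` G32 = G32_maps" by (auto simp: image_image f G32_maps_def)
  ultimately have "f \<in> iso ((GL sV)\<lparr>carrier := lmap ` G32\<rparr>) ((GL (*s))\<lparr>carrier := G32_maps\<rparr>)"
    by (auto simp: iso_def bij_betw_def)
  then show ?thesis by (auto simp: is_iso_def)
qed

end

theorem mainTheorem2:
  fixes sV :: "complex \<Rightarrow> 'v::ab_group_add \<Rightarrow> 'v"
    and s2 :: "complex \<Rightarrow> 'e::ab_group_add \<Rightarrow> 'e"
    and s4 :: "complex \<Rightarrow> 'f::ab_group_add \<Rightarrow> 'f"
    and wedge2 :: "'v list \<Rightarrow> 'e"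
    and wedge4 :: "'v list \<Rightarrow> 'f"
    and \<epsilon> :: 'f
    and j :: complex
    and E6 :: "('e \<Rightarrow> 'e) set"
    and W :: "('v \<Rightarrow> 'v) set"
  assumes V: "vector_space sV" "vector_space.dim sV UNIV = 4"
    and ext2: "is_exterior_power 2 sV s2 wedge2"
    and ext4: "is_exterior_power 4 sV s4 wedge4"
    and generator: "module.span s4 {\<epsilon>} = UNIV"
    and j: "j ^ 3 = 1" "j \<noteq> 1"
    and E6: "is_weyl_group_E6 s2 E6" "finite E6"
      "E6 \<subseteq> orthogonal_group s2 (beta_wedge s2 s4 wedge2 wedge4 \<epsilon>)"
    and W_def: "W = {g \<in> carrier (GL sV). exterior_power_map 2 s2 wedge2 g
                       \<in> generate (GL s2) (derived (GL s2) E6 \<union> {s2 j})}"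
  shows "\<exists>G :: (complex ^ 4 \<Rightarrow> complex ^ 4) set.
           is_shephard_todd_G32 (*s) G \<and>
           (GL sV)\<lparr>carrier := W\<rparr> \<cong> (GL (*s))\<lparr>carrier := G\<rparr>"
proof -
  have "(j - 1) * (j\<^sup>2 + j + 1) = j ^ 3 - 1" by (simp add: power2_eq_square power3_eq_cube algebra_simps)
  then have "cube_root j" using j by (simp add: cube_root_def)
  then interpret cube_root j .
  obtain \<psi> \<Phi> where "wedge_coords sV s2 wedge2 \<psi> \<Phi>"
    using wedge_coords_exist[OF V(2) ext2] by blast
  then interpret wc: wedge_coords sV s2 wedge2 \<psi> \<Phi> .
  obtain \<kappa> where \<kappa>: "\<kappa> \<noteq> 0"
    "\<And>x y. beta_wedge s2 s4 wedge2 wedge4 \<epsilon> x y = \<kappa> * pfb (\<Phi> x) (\<Phi> y)"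
    using wc.beta_wedge_eq_pfb[OF ext4 generator] by blast
  obtain \<psi>' \<Phi>' \<alpha> \<sigma> \<mu> where nf: "wedge_coords sV s2 wedge2 \<psi>' \<Phi>'" "simple_system s2 \<alpha> \<sigma> E6"
    "\<mu> \<noteq> 0" "\<forall>k\<in>{1..6}. \<Phi>' (\<alpha> k) = smat \<mu> (root k)"
    using wc.simple_system_normal_form[OF E6(1,3) \<kappa> root_skew root_gram] by blast
  interpret G32_coords sV s2 wedge2 \<psi>' \<Phi>' j \<alpha> \<sigma> E6 \<mu>
    using nf \<open>cube_root j\<close> by (simp add: G32_coords_def G32_coords_axioms_def)
  have "W = lmap ` G32" unfolding W_def by (rule preimage_eq_G32)
  then show ?thesis using G32_maps_shephard_todd preimage_iso by blast
qed

end
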